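(* For all $j_1,j_2\in\tfrac12\mathbb{N}^+$, \[ R^{(j_1,j_2)}(t/s)\star K^{(j_1)}_{1}(s)\star \widehat R^{(j_1,j_2)}\star K^{(j_2)}_{2}(t)=K^{(j_2)}_{2}(t)\star \widehat R^{(j_1,j_2)}\star K^{(j_1)}_{1}(s)\star R^{(j_1,j_2)}(t/s), \] where $K^{(j_1)}_1(s)=K^{(j_1)}(s)\otimes I_{2j_2+1}$ and $K^{(j_2)}_2(t)=I_{2j_1+1}\otimes K^{(j_2)}(t)$. Here both sides are $(2j_1+1)(2j_2+1)$-square matrices whose entries are formal Laurent series in the indeterminates $s,t$ with coefficients in $\mathbb{V}$.
   Context: Conventions. $\mathbb{F}$ is a field of characteristic zero in which every element has a square root. Fix $q\in\mathbb{F}$ nonzero and not a root of unity, and a square root $q^{1/2}\in\mathbb{F}$; $q^{k/2}:=(q^{1/2})^k$ for $k\in\mathbb{Z}$. Any other expression $(\cdot)^{1/2}$ below denotes a fixed choice of square root in $\mathbb{F}$. For $n\in\mathbb{Z}$, $[n]_q=\frac{q^n-q^{-n}}{q-q^{-1}}$; for $n\in\mathbb{N}$, $[n]_q^!=[n]_q[n-1]_q\cdots[1]_q$, $[0]_q^!=1$. $c(t)=t-t^{-1}$. $\tfrac12\mathbb{N}^+=\{\tfrac12,1,\tfrac32,\dots\}$. $I_n$ is the $n\times n$ identity, $\otimes$ of matrices is the Kronecker product, $t,s$ are indeterminates. Leg notation. For tensor factors $\mathbb{F}^{n_1}\otimes\mathbb{F}^{n_2}\otimes\mathbb{F}^{n_3}$: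 for a matrix $X$ on factors 1,2 put $X_{12}=X\otimes I_{n_3}$; on factors 2,3 put $X_{23}=I_{n_1}\otimes X$; on factors 1,3, $X_{13}=P(X\otimes I_{n_2})P$ where $P$ is the flip of factors 2 and 3. For non-square matrices $Y$ also $Y_{12}=Y\otimes I_{n_3}$, $Y_{23}=I_{n_1}\otimes Y$. Fusion matrices. For $j\in\tfrac12\mathbb{N}^+$, $\mathcal{E}^{(j+\frac12)}$ is the $(4j+2)\times(2j+2)$ matrix whose only nonzero entries are $\mathcal{E}_{(a,a)}=\big(\frac{[2j+2-a]_q}{[2j+1]_q}\big)^{1/2}$ and $\mathcal{E}_{(a+2j+1,a+1)}=\big(\frac{[a]_q}{[2j+1]_q}\big)^{1/2}$, $1\le a\le 2j+1$; $\mathcal{F}^{(j+\frac12)}$ is the $(2j+2)\times(4j+2)$ matrix whose only nonzero entries are $\mathcal{F}_{(a,a)}=\frac{([2j+2-a]_q[2j+1]_q)^{1/2}}{[2j+2-a]_q+[a-1]_q}$ and $\mathcal{F}_{(a+1,a+2j+1)}=\frac{([a]_q[2j+1]_q)^{1/2}}{[2j+1-a]_q+[a]_q}$, $1\le a\le 2j+1$. (The $4j+2$ side is $\mathbb{F}^2\otimes\mathbb{F}^{2j+1}$.) R-matrices. $R^{(\frac12,\frac12)}(t)$ is the $4\times 4$ matrix with rows $(c(qt),0,0,0)$, $(0,c(t),c(q),0)$, $(0,c(q),c(t),0)$, $(0,0,0,c(qt))$. For $j_1,j_2\in\tfrac12\mathbb{N}^+$ the $(2j_1+1)(2j_2+1)$-square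 matrix $R^{(j_1,j_2)}(t)$ (entries Laurent polynomials in $t$ over $\mathbb{F}$) is defined recursively by $R^{(\frac12,j+\frac12)}(t)=\mathcal{F}^{(j+\frac12)}_{23}R^{(\frac12,j)}_{13}(q^{-1/2}t)R^{(\frac12,\frac12)}_{12}(q^{j}t)\mathcal{E}^{(j+\frac12)}_{23}$ (factors of sizes $2,2,2j+1$) and $R^{(j_1+\frac12,j_2)}(t)=\mathcal{F}^{(j_1+\frac12)}_{12}R^{(\frac12,j_2)}_{13}(q^{-j_1}t)R^{(j_1,j_2)}_{23}(q^{1/2}t)\mathcal{E}^{(j_1+\frac12)}_{12}$ (factors of sizes $2,2j_1+1,2j_2+1$). $\widehat R^{(j_1,j_2)}=q^{2\,\mathrm{diag}(j_1,j_1-1,\dots,-j_1)\otimes\mathrm{diag}(j_2,j_2-1,\dots,-j_2)}$, the diagonal matrix with entries $q^{2\alpha\beta}$. q-shuffle algebra. $\mathbb{V}$ is the free algebra on letters $x,y$ with basis the words (trivial word $\mathbf{1}$). The $q$-shuffle product $\star$ on $\mathbb{V}$ is the bilinear product with $\mathbf 1\star v=v\star\mathbf 1=v$ and, for nonempty words $u=u_1\cdots u_r$, $v=v_1\cdots v_s$, $u\star v=u_1\big((u_2\cdots u_r)\star v\big)+v_1\big(u\star(v_2\cdots v_s)\big)q^{\langle v_1,u_1\rangle+\cdots+\langle v_1,u_r\rangle}$ (juxtaposition = concatenation), where $\langle x,x\rangle=\langle y,y\rangle=2$, $\langle x,y\rangle=\langle y,x\rangle=-2$; $(\mathbb{V},\star)$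 is an associative algebra. For matrices with entries in $\mathbb{V}$ or in formal series over $\mathbb{V}$ (scalars from $\mathbb{F}$ or $\mathbb{F}[t^{\pm1},s^{\pm1}]$ being regarded as multiples of $\mathbf 1$), $A\star B$ is the matrix product with entries multiplied via $\star$ (bilinearly in the indeterminates). Catalan words and $\Delta$. Put $\bar x=1$, $\bar y=-1$. A word $a_1\cdots a_n$ is Catalan if $\bar a_1+\dots+\bar a_i\ge 0$ for $1\le i\le n-1$ and $\bar a_1+\dots+\bar a_n=0$; $\mathrm{Cat}_n$ is the set of Catalan words of length $2n$. For $m\in\mathbb{Z}$, $n\in\mathbb{N}$: $\Delta^{(m)}_n=\sum_{a_1\cdots a_{2n}\in\mathrm{Cat}_n}\prod_{i=1}^{2n}\big[\bar a_1+\dots+\bar a_{i-1}+m(\bar a_i+1)/2\big]_q\,a_1\cdots a_{2n}$ (so $\Delta^{(m)}_0=\mathbf 1$), and $\Delta^{(m)}(t)=\sum_{n\in\mathbb{N}}\Delta^{(m)}_n t^n$. Deletion. For a word $w=a_1\cdots a_n$, $n\ge1$: $x^{-1}w=a_2\cdots a_n$ if $a_1=x$ and $0$ if $a_1=y$; $x^{-1}\mathbf 1=0$; $y^{-1}w$ analogously (delete a leading $y$), and $wx^{-1}$, $wy^{-1}$ delete a trailing $x$, resp. $y$ (else $0$). These are extended linearly and coefficientwise to series; for $k\ge 1$, $x^{-k}$ means applying $x^{-1}$ $k$ times, and $x^0$ is the identity (same for $y$). K-matrix. For $j\in\tfrac12\mathbb{N}^+$, $K^{(j)}(t)$ is the $(2j+1)\times(2j+1)$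 matrix with $K^{(j)}_{(a,b)}(t)=\varphi(a,b,j)\,t^{a-b-2j}\,x^{1-b}\Delta^{(-2j)}(-t^2)y^{a-2j-1}$, where $\Delta^{(-2j)}(-t^2)=\sum_n(-1)^n\Delta^{(-2j)}_nt^{2n}$, $\varphi(a,b,j)=q^{\rho(a,b,j)}([2j]_q^!)^{-1}\Big(\frac{[a-1]_q^![2j+1-b]_q^!}{[b-1]_q^![2j+1-a]_q^!}\Big)^{1/2}$ and $\rho(a,b,j)=(a^2+b^2+6j^2+4ab-6aj-6bj-6a-6b+13j+6)/2$.
   Formalization: The square roots in E, F and φ are not chosen independently: a square root of each [n]_q is fixed, and every other radical is the corresponding product or quotient of these; for unrelated choices of signs the equation can fail. *)

theory Defs
  imports Main "HOL-Library.Function_Algebras"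
begin

(* Conventions:
   * the field F is a type 'a :: field_char_0;
   * j in 1/2 N^+ is represented by d = 2j :: nat, d >= 1 (matrix size d+1);
   * matrices are functions nat => nat => entry, indexed from 0 (paper index a <-> a-1);
   * Kronecker product (A (x) B)(i*nB+k, j*mB+l) = A(i,j) B(k,l) (standard row-major). *)

datatype letter = X | Y

type_synonym 'a vec = "letter list \<Rightarrow> 'a"          (* element of V: coefficient of each word *)
type_synonym 'a ser = "int \<Rightarrow> int \<Rightarrow> 'a vec"    (* f i k = coefficient of s^i t^k, in V *)
type_synonym 'a lp  = "int \<Rightarrow> 'a"                  (* Laurent polynomial in t: p e = coeff of t^e *)
type_synonym 'b mat = "nat \<Rightarrow> nat \<Rightarrow> 'b"

definition qint :: "'a::field \<Rightarrow> int \<Rightarrow> 'a" where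
  "qint q n = (q powi n - q powi (- n)) / (q - inverse q)"

definition qfact :: "'a::field \<Rightarrow> nat \<Rightarrow> 'a" where
  "qfact q n = (\<Prod>k = 1..n. qint q (int k))"

(* product of the fixed square roots r k of [k]_q, k = 1..n: a square root of [n]_q^! *)
definition rfact :: "(nat \<Rightarrow> 'a::field) \<Rightarrow> nat \<Rightarrow> 'a" where
  "rfact r n = (\<Prod>k = 1..n. r k)"

definition bra :: "letter \<Rightarrow> letter \<Rightarrow> int" where
  "bra a b = (if a = b then 2 else -2)"

definition single :: "letter list \<Rightarrow> 'a::zero_neq_one vec" where
  "single w = (\<lambda>w'. if w' = w then 1 else 0)"

definition prepend :: "letter \<Rightarrow> 'a::zero vec \<Rightarrow> 'a vec" where
  "prepend c f = (\<lambda>w. case w of [] \<Rightarrow> 0 | d # w' \<Rightarrow> if d = c then f w' else 0)"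

fun shuf :: "'a::field \<Rightarrow> letter list \<Rightarrow> letter list \<Rightarrow> 'a vec" where
  "shuf q [] v = single v"
| "shuf q (a # u) [] = single (a # u)"
| "shuf q (a # u) (b # v) =
     (\<lambda>w. prepend a (shuf q u (b # v)) w
          + q powi (\<Sum>c \<leftarrow> a # u. bra b c) * prepend b (shuf q (a # u) v) w)"

(* bilinear extension of the q-shuffle to (finitely supported) elements of V *)
definition vmul :: "'a::field \<Rightarrow> 'a vec \<Rightarrow> 'a vec \<Rightarrow> 'a vec" where
  "vmul q u v = (\<lambda>w. \<Sum>p \<in> {p. u (fst p) \<noteq> 0 \<and> v (snd p) \<noteq> 0}.
                        u (fst p) * v (snd p) * shuf q (fst p) (snd p) w)"

definition smul :: "'a::field \<Rightarrow> 'a ser \<Rightarrow> 'a ser \<Rightarrow> 'a ser" where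
  "smul q A B = (\<lambda>m n. \<Sum>p \<in> {p. A (fst p) (snd p) \<noteq> 0 \<and> B (m - fst p) (n - snd p) \<noteq> 0}.
                          vmul q (A (fst p) (snd p)) (B (m - fst p) (n - snd p)))"

definition mmul :: "'a::field \<Rightarrow> nat \<Rightarrow> 'a ser mat \<Rightarrow> 'a ser mat \<Rightarrow> 'a ser mat" where
  "mmul q n A B = (\<lambda>a b. \<Sum>c<n. smul q (A a c) (B c b))"

definition bar :: "letter \<Rightarrow> int" where
  "bar a = (if a = X then 1 else -1)"

definition height :: "letter list \<Rightarrow> int" where
  "height w = sum_list (map bar w)"

definition catalan :: "letter list \<Rightarrow> bool" where
  "catalan w \<longleftrightarrow> (\<forall>i. 1 \<le> i \<and> i \<le> length w - 1 \<longrightarrow> height (take i w) \<ge> 0) \<and> height w = 0"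

definition Cat :: "nat \<Rightarrow> letter list set" where
  "Cat n = {w. length w = 2 * n \<and> catalan w}"

definition Delta :: "'a::field \<Rightarrow> int \<Rightarrow> nat \<Rightarrow> 'a vec" where
  "Delta q m n = (\<lambda>w. if w \<in> Cat n
       then (\<Prod>i < 2 * n. qint q (height (take i w) + (if w ! i = X then m else 0)))
       else 0)"

(* 2*rho(a,b,j), with paper (1-based) indices a b and d = 2j; the division is exact *)
definition rho2 :: "int \<Rightarrow> int \<Rightarrow> int \<Rightarrow> int" where
  "rho2 a b d = (2*a^2 + 2*b^2 + 3*d^2 + 8*a*b - 6*a*d - 6*b*d - 12*a - 12*b + 13*d + 12) div 2"

(* phi(a+1, b+1, d/2) for 0-based a b; q^rho = (q^(1/2))^(2 rho) *)
definition phi :: "'a::field \<Rightarrow> 'a \<Rightarrow> (nat \<Rightarrow> 'a) \<Rightarrow> nat \<Rightarrow> nat \<Rightarrow> nat \<Rightarrow> 'a" where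
  "phi q qh r d a b = qh powi (rho2 (int a + 1) (int b + 1) (int d)) * inverse (qfact q d)
      * ((rfact r a * rfact r (d - b)) / (rfact r b * rfact r (d - a)))"

(* entry (a+1,b+1) of K^{(d/2)}(t) as a Laurent series in t: e |-> coefficient of t^e *)
definition Kser :: "'a::field \<Rightarrow> 'a \<Rightarrow> (nat \<Rightarrow> 'a) \<Rightarrow> nat \<Rightarrow> nat \<Rightarrow> nat \<Rightarrow> int \<Rightarrow> 'a vec" where
  "Kser q qh r d a b = (\<lambda>e. let m = e - (int a - int b - int d) in
      if 0 \<le> m \<and> even m then
        (\<lambda>w. phi q qh r d a b * (-1) ^ (nat m div 2)
              * Delta q (- int d) (nat m div 2) (replicate b X @ w @ replicate (d - a) Y))
      else 0)"

(* X_{12} = X (x) I_{n3} *)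
definition leg12 :: "nat \<Rightarrow> 'b::zero mat \<Rightarrow> 'b mat" where
  "leg12 n3 M = (\<lambda>a b. if a mod n3 = b mod n3 then M (a div n3) (b div n3) else 0)"

(* X_{23} = I_{n1} (x) X, X of size p x m *)
definition leg23 :: "nat \<Rightarrow> nat \<Rightarrow> 'b::zero mat \<Rightarrow> 'b mat" where
  "leg23 p m M = (\<lambda>a b. if a div p = b div m then M (a mod p) (b mod m) else 0)"

(* X_{13} = P (X (x) I_{n2}) P, P the flip of factors 2,3; written out entrywise *)
definition leg13 :: "nat \<Rightarrow> nat \<Rightarrow> 'b::zero mat \<Rightarrow> 'b mat" where
  "leg13 n2 n3 M = (\<lambda>a b. if (a div n3) mod n2 = (b div n3) mod n2
       then M ((a div (n2 * n3)) * n3 + a mod n3) ((b div (n2 * n3)) * n3 + b mod n3) else 0)"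

(* E^{(d/2 + 1/2)}, size (2d+2) x (d+2), 0-based; square roots via r *)
definition Emat :: "'a::field \<Rightarrow> (nat \<Rightarrow> 'a) \<Rightarrow> nat \<Rightarrow> 'a mat" where
  "Emat q r d = (\<lambda>i k.
      if i \<le> d \<and> k = i then r (d + 1 - i) / r (d + 1)
      else if d + 1 \<le> i \<and> i \<le> 2 * d + 1 \<and> k = i - d then r (i - d) / r (d + 1)
      else 0)"

(* F^{(d/2 + 1/2)}, size (d+2) x (2d+2), 0-based *)
definition Fmat :: "'a::field \<Rightarrow> (nat \<Rightarrow> 'a) \<Rightarrow> nat \<Rightarrow> 'a mat" where
  "Fmat q r d = (\<lambda>i k.
      if i \<le> d \<and> k = i then
        r (d + 1 - i) * r (d + 1) / (qint q (int (d + 1 - i)) + qint q (int i))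
      else if 1 \<le> i \<and> i \<le> d + 1 \<and> k = i + d then
        r i * r (d + 1) / (qint q (int (d + 1 - i)) + qint q (int i))
      else 0)"

definition lpmul :: "'a::field lp \<Rightarrow> 'a lp \<Rightarrow> 'a lp" where
  "lpmul p r = (\<lambda>n. \<Sum>i \<in> {i. p i \<noteq> 0 \<and> r (n - i) \<noteq> 0}. p i * r (n - i))"

definition lmmul :: "nat \<Rightarrow> 'a::field lp mat \<Rightarrow> 'a lp mat \<Rightarrow> 'a lp mat" where
  "lmmul n A B = (\<lambda>a b. \<Sum>c<n. lpmul (A a c) (B c b))"

definition lscale :: "'a::field \<Rightarrow> 'a lp mat \<Rightarrow> 'a lp mat" where
  "lscale c A = (\<lambda>a b e. c powi e * A a b e)"

definition constm :: "'a::zero mat \<Rightarrow> 'a lp mat" where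
  "constm M = (\<lambda>a b e. if e = 0 then M a b else 0)"

definition lp_ct :: "'a::field \<Rightarrow> 'a lp" where
  "lp_ct c = (\<lambda>e. if e = 1 then c else if e = -1 then - inverse c else 0)"

definition lp_const :: "'a::zero \<Rightarrow> 'a lp" where
  "lp_const c = (\<lambda>e. if e = 0 then c else 0)"

definition R11 :: "'a::field \<Rightarrow> 'a lp mat" where
  "R11 q = (\<lambda>a b.
      if (a = 0 \<and> b = 0) \<or> (a = 3 \<and> b = 3) then lp_ct q
      else if (a = 1 \<and> b = 1) \<or> (a = 2 \<and> b = 2) then lp_ct 1
      else if (a = 1 \<and> b = 2) \<or> (a = 2 \<and> b = 1) then lp_const (q - inverse q)
      else 0)"

(* Rhalf d = R^{(1/2, d/2)}(t), size 2(d+1) *)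
fun Rhalf :: "'a::field \<Rightarrow> 'a \<Rightarrow> (nat \<Rightarrow> 'a) \<Rightarrow> nat \<Rightarrow> 'a lp mat" where
  "Rhalf q qh r 0 = (\<lambda>a b. 0)"
| "Rhalf q qh r (Suc 0) = R11 q"
| "Rhalf q qh r (Suc (Suc d)) =
     lmmul (4 * (Suc d + 1))
       (lmmul (4 * (Suc d + 1))
         (lmmul (4 * (Suc d + 1))
            (constm (leg23 (Suc d + 2) (2 * (Suc d + 1)) (Fmat q r (Suc d))))
            (leg13 2 (Suc d + 1) (lscale (inverse qh) (Rhalf q qh r (Suc d)))))
         (leg12 (Suc d + 1) (lscale (qh ^ Suc d) (R11 q))))
       (constm (leg23 (2 * (Suc d + 1)) (Suc d + 2) (Emat q r (Suc d))))"

(* Rfull d1 d2 = R^{(d1/2, d2/2)}(t), size (d1+1)(d2+1) *)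
fun Rfull :: "'a::field \<Rightarrow> 'a \<Rightarrow> (nat \<Rightarrow> 'a) \<Rightarrow> nat \<Rightarrow> nat \<Rightarrow> 'a lp mat" where
  "Rfull q qh r 0 d2 = (\<lambda>a b. 0)"
| "Rfull q qh r (Suc 0) d2 = Rhalf q qh r d2"
| "Rfull q qh r (Suc (Suc d)) d2 =
     lmmul (2 * (Suc d + 1) * (d2 + 1))
       (lmmul (2 * (Suc d + 1) * (d2 + 1))
         (lmmul (2 * (Suc d + 1) * (d2 + 1))
            (constm (leg12 (d2 + 1) (Fmat q r (Suc d))))
            (leg13 (Suc d + 1) (d2 + 1) (lscale (qh powi (- int (Suc d))) (Rhalf q qh r d2))))
         (leg23 ((Suc d + 1) * (d2 + 1)) ((Suc d + 1) * (d2 + 1)) (lscale qh (Rfull q qh r (Suc d) d2))))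
       (constm (leg12 (d2 + 1) (Emat q r (Suc d))))"

definition serS :: "(int \<Rightarrow> 'a::zero_neq_one vec) \<Rightarrow> 'a ser" where
  "serS f = (\<lambda>i k. if k = 0 then f i else 0)"

definition serT :: "(int \<Rightarrow> 'a::zero_neq_one vec) \<Rightarrow> 'a ser" where
  "serT f = (\<lambda>i k. if i = 0 then f k else 0)"

(* p(t/s) for a scalar Laurent polynomial p, as a multiple of the trivial word *)
definition serR :: "'a::zero_neq_one lp \<Rightarrow> 'a ser" where
  "serR p = (\<lambda>i k. if i = - k then (\<lambda>w. if w = [] then p k else 0) else 0)"

definition serC :: "'a::zero_neq_one \<Rightarrow> 'a ser" where
  "serC c = (\<lambda>i k. if i = 0 \<and> k = 0 then (\<lambda>w. if w = [] then c else 0) else 0)"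

definition Rts :: "'a::field \<Rightarrow> 'a \<Rightarrow> (nat \<Rightarrow> 'a) \<Rightarrow> nat \<Rightarrow> nat \<Rightarrow> 'a ser mat" where
  "Rts q qh r d1 d2 = (\<lambda>a b. serR (Rfull q qh r d1 d2 a b))"

definition Kone :: "'a::field \<Rightarrow> 'a \<Rightarrow> (nat \<Rightarrow> 'a) \<Rightarrow> nat \<Rightarrow> nat \<Rightarrow> 'a ser mat" where
  "Kone q qh r d1 d2 = leg12 (d2 + 1) (\<lambda>a b. serS (Kser q qh r d1 a b))"

definition Ktwo :: "'a::field \<Rightarrow> 'a \<Rightarrow> (nat \<Rightarrow> 'a) \<Rightarrow> nat \<Rightarrow> nat \<Rightarrow> 'a ser mat" where
  "Ktwo q qh r d1 d2 = leg23 (d2 + 1) (d2 + 1) (\<lambda>a b. serT (Kser q qh r d2 a b))"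

(* Rhat^{(j1,j2)}: diagonal, q^{2 alpha beta} = (q^{1/2})^{(d1 - 2i)(d2 - 2k)} *)
definition Rhat :: "'a::field \<Rightarrow> 'a \<Rightarrow> nat \<Rightarrow> nat \<Rightarrow> 'a ser mat" where
  "Rhat q qh d1 d2 = (\<lambda>a b. if a = b then
      serC (qh powi ((int d1 - 2 * int (a div (d2 + 1))) * (int d2 - 2 * int (a mod (d2 + 1)))))
      else 0)"

end

theory Submission
  imports Defs "HOL-Computational_Algebra.Polynomial"
begin

text \<open>
  The coefficient of a word $w$ in $K^{(j)}(t)$ is, up to a diagonal gauge and a power of $q$, a matrix
  entry of $t^{|w|} A(w)$, where $A(x), A(y)$ are the two step operators on a $(2j+1)$-dimensional
  space and $A(w)$ is the product along $w$. The $q$-shuffle product sums over all ways to distribute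
  the letters of $w$ over the two tensor factors; together with the powers of $q$ in $K$ and in
  $\widehat R$ its weights factor letter by letter, so the coefficient of $w$ in $K_1 \widehat R K_2$
  (in $K_2 \widehat R K_1$) is the product along $w$ of the coproduct (the opposite coproduct) of the
  letters. Hence the reflection equation follows once $R$ intertwines the two coproducts of $x$ and $y$.

  In the gauge given by the square roots of $[i]_q^! [2j-i]_q^!$ the fusion matrix $\mathcal{E}$
  becomes $f \mapsto f(p + i)$, so its image consists of the symmetric functions. $R^{(1/2,j)}$ is then
  a scalar multiple of an explicit $L$-operator, and $L_1(z) L_2(qz)$ preserves symmetry in its first
  two arguments. This shows that the fused product of $R$-matrices preserves the image of
  $\mathcal{E}$, so that the intertwining property passes from $L$ to all $R^{(j_1,j_2)}$.
\<close>

section \<open>The $L$-operator\<close>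

text \<open>Why the coefficients of \<open>K\<close> are matrix entries: with indices counted from 0
  and d = 2j, deleting b letters x in front and d - a letters y behind means reading Delta at the
  word x^b w y^(d-a), that is, along a path that climbs to height b, follows w and descends from
  height d - a. The deletions thus turn one series into all entries of A(w), from index b to index d
  - a, and the q-integers in Delta are the step weights up to sign and gauge. The final index d - a
  is counted backwards, so \<open>R\<close> must also commute with the reversal of both index
  ranges; the same symmetry yields the relation for y from the one for x. The powers of q^(1/2) that
  do not belong to the coproducts depend only on sums of indices, and \<open>R\<close> conserves
  these sums. At special z the scalar factors of \<open>R\<close> vanish, so they are carried along
  and never divided out. Operators are compared at nonzero field elements z in place of the
  indeterminate; the field is infinite, so this determines Laurent polynomials.\<close>

definition cc :: "'a::field \<Rightarrow> 'a" where "cc t = t - inverse t"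

lemma cc_1 [simp]: "cc 1 = 0" by (simp add: cc_def)

locale qparam =
  fixes q qh :: "'a::field_char_0" and r :: "nat \<Rightarrow> 'a"
  assumes q_nz: "q \<noteq> 0"
    and q_not_root: "\<And>n::nat. n > 0 \<Longrightarrow> q ^ n \<noteq> 1"
    and qh_sq: "qh * qh = q"
    and r_sqrt: "\<And>n. r n * r n = qint q (int n)"
begin

lemma qh_nz [simp]: "qh \<noteq> 0" using q_nz qh_sq by auto

lemma q_inv_nz: "q - inverse q \<noteq> 0"
proof
  assume "q - inverse q = 0"
  then have "q ^ 2 = 1" using q_nz by (simp add: field_simps power2_eq_square)
  then show False using q_not_root[of 2] by simp
qed

lemma q_powi: "q powi n = qh powi n * qh powi n"
  by (simp add: qh_sq[symmetric] power_int_mult_distrib)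

lemma qh_powi_double: "qh powi (2 * n) = qh powi n * qh powi n"
  "qh powi (n * 2) = qh powi n * qh powi n"
proof -
  have "qh powi (n + n) = qh powi n * qh powi n" by (rule power_int_add) simp
  then show "qh powi (2 * n) = qh powi n * qh powi n" "qh powi (n * 2) = qh powi n * qh powi n"
    by (simp_all only: mult_2 mult_2_right)
qed

lemmas qh_pow = q_powi power_int_add[OF disjI1[OF qh_nz]] power_int_diff[OF disjI1[OF qh_nz]] qh_powi_double
   power_int_minus

text \<open>Dictionary between the entries of the L-operator, which contain c(q^n), and those of the
  coproducts, which contain [n]_q.\<close>

lemma cc_powi: "cc (q powi n) = cc q * qint q n"
  using q_inv_nz by (simp add: cc_def qint_def power_int_minus)

lemma qint_0 [simp]: "qint q 0 = 0" by (simp add: qint_def)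
lemma qint_1 [simp]: "qint q 1 = 1" using q_inv_nz by (simp add: qint_def power_int_minus)
lemma qint_minus: "qint q (- n) = - qint q n"
  by (simp add: qint_def power_int_minus minus_divide_left)

text \<open>
  The operator \<open>Lop d z\<close> acts on functions on $\{0,1\} \times \{0..d\}$. Out-of-range
  arguments only occur with coefficient \<open>cc 1 = 0\<close>.
\<close>

definition Lop :: "nat \<Rightarrow> 'a \<Rightarrow> (nat \<Rightarrow> nat \<Rightarrow> 'a) \<Rightarrow> nat \<Rightarrow> nat \<Rightarrow> 'a" where
  "Lop d z f p k =
    (if p = 0 then cc (qh powi (int d + 1 - 2 * int k) * z) * f 0 k + cc (q powi int k) * f 1 (k - 1)
     else cc (qh powi (1 - int d + 2 * int k) * z) * f 1 k + cc (q powi (int d - int k)) * f 0 (k + 1))"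

lemma Lop_cong:
  assumes "\<And>p k. p \<le> 1 \<Longrightarrow> k \<le> d \<Longrightarrow> f p k = g p k" "k \<le> d"
  shows "Lop d z f p k = Lop d z g p k"
proof (cases "k = d")
  case True then show ?thesis using assms by (auto simp: Lop_def)
next
  case False then show ?thesis using assms by (auto simp: Lop_def)
qed

lemma Lop_linear: "Lop d z (\<lambda>p k. a * f p k + b * g p k) p k = a * Lop d z f p k + b * Lop d z g p k"
  by (simp add: Lop_def algebra_simps)

text \<open>Each term of \<open>Lop\<close> keeps \<open>p\<close> and \<open>k\<close> or moves one
  unit between them, so the total weight \<open>p + k\<close> is conserved. Where the truncated
  difference \<open>k - 1\<close> would break this, the coefficient is zero.\<close>

lemma Lop_weight: "k \<le> d \<Longrightarrow> p \<le> 1 \<Longrightarrow> Lop d z (\<lambda>p k. g (p + k) * f p k) p k = g (p + k) * Lop d z f p k"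
  by (cases "k = 0"; cases "p = 0") (auto simp: Lop_def algebra_simps le_Suc_eq)

text \<open>Reversing both index ranges exchanges the two branches of \<open>Lop\<close>.\<close>

lemma Lop_flip:
  assumes "k \<le> d" "p \<le> 1"
  shows "Lop d z (\<lambda>p k. f (1 - p) (d - k)) p k = Lop d z f (1 - p) (d - k)"
proof -
  obtain l where d: "d = k + l" using assms(1) le_Suc_ex by blast
  consider "p = 0" "k = 0" | m where "p = 0" "k = Suc m" | "p = 1" using assms by (cases k; cases p) auto
  then show ?thesis
    by cases (simp_all add: Lop_def d algebra_simps)
qed

text \<open>Every coefficient of the L-operator is a monomial in \<open>qh\<close> and
  \<open>z\<close> minus its inverse. In this notation products add exponents, so identities between
  coefficients follow by expansion.\<close>

definition qzmonom :: "'a \<Rightarrow> int \<Rightarrow> int \<Rightarrow> 'a" where "qzmonom z m n = qh powi m * z powi n"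

lemma qzmonom_mult: "z \<noteq> 0 \<Longrightarrow> qzmonom z m n * qzmonom z m' n' = qzmonom z (m + m') (n + n')"
  by (simp add: qzmonom_def power_int_add mult_ac)

lemma cc_qzmonom: "cc (qzmonom z m n) = qzmonom z m n - qzmonom z (- m) (- n)"
  by (simp add: cc_def qzmonom_def power_int_minus)

lemma to_qzmonom: "qh powi m * z = qzmonom z m 1" "qh powi m * (q * z) = qzmonom z (m + 2) 1"
   "qh powi m * (inverse qh * z) = qzmonom z (m - 1) 1" "qh powi m * (qh ^ d * z) = qzmonom z (m + int d) 1"
   "qh ^ d * z = qzmonom z (int d) 1"
    "q powi m = qzmonom z (2 * m) 0"
  by (simp_all add: qzmonom_def qh_pow qh_sq[symmetric] power_int_mult_distrib field_simps power2_eq_square)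

lemmas qzmonom_simps = cc_qzmonom qzmonom_mult algebra_simps

text \<open>The quantum determinant relation: at this ratio of parameters symmetry is preserved.\<close>

lemma Lop_qdet:
  assumes z: "z \<noteq> 0" and sym: "\<And>k. f 0 1 k = f 1 0 k"
  shows "Lop d z (\<lambda>p. Lop d (q * z) (f p) 1) 0 k = Lop d z (\<lambda>p. Lop d (q * z) (f p) 0) 1 k"
proof -
  define C where "C m n = cc (qzmonom z m n)" for m n
  have tm: "cc (qh powi m * z) = C m 1" "cc (qh powi m * (q * z)) = C (m + 2) 1"
    "cc (q powi m) = C (2 * m) 0" for m
    by (simp_all only: C_def to_qzmonom(1,2,6)[where z = z])
  \<comment> \<open>This compares the coefficients of \<open>f 0 1 k\<close> and
    \<open>f 1 0 k\<close>, which \<open>sym\<close> merges into one. Those of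
    \<open>f 0 0 (k + 1)\<close> and \<open>f 1 1 (k - 1)\<close> match term by term because the
    parameters have ratio \<open>q\<close>.\<close>
  have c1: "C (int d + 1 - 2 * int k) 1 * C (3 - int d + 2 * int k) 1
      + C (2 * int k) 0 * C (2 * (int d - int k + 1)) 0
     = C (1 - int d + 2 * int k) 1 * C (int d + 3 - 2 * int k) 1
      + C (2 * (int d - int k)) 0 * C (2 * (int k + 1)) 0"
    using z by (simp add: C_def qzmonom_simps)
  show ?thesis
  proof (cases k)
    case 0
    have "C 0 0 = 0" by (simp add: C_def cc_def qzmonom_def)
    then show ?thesis using c1 sym unfolding Lop_def tm 0 by (simp add: algebra_simps)
  next
    case (Suc m)
    show ?thesis using arg_cong[OF c1, of "(*) (f 1 0 k)"] sym unfolding Lop_def tm Suc by (simp add: algebra_simps)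
  qed
qed

text \<open>Functions of \<open>p2 + k\<close> are the image of the gauged fusion matrix in the
  second factor, so this is the recursion for R^(1/2,j+1/2) in operator form. The scalar on the
  right is what \<open>Rfactor\<close> accumulates.\<close>

lemma Lop_fusion:
  assumes z: "z \<noteq> 0" and p: "p \<le> 1" "p2 \<le> 1"
  shows "Lop d (inverse qh * z) (\<lambda>p k. Lop 1 (qh ^ d * z) (\<lambda>p p2. f p (p2 + k)) p p2) p k
       = cc (qh ^ d * z) * Lop (Suc d) z f p (p2 + k)"
proof -
  define C where "C m n = cc (qzmonom z m n)" for m n
  have tm: "cc (qh powi m * z) = C m 1" "cc (qh powi m * (inverse qh * z)) = C (m - 1) 1"
    "cc (qh powi m * (qh ^ d * z)) = C (m + int d) 1" "cc (qh ^ d * z) = C (int d) 1"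
    "cc (q powi m) = C (2 * m) 0" for m
    by (simp_all only: C_def to_qzmonom(1,3,4,6)[where z = z]) (simp only: to_qzmonom(5)[where z = z])
  have C0: "C 0 0 = 0" by (simp add: C_def cc_def qzmonom_def)
  \<comment> \<open>The cases \<open>(p, p2)\<close> = (0,0), (1,1), (0,1), (1,0), in this order.
    Each identity concerns the one value of \<open>f\<close> to which two terms of the product
    contribute.\<close>
  have c1: "C (int d - 2 * int k) 1 * C (2 + int d) 1 + C (2 * int k) 0 * C 2 0
      = C (int d) 1 * C (2 + int d - 2 * int k) 1"
    "C (2 * int k - int d) 1 * C (2 + int d) 1 + C (2 * int d - 2 * int k) 0 * C 2 0
      = C (int d) 1 * C (2 + 2 * int k - int d) 1"
    "C (int d - 2 * int k) 1 * C 2 0 + C (2 * int k) 0 * C (2 + int d) 1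
      = C (int d) 1 * C (2 + 2 * int k) 0"
    "C (2 * int k - int d) 1 * C 2 0 + C (2 * int d - 2 * int k) 0 * C (2 + int d) 1
      = C (int d) 1 * C (2 + 2 * int d - 2 * int k) 0"
    using z by (simp_all add: C_def qzmonom_simps)
  consider "p = 0" "p2 = 0" | "p = 0" "p2 = 1"| "p = 1" "p2 = 0"| "p = 1" "p2 = 1" using p by linarith
  then show ?thesis
  proof cases
    case 1
    then show ?thesis using arg_cong[OF c1(1), of "(*) (f 0 k)"] C0
      unfolding Lop_def tm by (cases k) (simp_all add: algebra_simps)
  next
    case 2
    then show ?thesis using arg_cong[OF c1(3), of "(*) (f 1 k)"] C0
      unfolding Lop_def tm by (cases k) (simp_all add: algebra_simps)
  next
    case 3
    then show ?thesis using arg_cong[OF c1(4), of "(*) (f 0 (Suc k))"] C0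
      unfolding Lop_def tm by (cases k) (simp_all add: algebra_simps)
  next
    case 4
    then show ?thesis using arg_cong[OF c1(2), of "(*) (f 1 (Suc k))"] C0
      unfolding Lop_def tm by (cases k) (simp_all add: algebra_simps)
  qed
qed

end

context qparam begin

section \<open>Fused operators as intertwiners\<close>

text \<open>
  The coproduct of \<open>X\<close> with spectral parameters $s, t$. Exchanging the factors,
  \<open>DX d2 d1 t s (\<lambda>k i. f i k) k i\<close>, gives the opposite coproduct.
\<close>

definition DX :: "nat \<Rightarrow> nat \<Rightarrow> 'a \<Rightarrow> 'a \<Rightarrow> (nat \<Rightarrow> nat \<Rightarrow> 'a) \<Rightarrow> nat \<Rightarrow> nat \<Rightarrow> 'a" where
  "DX d1 d2 s t f i k = s * qint q (int i) * qh powi (2 * int k - int d2) * f (i - 1) k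
     + t * qh powi (int d1 - 2 * int i) * qint q (int k) * f i (k - 1)"

text \<open>The q-analogue of m (n + 1) = n (m + 1) + (m - n); it settles the mixed coefficient in
  \<open>Lop_DX\<close>.\<close>

lemma qint_add_exchange: "qint q m * qint q (n + 1) = qint q n * qint q (m + 1) + qint q (m - n)"
proof -
  define u where "u k = q powi k - q powi (- k)" for k
  define x where "x = q - inverse q"
  have x: "x \<noteq> 0" "\<And>k. qint q k = u k / x" using q_inv_nz by (simp_all add: x_def u_def qint_def)
  have "u m * u (n + 1) = u n * u (m + 1) + u (m - n) * x"
    using q_nz by (simp add: u_def x_def power_int_minus power_int_add power_int_diff) (simp add: field_simps)
  then show ?thesis using x(1) unfolding x(2) by (simp add: field_simps)
qed

text \<open>The intertwining property is computed by hand only here, for spin 1/2 in the first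
  factor and the letter \<open>X\<close>. Fusion extends it to all spins, reversal of the indices to
  \<open>Y\<close>.\<close>

lemma Lop_DX:
  assumes z: "z \<noteq> 0" and p: "p \<le> 1"
  shows "Lop d z (DX 1 d 1 z f) p k = DX d 1 z 1 (\<lambda>k p. Lop d z f p k) k p"
proof -
  define M where "M = qzmonom z"
  define C where "C m n = cc (qzmonom z m n)" for m n
  have tm: "cc (qh powi m * z) = C m 1" for m
    by (simp_all only: C_def to_qzmonom(1)[where z = z])
  have q2: "cc q = C 2 0" by (simp add: C_def qzmonom_def qh_sq power2_eq_square)
  note tq = cc_powi[unfolded q2]
  have M1: "M m 1 = z * M m 0" for m by (simp add: qzmonom_def M_def)
  have t0: "qh powi m = qzmonom z m 0" for m by (simp_all add: qzmonom_def)
  show ?thesis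
  proof (cases "p = 0")
    case True
    have c1: "C (int d + 1 - 2 * int k) 1 * M 1 1 + C 2 0 * M (2 * int k - 2 - int d) 0 = M (- 1) 1 * C (int d + 3 - 2 * int k) 1"
      using z unfolding M_def C_def by (simp add: qzmonom_simps)
    show ?thesis
    proof (cases k)
      case 0 then show ?thesis using True by (simp add: DX_def Lop_def)
    next
      case (Suc m)
      show ?thesis using True arg_cong[OF c1, of "(*) (qint q (int k) * f 0 m)"] Suc
        unfolding DX_def Lop_def tm tq unfolding t0 M_def[symmetric] by (simp add: M1 algebra_simps)
    qed
  next
    case False
    then have p1: "p = 1" using p by simp
    have c1: "C (1 - int d + 2 * int k) 1 * M (- 1) 1 = M 1 1 * C (2 * int k - 1 - int d) 1 + M (int d - 2 * int k) 0 * C 2 0"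
      using z unfolding M_def C_def by (simp add: qzmonom_simps)
    have x: "C 2 0 * qint q (int d - 2 * int k) = C (2 * int d - 4 * int k) 0"
      unfolding tq[symmetric] by (simp add: C_def to_qzmonom(6)[of _ z])
    \<comment> \<open>The coefficient of \<open>f 0 k\<close>, to which four terms contribute. The
      two products of q-integers differ by [d - 2k], and an identity of monomials accounts for this
      difference.\<close>
    have c2: "C (1 - int d + 2 * int k) 1 * M (2 * int k - int d) 0 + C 2 0 * qint q (int d - int k) * qint q (int k + 1) * M 1 1
        = M 1 1 * qint q (int k) * C 2 0 * qint q (int d - int k + 1) + M (int d - 2 * int k) 0 * C (int d + 1 - 2 * int k) 1"
    proof -
      have "C (1 - int d + 2 * int k) 1 * M (2 * int k - int d) 0 + C (2 * int d - 4 * int k) 0 * M 1 1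
         = M (int d - 2 * int k) 0 * C (int d + 1 - 2 * int k) 1"
        using z unfolding M_def C_def by (simp add: qzmonom_simps)
      moreover have "qint q (int d - int k) * qint q (int k + 1) = qint q (int k) * qint q (int d - int k + 1) + qint q (int d - 2 * int k)"
        using qint_add_exchange[of "int d - int k" "int k"] by (simp add: algebra_simps)
      ultimately show ?thesis unfolding x[symmetric] by algebra
    qed
    show ?thesis
    proof (cases k)
      case 0 then show ?thesis using p1 arg_cong[OF c2, of "(*) (f 0 0)"]
        unfolding DX_def Lop_def tm tq unfolding t0 M_def[symmetric] by (simp add: M1 algebra_simps)
    next
      case (Suc m)
      show ?thesis using p1 arg_cong[OF c1, of "(*) (qint q (int k) * f 1 m)"] arg_cong[OF c2, of "(*) (f 0 k)"] Suc
        unfolding DX_def Lop_def tm tq unfolding t0 M_def[symmetric] by (simp add: M1 algebra_simps)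
    qed
  qed
qed

text \<open>The common scalar factor of the entries of $R^{(1/2,d/2)}(z)$.\<close>

fun Rfactor :: "nat \<Rightarrow> 'a \<Rightarrow> 'a" where
  "Rfactor (Suc (Suc d)) z = Rfactor (Suc d) (inverse qh * z) * cc (qh ^ Suc d * z)"
| "Rfactor _ z = 1"

text \<open>
  The value at \<open>i\<close> reads the fused product at \<open>(0, 0)\<close> or \<open>(1, i - 1)\<close>; by
  \<open>fuse_Rop\<close> below every \<open>(p, i - p)\<close> gives the same value, which makes the weights in
  $\mathcal{F}$ irrelevant.
\<close>

primrec Rop :: "nat \<Rightarrow> nat \<Rightarrow> 'a \<Rightarrow> (nat \<Rightarrow> nat \<Rightarrow> 'a) \<Rightarrow> nat \<Rightarrow> nat \<Rightarrow> 'a" where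
  "Rop 0 d2 z f = f"
| "Rop (Suc d) d2 z f = (\<lambda>i k. let p0 = (if i = 0 then 0 else 1) in
     Rfactor d2 (qh powi (- int d) * z) *
     Lop d2 (qh powi (- int d) * z) (\<lambda>p k. Rop d d2 (qh * z) (\<lambda>i k. f (p + i) k) (i - p0) k) p0 k)"

text \<open>The fused product before its compression by the left fusion matrix: the two legs
  \<open>p\<close> and \<open>i\<close> of the first factor are still separate.\<close>

definition fuse :: "nat \<Rightarrow> nat \<Rightarrow> 'a \<Rightarrow> (nat \<Rightarrow> nat \<Rightarrow> 'a) \<Rightarrow> nat \<Rightarrow> nat \<Rightarrow> nat \<Rightarrow> 'a" where
  "fuse d d2 z f p i k = Rfactor d2 (qh powi (- int d) * z) *
     Lop d2 (qh powi (- int d) * z) (\<lambda>p k. Rop d d2 (qh * z) (\<lambda>i k. f (p + i) k) i k) p k"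

lemma Rop_Suc: "Rop (Suc d) d2 z f 0 k = fuse d d2 z f 0 0 k" "Rop (Suc d) d2 z f (Suc i) k = fuse d d2 z f 1 i k"
  by (simp_all add: fuse_def)

declare Rop.simps(2) [simp del]

lemma fuse_cong:
  assumes "\<And>p k. p \<le> 1 \<Longrightarrow> k \<le> d2 \<Longrightarrow> Rop d d2 (qh * z) (\<lambda>i k. f (p + i) k) i k = Rop d d2 (qh * z) (\<lambda>i k. g (p + i) k) i k"
    and "k \<le> d2"
  shows "fuse d d2 z f p i k = fuse d d2 z g p i k"
  unfolding fuse_def using assms by (intro arg_cong[of _ _ "(*) _"] Lop_cong) auto

lemma Rop_cong:
  assumes "\<And>i k. i \<le> d \<Longrightarrow> k \<le> d2 \<Longrightarrow> f i k = g i k" "i \<le> d" "k \<le> d2"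
  shows "Rop d d2 z f i k = Rop d d2 z g i k"
  using assms
proof (induction d arbitrary: z f g i k)
  case 0 then show ?case by simp
next
  case (Suc d)
  have "fuse d d2 z f p i k = fuse d d2 z g p i k" if "i \<le> d" "k \<le> d2" "p \<le> 1" for p i k
    by (intro fuse_cong Suc.IH) (use that Suc.prems in auto)
  then show ?case using Suc.prems by (cases i) (auto simp: Rop_Suc)
qed

lemma Rop_linear: "Rop d d2 z (\<lambda>i k. a * f i k + b * g i k) i k = a * Rop d d2 z f i k + b * Rop d d2 z g i k"
proof (induction d arbitrary: z f g i k)
  case (Suc d)
  have "fuse d d2 z (\<lambda>i k. a * f i k + b * g i k) p i k = a * fuse d d2 z f p i k + b * fuse d d2 z g p i k" for p i k
    unfolding fuse_def Suc.IH[of _ "\<lambda>i. f (_ + i)" "\<lambda>i. g (_ + i)"] Lop_linear by (simp add: algebra_simps)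
  then show ?case by (cases i) (auto simp: Rop_Suc)
qed simp

lemma Rop_weight:
  assumes "i \<le> d" "k \<le> d2"
  shows "Rop d d2 z (\<lambda>i k. g (i + k) * f i k) i k = g (i + k) * Rop d d2 z f i k"
  using assms
proof (induction d arbitrary: z f g i k)
  case (Suc d)
  have "fuse d d2 z (\<lambda>i k. g (i + k) * f i k) p i k = g (p + i + k) * fuse d d2 z f p i k"
    if "i \<le> d" "k \<le> d2" "p \<le> 1" for p i k
  proof -
    define z' where "z' = qh powi (- int d) * z"
    have "Lop d2 z' (\<lambda>p k. Rop d d2 (qh * z) (\<lambda>i k. g (p + i + k) * f (p + i) k) i k) p k
      = Lop d2 z' (\<lambda>p k. (\<lambda>n. g (i + n)) (p + k) * Rop d d2 (qh * z) (\<lambda>i k. f (p + i) k) i k) p k"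
      using that(1,2) Suc.IH[of i _ "qh*z" "\<lambda>n. g (_ + n)"]
      by (intro Lop_cong) (auto simp: add_ac)
    also have "\<dots> = g (i + (p + k)) * Lop d2 z' (\<lambda>p k. Rop d d2 (qh * z) (\<lambda>i k. f (p + i) k) i k) p k"
      using that by (subst Lop_weight) auto
    finally show ?thesis by (simp add: fuse_def z'_def add_ac)
  qed
  from this[of _ _ 0] this[of _ _ 1] show ?case using Suc.prems by (cases i) (auto simp: Rop_Suc)
qed simp

text \<open>Two consecutive legs of the fused product have parameters \<open>z'\<close> and
  \<open>q * z'\<close>, the ratio in \<open>Lop_qdet\<close>. The input depends only on the sum of
  the leg indices, so after peeling off a second leg a unit can be moved from \<open>i\<close> to
  \<open>p\<close>.\<close>

lemma fuse_Rop:
  assumes "p \<le> 1" "i \<le> d" "k \<le> d2" "z \<noteq> 0"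
  shows "fuse d d2 z f p i k = Rop (Suc d) d2 z f (p + i) k"
  using assms
proof (induction d arbitrary: z f p i k)
  case 0 then show ?case by (cases p) (auto simp: Rop_Suc)
next
  case (Suc d)
  have swap: "fuse (Suc d) d2 z f 0 (Suc m) k = fuse (Suc d) d2 z f 1 m k" if "m \<le> d" for m
  proof -
    define z' where "z' = qh powi (- int (Suc d)) * z"
    have z': "z' \<noteq> 0" using Suc.prems by (simp add: z'_def)
    have qz: "qh powi (- int d) * (qh * z) = q * z'"
      by (simp add: z'_def qh_sq[symmetric] power_int_diff power_int_add power_int_minus field_simps)
    define g where "g = (\<lambda>n k. Rop d d2 (qh * (qh * z)) (\<lambda>i k. f (n + i) k) m k)"
    have R: "Rop (Suc d) d2 (qh * z) (\<lambda>i k. f (p + i) k) (p2 + m) k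
        = Rfactor d2 (q * z') * Lop d2 (q * z') (\<lambda>p2. g (p + p2)) p2 k" if "p2 \<le> 1" "k \<le> d2" for p p2 k
      using Suc.IH[of p2 m k "qh * z" "\<lambda>i k. f (p + i) k", symmetric] that \<open>m \<le> d\<close> Suc.prems
      by (simp add: fuse_def qz g_def add.assoc)
    have L: "fuse (Suc d) d2 z f p (p2 + m) k = Rfactor d2 z' * Rfactor d2 (q * z') *
        Lop d2 z' (\<lambda>p k. Lop d2 (q * z') (\<lambda>p2. g (p + p2)) p2 k) p k" if "p2 \<le> 1" for p p2
    proof -
      \<comment> \<open>The summand \<open>0 * 0\<close> makes this a combination of two functions,
        so that \<open>Lop_linear\<close> can extract the scalar. The same device recurs
        below.\<close>
      have "Lop d2 z' (\<lambda>p k. Rop (Suc d) d2 (qh * z) (\<lambda>i k. f (p + i) k) (p2 + m) k) p k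
        = Lop d2 z' (\<lambda>p k. Rfactor d2 (q * z') * Lop d2 (q * z') (\<lambda>p2. g (p + p2)) p2 k + 0 * 0) p k"
        using Suc.prems that by (intro Lop_cong) (auto simp: R)
      also have "\<dots> = Rfactor d2 (q * z') * Lop d2 z' (\<lambda>p k. Lop d2 (q * z') (\<lambda>p2. g (p + p2)) p2 k) p k"
        by (subst Lop_linear) simp
      finally show ?thesis by (simp add: fuse_def z'_def)
    qed
    show ?thesis using L[of 1 0] L[of 0 1] Lop_qdet[OF z', of "\<lambda>p p2. g (p + p2)" d2 k] by simp
  qed
  consider "p = 0" "i = 0" | m where "p = 0" "i = Suc m" | "p = 1" using Suc.prems by (cases p; cases i) auto
  then show ?case
  proof cases
    case 1 then show ?thesis by (simp add: Rop_Suc)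
  next
    case 2 then show ?thesis using swap[of m] Suc.prems by (simp add: Rop_Suc)
  next
    case 3 then show ?thesis by (simp add: Rop_Suc)
  qed
qed

text \<open>The definition of \<open>Rop\<close> reads the fused product at positions that the
  reversal does not preserve; \<open>fuse_Rop\<close> makes the choice of position immaterial, and
  then \<open>Lop_flip\<close> carries the induction.\<close>

lemma Rop_flip:
  assumes "i \<le> d" "k \<le> d2" "z \<noteq> 0"
  shows "Rop d d2 z (\<lambda>i k. f (d - i) (d2 - k)) i k = Rop d d2 z f (d - i) (d2 - k)"
  using assms
proof (induction d arbitrary: z f i k)
  case 0 then show ?case by simp
next
  case (Suc d)
  have *: "Rop (Suc d) d2 z (\<lambda>i k. f (Suc d - i) (d2 - k)) (p + i) k = Rop (Suc d) d2 z f (Suc d - (p + i)) (d2 - k)"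
    if "i \<le> d" "p \<le> 1" for p i
  proof -
    define z' where "z' = qh powi (- int d) * z"
    define g where "g = (\<lambda>p k. Rop d d2 (qh * z) (\<lambda>i k. f (p + i) k) (d - i) k)"
    have "Rop d d2 (qh * z) (\<lambda>i k. f (Suc d - (p + i)) (d2 - k)) i k = g (1 - p) (d2 - k)"
      if "p \<le> 1" "k \<le> d2" for p k
    proof -
      have "Rop d d2 (qh * z) (\<lambda>i k. f (Suc d - (p + i)) (d2 - k)) i k
         = Rop d d2 (qh * z) (\<lambda>i k. (\<lambda>i k. f (1 - p + i) k) (d - i) (d2 - k)) i k"
        using that \<open>i \<le> d\<close> by (intro Rop_cong) (auto simp: le_Suc_eq Suc_diff_le)
      also have "\<dots> = g (1 - p) (d2 - k)"
        using Suc.IH[of i k "qh * z" "\<lambda>i k. f (1 - p + i) k"] that \<open>i \<le> d\<close> Suc.prems by (simp add: g_def)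
      finally show ?thesis .
    qed
    then have "fuse d d2 z (\<lambda>i k. f (Suc d - i) (d2 - k)) p i k = Rfactor d2 z' * Lop d2 z' (\<lambda>p k. g (1 - p) (d2 - k)) p k"
      using Suc.prems unfolding fuse_def z'_def by (intro arg_cong[of _ _ "(*) _"] Lop_cong) auto
    also have "\<dots> = fuse d d2 z f (1 - p) (d - i) (d2 - k)"
      using Suc.prems that by (subst Lop_flip) (auto simp: fuse_def z'_def g_def)
    finally show ?thesis using that Suc.prems by (subst (asm) (1 2) fuse_Rop) (auto simp: le_Suc_eq Suc_diff_le)
  qed
  show ?case
  proof (cases i)
    case 0 then show ?thesis using *[of 0 0] by simp
  next
    case (Suc m) then show ?thesis using *[of m 1] Suc.prems by simp
  qed
qed

text \<open>On functions of \<open>p + i\<close> the letter \<open>X\<close> acts with weight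
  [p + i]; this formula distributes the weight over the legs \<open>p\<close> and \<open>i\<close>
  with the powers of \<open>q\<close> of a coproduct.\<close>

lemma qint_add: "qint q (m + n) = qint q m * q powi n + q powi (- m) * qint q n"
proof -
  define x where "x = q - inverse q"
  have x: "x \<noteq> 0" "\<And>k. qint q k = (q powi k - inverse (q powi k)) / x"
    using q_inv_nz by (simp_all add: x_def qint_def power_int_minus)
  show ?thesis using x(1) q_nz unfolding x(2)
    by (simp add: power_int_minus power_int_add) (simp add: field_simps)
qed

lemma q_pow: "q ^ n = qh ^ n * qh ^ n"
  by (simp add: qh_sq[symmetric] power_mult_distrib)

text \<open>By coassociativity \<open>X\<close> acts on the three legs \<open>p\<close>,
  \<open>i\<close>, \<open>k\<close>, and the two factors of the fused product pass it one after the
  other. The term on the leg that a factor does not touch carries a power of \<open>qh\<close> in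
  the total weight of the two legs that it does touch, so it commutes with that factor.\<close>

lemma fuse_DX:
  assumes "i \<le> d" "k \<le> d2" "p \<le> 1" "z \<noteq> 0"
    and IH: "\<And>f i k. i \<le> d \<Longrightarrow> k \<le> d2 \<Longrightarrow>
       Rop d d2 (qh * z) (DX d d2 1 (qh * z) f) i k = DX d2 d (qh * z) 1 (\<lambda>k i. Rop d d2 (qh * z) f i k) k i"
  shows "Rop (Suc d) d2 z (DX (Suc d) d2 1 z f) (p + i) k
       = DX d2 (Suc d) z 1 (\<lambda>k i. Rop (Suc d) d2 z f i k) k (p + i)"
proof -
  define z' where "z' = qh powi (- int d) * z"
  have z': "z' \<noteq> 0" using assms by (simp add: z'_def)
  define H where "H = (\<lambda>i p k. Rop d d2 (qh * z) (\<lambda>i k. f (p + i) k) i k)"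
  \<comment> \<open>The leg \<open>p\<close> is split off. What remains is the coproduct on
    \<open>(i, k)\<close>, with the parameter \<open>qh * z\<close> at which \<open>Rop d\<close> is
    evaluated.\<close>
  have dec: "DX (Suc d) d2 1 z f (p + i) k
     = qint q (int p) * (qh powi (2 * int (i + k) - int d2) * f (p - 1 + i) k)
       + qh powi (- 2 * int p) * DX d d2 1 (qh * z) (\<lambda>i k. f (p + i) k) i k" if "p \<le> 1" for p i k
    proof -
    have "DX (Suc d) d2 1 z f (p + i) k = qint q (int p + int i) * qh powi (2 * int k - int d2) * f (p + i - 1) k
       + z * qh powi (int d + 1 - 2 * int (p + i)) * qint q (int k) * f (p + i) (k - 1)"
      by (simp add: DX_def algebra_simps)
    also have "qint q (int p + int i) * qh powi (2 * int k - int d2) * f (p + i - 1) k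
       = qint q (int p) * (q powi int i * qh powi (2 * int k - int d2)) * f (p - 1 + i) k
        + q powi (- int p) * (qint q (int i) * qh powi (2 * int k - int d2) * f (p + (i - 1)) k)"
      unfolding qint_add by (cases p; cases i) (simp_all add: algebra_simps)
    also have "q powi int i * qh powi (2 * int k - int d2) = qh powi (2 * int (i + k) - int d2)"
      by (simp add: qh_pow q_pow)
    also have "qh powi (int d + 1 - 2 * int (p + i)) = q powi (- int p) * (qh * qh powi (int d - 2 * int i))"
      by (simp add: qh_pow q_pow field_simps)
    also have "q powi (- int p) = qh powi (- 2 * int p)" by (simp add: qh_pow q_pow)
    finally show ?thesis by (simp add: DX_def algebra_simps)
  qed
  \<comment> \<open>The letter has now been exchanged between \<open>i\<close> and \<open>k\<close>;
    the terms on \<open>p\<close> and \<open>k\<close> recombine into the coproduct with parameter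
    \<open>z'\<close> that \<open>Lop_DX\<close> expects.\<close>
  have R: "Rop d d2 (qh * z) (\<lambda>i k. DX (Suc d) d2 1 z f (p + i) k) i k
     = qh powi (2 * int i) * DX 1 d2 1 z' (H i) p k + qint q (int i) * (qh powi (int d2 - 2 * int (p + k)) * H (i - 1) p k)"
    if "p \<le> 1" "k \<le> d2" for p k
    proof -
    let ?w = "\<lambda>n. qh powi (2 * int n - int d2)"
    have "Rop d d2 (qh * z) (\<lambda>i k. DX (Suc d) d2 1 z f (p + i) k) i k
      = qint q (int p) * Rop d d2 (qh * z) (\<lambda>i k. ?w (i + k) * f (p - 1 + i) k) i k
       + qh powi (- 2 * int p) * Rop d d2 (qh * z) (DX d d2 1 (qh * z) (\<lambda>i k. f (p + i) k)) i k"
      unfolding dec[OF that(1)] by (rule Rop_linear)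
    also have "Rop d d2 (qh * z) (\<lambda>i k. ?w (i + k) * f (p - 1 + i) k) i k = ?w (i + k) * H i (p - 1) k"
      unfolding H_def by (rule Rop_weight) (use assms that in auto)
    also have "Rop d d2 (qh * z) (DX d d2 1 (qh * z) (\<lambda>i k. f (p + i) k)) i k = DX d2 d (qh * z) 1 (\<lambda>k i. H i p k) k i"
      unfolding H_def by (rule IH) (use assms that in auto)
    also have "?w (i + k) = qh powi (2 * int i) * qh powi (2 * int k - int d2)"
      by (simp add: qh_pow q_pow field_simps)
    finally have X: "Rop d d2 (qh * z) (\<lambda>i k. DX (Suc d) d2 1 z f (p + i) k) i k
      = qh powi (2 * int i) * (qint q (int p) * qh powi (2 * int k - int d2) * H i (p - 1) k)
        + (qh powi (- 2 * int p) * (qh * z) * qh powi (2 * int i - int d)) * qint q (int k) * H i p (k - 1)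
        + (qh powi (- 2 * int p) * qh powi (int d2 - 2 * int k)) * qint q (int i) * H (i - 1) p k"
      by (simp add: DX_def algebra_simps)
    have b: "qh powi (- 2 * int p) * (qh * z) * qh powi (2 * int i - int d) = qh powi (2 * int i) * z' * qh powi (1 - 2 * int p)"
      by (simp add: z'_def qh_pow q_pow field_simps)
    have c: "qh powi (- 2 * int p) * qh powi (int d2 - 2 * int k) = qh powi (int d2 - 2 * int (p + k))"
      by (simp add: qh_pow q_pow field_simps)
    show ?thesis unfolding X b c by (simp add: DX_def algebra_simps)
  qed
  have L: "Rfactor d2 z' * Lop d2 z' (\<lambda>p k. Rop d d2 (qh * z) (\<lambda>i k. DX (Suc d) d2 1 z f (p + i) k) i k) p k
     = qh powi (2 * int i) * DX d2 1 z' 1 (\<lambda>k p. Rfactor d2 z' * Lop d2 z' (H i) p k) k p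
       + qint q (int i) * (qh powi (int d2 - 2 * int (p + k)) * (Rfactor d2 z' * Lop d2 z' (H (i - 1)) p k))"
    proof -
    let ?w = "\<lambda>n. qh powi (int d2 - 2 * int n)"
    have "Lop d2 z' (\<lambda>p k. Rop d d2 (qh * z) (\<lambda>i k. DX (Suc d) d2 1 z f (p + i) k) i k) p k
       = Lop d2 z' (\<lambda>p k. qh powi (2 * int i) * DX 1 d2 1 z' (H i) p k + qint q (int i) * (?w (p + k) * H (i - 1) p k)) p k"
      using assms by (intro Lop_cong) (auto simp: R)
    also have "\<dots> = qh powi (2 * int i) * Lop d2 z' (DX 1 d2 1 z' (H i)) p k
       + qint q (int i) * Lop d2 z' (\<lambda>p k. ?w (p + k) * H (i - 1) p k) p k"
      by (rule Lop_linear)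
    also have "Lop d2 z' (\<lambda>p k. ?w (p + k) * H (i - 1) p k) p k = ?w (p + k) * Lop d2 z' (H (i - 1)) p k"
      by (rule Lop_weight) (use assms in auto)
    also have "Lop d2 z' (DX 1 d2 1 z' (H i)) p k = DX d2 1 z' 1 (\<lambda>k p. Lop d2 z' (H i) p k) k p"
      by (rule Lop_DX) (use assms z' in auto)
    finally show ?thesis by (simp add: DX_def algebra_simps)
  qed
  have F: "Rfactor d2 z' * Lop d2 z' (H i) p k = Rop (Suc d) d2 z f (p + i) k" if "p \<le> 1" "i \<le> d" "k \<le> d2" for i p k
    using that fuse_Rop[of p i d k d2 z f] assms by (simp add: fuse_def z'_def H_def)
  show ?thesis proof -
    have "Rop (Suc d) d2 z (DX (Suc d) d2 1 z f) (p + i) k = fuse d d2 z (DX (Suc d) d2 1 z f) p i k"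
      using assms by (simp add: fuse_Rop)
    also have "\<dots> = qh powi (2 * int i) * DX d2 1 z' 1 (\<lambda>k p. Rop (Suc d) d2 z f (p + i) k) k p
       + qint q (int i) * (qh powi (int d2 - 2 * int (p + k)) * Rop (Suc d) d2 z f (p + (i - 1)) k)"
      unfolding fuse_def z'_def[symmetric] L using assms(1-3) by (simp add: F DX_def)
    also have "\<dots> = DX d2 (Suc d) z 1 (\<lambda>k i. Rop (Suc d) d2 z f i k) k (p + i)"
    proof -
      have a: "qh powi (2 * int i) * z' * qh powi (2 * int p - 1) = z * qh powi (2 * int (p + i) - int (Suc d))"
        by (simp add: z'_def qh_pow q_pow field_simps)
      have b: "qh powi (2 * int i) = q powi int i" by (simp add: qh_pow q_pow)
      have c: "qh powi (int d2 - 2 * int (p + k)) = q powi (- int p) * qh powi (int d2 - 2 * int k)"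
        by (simp add: qh_pow q_pow field_simps)
      have "qh powi (2 * int i) * DX d2 1 z' 1 (\<lambda>k p. Rop (Suc d) d2 z f (p + i) k) k p
         + qint q (int i) * (qh powi (int d2 - 2 * int (p + k)) * Rop (Suc d) d2 z f (p + (i - 1)) k)
        = (qh powi (2 * int i) * z' * qh powi (2 * int p - 1)) * qint q (int k) * Rop (Suc d) d2 z f (p + i) (k - 1)
          + qh powi (int d2 - 2 * int k) * (qint q (int p) * q powi int i * Rop (Suc d) d2 z f (p - 1 + i) k
              + q powi (- int p) * qint q (int i) * Rop (Suc d) d2 z f (p + (i - 1)) k)"
        unfolding c b[symmetric] by (simp add: DX_def algebra_simps)
      also have "qint q (int p) * q powi int i * Rop (Suc d) d2 z f (p - 1 + i) k
              + q powi (- int p) * qint q (int i) * Rop (Suc d) d2 z f (p + (i - 1)) k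
         = qint q (int p + int i) * Rop (Suc d) d2 z f (p + i - 1) k"
        unfolding qint_add by (cases p; cases i) (simp_all add: algebra_simps)
      finally show ?thesis unfolding a by (simp add: DX_def algebra_simps)
    qed
    finally show ?thesis .
  qed
qed

lemma Rop_DX:
  assumes "i \<le> d" "k \<le> d2" "z \<noteq> 0"
  shows "Rop d d2 z (DX d d2 1 z f) i k = DX d2 d z 1 (\<lambda>k i. Rop d d2 z f i k) k i"
  using assms
proof (induction d arbitrary: z f i k)
  case 0
  then show ?case by (simp add: DX_def)
next
  case (Suc d)
  have *: "Rop (Suc d) d2 z (DX (Suc d) d2 1 z f) (p + i) k
       = DX d2 (Suc d) z 1 (\<lambda>k i. Rop (Suc d) d2 z f i k) k (p + i)" if "p \<le> 1" "i \<le> d" for p i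
    by (rule fuse_DX) (use Suc that in auto)
  show ?case
  proof (cases i)
    case 0 then show ?thesis using *[of 0 0] by simp
  next
    case (Suc m) then show ?thesis using *[of 1 m] Suc.prems by simp
  qed
qed

section \<open>The letter \<open>Y\<close>, obtained from \<open>X\<close> by reversing the index
  ranges\<close>

definition DY :: "nat \<Rightarrow> nat \<Rightarrow> 'a \<Rightarrow> 'a \<Rightarrow> (nat \<Rightarrow> nat \<Rightarrow> 'a) \<Rightarrow> nat \<Rightarrow> nat \<Rightarrow> 'a" where
  "DY d1 d2 s t f i k = s * qint q (int d1 - int i) * qh powi (int d2 - 2 * int k) * f (i + 1) k
     + t * qh powi (2 * int i - int d1) * qint q (int d2 - int k) * f i (k + 1)"

lemma DY_flip:
  assumes "i \<le> d1" "k \<le> d2"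
  shows "DY d1 d2 s t f i k = DX d1 d2 s t (\<lambda>i k. f (d1 - i) (d2 - k)) (d1 - i) (d2 - k)"
proof -
  obtain i' k' where [simp]: "d1 = i + i'" "d2 = k + k'" using assms le_Suc_ex by metis
  show ?thesis by (cases i'; cases k') (simp_all add: DX_def DY_def algebra_simps)
qed

lemma DX_cong:
  assumes "\<And>i k. i \<le> d1 \<Longrightarrow> k \<le> d2 \<Longrightarrow> f i k = g i k" "i \<le> d1" "k \<le> d2"
  shows "DX d1 d2 s t f i k = DX d1 d2 s t g i k"
  using assms by (simp add: DX_def)

lemma DY_cong:
  assumes "\<And>i k. i \<le> d1 \<Longrightarrow> k \<le> d2 \<Longrightarrow> f i k = g i k" "i \<le> d1" "k \<le> d2"
  shows "DY d1 d2 s t f i k = DY d1 d2 s t g i k"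
  using assms by (cases "i = d1"; cases "k = d2") (simp_all add: DY_def)

lemma Rop_DY:
  assumes "i \<le> d" "k \<le> d2" "z \<noteq> 0"
  shows "Rop d d2 z (DY d d2 1 z f) i k = DY d2 d z 1 (\<lambda>k i. Rop d d2 z f i k) k i"
proof -
  let ?f = "\<lambda>i k. f (d - i) (d2 - k)"
  have "Rop d d2 z (DY d d2 1 z f) i k = Rop d d2 z (\<lambda>i k. DX d d2 1 z ?f (d - i) (d2 - k)) i k"
    using assms by (intro Rop_cong) (auto simp: DY_flip)
  also have "\<dots> = Rop d d2 z (DX d d2 1 z ?f) (d - i) (d2 - k)" using assms by (simp add: Rop_flip)
  also have "\<dots> = DX d2 d z 1 (\<lambda>k i. Rop d d2 z ?f i k) (d2 - k) (d - i)" using assms by (simp add: Rop_DX)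
  also have "\<dots> = DX d2 d z 1 (\<lambda>k i. Rop d d2 z f (d - i) (d2 - k)) (d2 - k) (d - i)"
    using assms by (intro DX_cong) (auto simp: Rop_flip)
  also have "\<dots> = DY d2 d z 1 (\<lambda>k i. Rop d d2 z f i k) k i" using assms by (subst DY_flip) auto
  finally show ?thesis .
qed

end

section \<open>Shuffles as iterated coproducts\<close>

text \<open>Only pairs of total length \<open>length w\<close> contribute to the coefficient of
  \<open>w\<close> in a shuffle. Restricting to them gives finite sums without conditions on
  supports.\<close>

definition word_pairs :: "nat \<Rightarrow> (letter list \<times> letter list) set" where
  "word_pairs n = {(u, v). length u + length v = n}"

lemma finite_word_pairs [simp]: "finite (word_pairs n)"
proof -
  have "set u \<subseteq> {X, Y}" for u using letter.exhaust by blast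
  then have fin: "finite {u :: letter list. length u \<le> n}"
    using finite_lists_length_le[of "{X, Y}" n] by simp
  show ?thesis
    by (rule finite_subset[OF _ finite_cartesian_product[OF fin fin]]) (auto simp: word_pairs_def)
qed

lemma shuf_Nil_right [simp]: "shuf q u [] = single u" by (cases u) simp_all

lemma shuf_Cons_word:
  "shuf q u v (a # w) = (if u \<noteq> [] \<and> hd u = a then shuf q (tl u) v w else 0)
    + (if v \<noteq> [] \<and> hd v = a then q powi (\<Sum>c \<leftarrow> u. bra a c) * shuf q u (tl v) w else 0)"
  by (cases u; cases v) (auto simp: prepend_def single_def)

text \<open>Dual form of the shuffle recursion: the first letter of the result came from
  \<open>u\<close>, or from \<open>v\<close> after passing all of \<open>u\<close>, which costs the
  power of \<open>q\<close>. The test function \<open>G\<close> absorbs the letter, which is how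
  \<open>Dw_shuffle\<close> uses it.\<close>

lemma shuf_sum_Cons:
  "(\<Sum>(u, v) \<in> word_pairs (Suc n). shuf q u v (a # w) * G u v)
   = (\<Sum>(u, v) \<in> word_pairs n. shuf q u v w * (G (a # u) v + q powi (\<Sum>c \<leftarrow> u. bra a c) * G u (a # v)))"
proof -
  let ?S = "word_pairs (Suc n)" and ?P = "word_pairs n"
  let ?F1 = "\<lambda>(u, v). (if u \<noteq> [] \<and> hd u = a then shuf q (tl u) v w else 0) * G u v"
  let ?F2 = "\<lambda>(u, v). (if v \<noteq> [] \<and> hd v = a then q powi (\<Sum>c \<leftarrow> u. bra a c) * shuf q u (tl v) w else 0) * G u v"
  have "(\<Sum>(u, v) \<in> ?S. shuf q u v (a # w) * G u v) = sum ?F1 ?S + sum ?F2 ?S"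
    unfolding sum.distrib[symmetric] by (intro sum.cong refl) (auto simp: shuf_Cons_word algebra_simps)
  also have "sum ?F1 ?S = sum ?F1 ((\<lambda>(u, v). (a # u, v)) ` ?P)"
  proof (rule sum.mono_neutral_right)
    show "\<forall>x\<in>?S - (\<lambda>(u, v). (a # u, v)) ` ?P. ?F1 x = 0"
    proof (clarify, rule ccontr)
      fix u v assume 1: "(u, v) \<in> ?S" "(u, v) \<notin> (\<lambda>(u, v). (a # u, v)) ` ?P"
        "(if u \<noteq> [] \<and> hd u = a then shuf q (tl u) v w else 0) * G u v \<noteq> 0"
      then obtain u' where "u = a # u'" by (cases u) (auto split: if_splits)
      then show False using 1 by (auto simp: word_pairs_def image_iff)
    qed
  qed (simp, auto simp: word_pairs_def)
  also have "\<dots> = (\<Sum>(u, v) \<in> ?P. shuf q u v w * G (a # u) v)"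
    by (subst sum.reindex) (auto simp: inj_on_def intro!: sum.cong)
  also have "sum ?F2 ?S = sum ?F2 ((\<lambda>(u, v). (u, a # v)) ` ?P)"
  proof (rule sum.mono_neutral_right)
    show "\<forall>x\<in>?S - (\<lambda>(u, v). (u, a # v)) ` ?P. ?F2 x = 0"
    proof (clarify, rule ccontr)
      fix u v assume 1: "(u, v) \<in> ?S" "(u, v) \<notin> (\<lambda>(u, v). (u, a # v)) ` ?P"
        "(if v \<noteq> [] \<and> hd v = a then q powi (\<Sum>c \<leftarrow> u. bra a c) * shuf q u (tl v) w else 0) * G u v \<noteq> 0"
      then obtain v' where "v = a # v'" by (cases v) (auto split: if_splits)
      then show False using 1 by (auto simp: word_pairs_def image_iff)
    qed
  qed (simp, auto simp: word_pairs_def)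
  also have "\<dots> = (\<Sum>(u, v) \<in> ?P. shuf q u v w * (q powi (\<Sum>c \<leftarrow> u. bra a c) * G u (a # v)))"
    by (subst sum.reindex) (auto simp: inj_on_def mult_ac intro!: sum.cong)
  finally show ?thesis by (simp add: sum.distrib[symmetric] case_prod_beta distrib_left)
qed

lemma height_simps [simp]: "height [] = 0" "height (a # w) = bar a + height w"
  "height (u @ v) = height u + height v" "height (replicate n a) = int n * bar a"
  by (simp_all add: height_def sum_list_replicate)

lemma bar_simps [simp]: "bar X = 1" "bar Y = -1" by (simp_all add: bar_def)

lemma sum_bra: "(\<Sum>c \<leftarrow> u. bra a c) = 2 * bar a * height u"
proof (induction u)
  case (Cons c u) then show ?case by (cases a; cases c) (simp_all add: bra_def algebra_simps)
qed simp

section \<open>Words as operators on one and on two tensor factors\<close>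

context qparam begin

text \<open>The standard raising and lowering operators of the (d + 1)-dimensional module of
  U_q(sl_2). The weight vanishes where the argument would leave the range from 0 to
  \<open>d\<close>.\<close>

definition Aop :: "nat \<Rightarrow> letter \<Rightarrow> (nat \<Rightarrow> 'a) \<Rightarrow> nat \<Rightarrow> 'a" where
  "Aop d a f h = (case a of X \<Rightarrow> qint q (int h) * f (h - 1) | Y \<Rightarrow> qint q (int d - int h) * f (h + 1))"

primrec Aw :: "nat \<Rightarrow> letter list \<Rightarrow> (nat \<Rightarrow> 'a) \<Rightarrow> nat \<Rightarrow> 'a" where
  "Aw d [] f = f"
| "Aw d (a # w) f = Aw d w (Aop d a f)"

definition Dop :: "nat \<Rightarrow> nat \<Rightarrow> 'a \<Rightarrow> 'a \<Rightarrow> letter \<Rightarrow> (nat \<Rightarrow> nat \<Rightarrow> 'a) \<Rightarrow> nat \<Rightarrow> nat \<Rightarrow> 'a" where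
  "Dop d1 d2 s t a f = (case a of X \<Rightarrow> DX d1 d2 s t f | Y \<Rightarrow> DY d1 d2 s t f)"

primrec Dw :: "nat \<Rightarrow> nat \<Rightarrow> 'a \<Rightarrow> 'a \<Rightarrow> letter list \<Rightarrow> (nat \<Rightarrow> nat \<Rightarrow> 'a) \<Rightarrow> nat \<Rightarrow> nat \<Rightarrow> 'a" where
  "Dw d1 d2 s t [] f = f"
| "Dw d1 d2 s t (a # w) f = Dw d1 d2 s t w (Dop d1 d2 s t a f)"

lemma Dop_Aop: "Dop d1 d2 s t a f i k = s * qh powi (- bar a * (int d2 - 2 * int k)) * Aop d1 a (\<lambda>i. f i k) i
    + t * qh powi (bar a * (int d1 - 2 * int i)) * Aop d2 a (f i) k"
  by (cases a) (simp_all add: Dop_def DX_def DY_def Aop_def)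

lemma Aop_linear: "Aop d a (\<lambda>i. x * f i + y * g i) i = x * Aop d a f i + y * Aop d a g i"
  by (cases a) (simp_all add: Aop_def algebra_simps)

lemma Aw_linear: "Aw d w (\<lambda>i. x * f i + y * g i) i = x * Aw d w f i + y * Aw d w g i"
  by (induction w arbitrary: f g) (simp_all add: Aop_linear[abs_def])

lemma Aw_scale: "Aw d w (\<lambda>i. x * f i) i = x * Aw d w f i"
  using Aw_linear[of d w x f 0 f i] by simp

text \<open>Each letter moves the index by one and so multiplies such a power of \<open>qh\<close>
  by a constant; along a word the shifts add up to the height.\<close>

lemma Aw_weight: "Aw d w (\<lambda>k. qh powi (x * (y - 2 * int k)) * f k) c = qh powi (x * (y - 2 * int c + 2 * height w)) * Aw d w f c"
proof (induction w arbitrary: f y)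
  case (Cons a w)
  have "Aop d a (\<lambda>k. qh powi (x * (y - 2 * int k)) * f k) = (\<lambda>k. qh powi (x * ((y + 2 * bar a) - 2 * int k)) * Aop d a f k)"
  proof
    fix k show "Aop d a (\<lambda>k. qh powi (x * (y - 2 * int k)) * f k) k = qh powi (x * ((y + 2 * bar a) - 2 * int k)) * Aop d a f k"
      by (cases a; cases k) (simp_all add: Aop_def algebra_simps)
  qed
  then show ?case using Cons.IH[of "y + 2 * bar a" "Aop d a f"] by (simp add: algebra_simps)
qed simp

lemma Aop_Aw_commute: "Aop d1 a (\<lambda>i. Aw d2 v (f i) c) i = Aw d2 v (\<lambda>k. Aop d1 a (\<lambda>i. f i k) i) c"
  by (cases a) (simp_all add: Aop_def Aw_scale)

text \<open>The exponent collects the weights of all coproducts after they have been pulled through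
  the later letters of \<open>u\<close> and \<open>v\<close>. By \<open>e1\<close> and
  \<open>e2\<close> it changes correctly when a letter joins \<open>u\<close> or \<open>v\<close>;
  in the second case the power of \<open>q\<close> from the shuffle makes up the difference.\<close>

lemma Dw_shuffle:
  "(\<Sum>(u, v) \<in> word_pairs (length w). shuf q u v w * (s ^ length u * t ^ length v *
      qh powi (- 2 * height u * height v + (int d1 - 2 * int c1) * height v - (int d2 - 2 * int c2) * height u)
      * Aw d1 u (\<lambda>i. Aw d2 v (f i) c2) c1)) = Dw d1 d2 s t w f c1 c2"
proof (induction w arbitrary: f)
  case Nil
  have "word_pairs 0 = {([], [])}" by (auto simp: word_pairs_def)
  then show ?case by (simp add: single_def)
next
  case (Cons a w)
  let ?E = "\<lambda>n1 n2. - 2 * n1 * n2 + (int d1 - 2 * int c1) * n2 - (int d2 - 2 * int c2) * n1"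
  have A: "Aw d1 u (\<lambda>i. Aw d2 v (Dop d1 d2 s t a f i) c2) c1
     = s * qh powi (- bar a * (int d2 - 2 * int c2 + 2 * height v)) * Aw d1 (a # u) (\<lambda>i. Aw d2 v (f i) c2) c1
       + t * qh powi (bar a * (int d1 - 2 * int c1 + 2 * height u)) * Aw d1 u (\<lambda>i. Aw d2 (a # v) (f i) c2) c1" for u v
  proof -
    have "Aw d2 v (Dop d1 d2 s t a f i) c2
       = Aw d2 v (\<lambda>k. s * (qh powi (- bar a * (int d2 - 2 * int k)) * Aop d1 a (\<lambda>i. f i k) i)
          + t * qh powi (bar a * (int d1 - 2 * int i)) * Aop d2 a (f i) k) c2" for i
      by (simp add: Dop_Aop[abs_def] mult.assoc)
    also have "\<dots> i = s * (qh powi (- bar a * (int d2 - 2 * int c2 + 2 * height v)) * Aw d2 v (\<lambda>k. Aop d1 a (\<lambda>i. f i k) i) c2)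
       + t * qh powi (bar a * (int d1 - 2 * int i)) * Aw d2 (a # v) (f i) c2" for i
      unfolding Aw_linear Aw_weight by simp
    finally have "Aw d1 u (\<lambda>i. Aw d2 v (Dop d1 d2 s t a f i) c2) c1
      = Aw d1 u (\<lambda>i. (s * qh powi (- bar a * (int d2 - 2 * int c2 + 2 * height v))) * Aop d1 a (\<lambda>i. Aw d2 v (f i) c2) i
        + t * (qh powi (bar a * (int d1 - 2 * int i)) * Aw d2 (a # v) (f i) c2)) c1"
      by (simp add: Aop_Aw_commute mult.assoc)
    then show ?thesis unfolding Aw_linear Aw_weight by simp
  qed
  have gen: "Q * E2 = E * e3 \<Longrightarrow> S * (s * a * b * (E * e1) * A1 + Q * (a * (t * b) * E2 * A2)) = S * (a * b * E * (s * e1 * A1 + t * e3 * A2))"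
    for Q E2 E e3 S s a b e1 A1 t A2 :: 'a by algebra
  have e1: "qh powi (?E n1 n2) * qh powi (- bar a * (int d2 - 2 * int c2 + 2 * n2)) = qh powi ?E (bar a + n1) n2" for n1 n2
    by (simp add: power_int_add[symmetric] algebra_simps)
  have e2: "qh powi (?E n1 n2) * qh powi (bar a * (int d1 - 2 * int c1 + 2 * n1))
      = q powi (2 * bar a * n1) * qh powi ?E n1 (bar a + n2)" for n1 n2
  proof -
    have "q powi (2 * bar a * n1) = qh powi (4 * bar a * n1)"
      unfolding q_powi by (simp add: power_int_add[symmetric] mult_ac)
    then show ?thesis by (simp add: power_int_add[symmetric] algebra_simps)
  qed
  have "(\<Sum>(u, v) \<in> word_pairs (length (a # w)). shuf q u v (a # w) * (s ^ length u * t ^ length v *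
      qh powi (?E (height u) (height v)) * Aw d1 u (\<lambda>i. Aw d2 v (f i) c2) c1))
    = (\<Sum>(u, v) \<in> word_pairs (length w). shuf q u v w * (s ^ length u * t ^ length v *
      qh powi (?E (height u) (height v)) * Aw d1 u (\<lambda>i. Aw d2 v (Dop d1 d2 s t a f i) c2) c1))"
    unfolding list.size(4) add_Suc_right add_0_right shuf_sum_Cons A
  proof (intro sum.cong refl, clarify)
    fix u v
    show "shuf q u v w * (s ^ Suc (length u) * t ^ length v * qh powi ?E (height (a # u)) (height v) * Aw d1 (a # u) (\<lambda>i. Aw d2 v (f i) c2) c1
       + q powi (\<Sum>c\<leftarrow>u. bra a c) * (s ^ length u * t ^ Suc (length v) * qh powi ?E (height u) (height (a # v)) * Aw d1 u (\<lambda>i. Aw d2 (a # v) (f i) c2) c1))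
      = shuf q u v w * (s ^ length u * t ^ length v * qh powi ?E (height u) (height v) *
         (s * qh powi (- bar a * (int d2 - 2 * int c2 + 2 * height v)) * Aw d1 (a # u) (\<lambda>i. Aw d2 v (f i) c2) c1
       + t * qh powi (bar a * (int d1 - 2 * int c1 + 2 * height u)) * Aw d1 u (\<lambda>i. Aw d2 (a # v) (f i) c2) c1))"
      unfolding sum_bra height_simps e1[symmetric]
      by (simp only: power_Suc, rule gen, rule e2[symmetric])
  qed
  then show ?case using Cons.IH[of "Dop d1 d2 s t a f"] by simp
qed

lemma Dop_cong:
  assumes "\<And>i k. i \<le> d1 \<Longrightarrow> k \<le> d2 \<Longrightarrow> f i k = g i k" "i \<le> d1" "k \<le> d2"
  shows "Dop d1 d2 s t a f i k = Dop d1 d2 s t a g i k"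
  using DX_cong[OF assms] DY_cong[OF assms] by (cases a) (auto simp: Dop_def)

lemma Dw_cong:
  assumes "\<And>i k. i \<le> d1 \<Longrightarrow> k \<le> d2 \<Longrightarrow> f i k = g i k" "i \<le> d1" "k \<le> d2"
  shows "Dw d1 d2 s t w f i k = Dw d1 d2 s t w g i k"
  using assms
proof (induction w arbitrary: f g)
  case (Cons a w)
  have "Dw d1 d2 s t w (Dop d1 d2 s t a f) i k = Dw d1 d2 s t w (Dop d1 d2 s t a g) i k"
    by (rule Cons.IH) (use Cons.prems in \<open>auto intro: Dop_cong\<close>)
  then show ?case by simp
qed simp

lemma Rop_Dop:
  assumes "i \<le> d1" "k \<le> d2" "z \<noteq> 0"
  shows "Rop d1 d2 z (Dop d1 d2 1 z a f) i k = Dop d2 d1 z 1 a (\<lambda>k i. Rop d1 d2 z f i k) k i"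
  using assms by (cases a) (auto simp: Dop_def Rop_DX Rop_DY)

lemma Rop_Dw:
  assumes "i \<le> d1" "k \<le> d2" "z \<noteq> 0"
  shows "Rop d1 d2 z (Dw d1 d2 1 z w f) i k = Dw d2 d1 z 1 w (\<lambda>k i. Rop d1 d2 z f i k) k i"
  using assms
proof (induction w arbitrary: f)
  case (Cons a w)
  have "Rop d1 d2 z (Dw d1 d2 1 z (a # w) f) i k
     = Dw d2 d1 z 1 w (\<lambda>k i. Rop d1 d2 z (Dop d1 d2 1 z a f) i k) k i" using Cons by simp
  also have "\<dots> = Dw d2 d1 z 1 w (Dop d2 d1 z 1 a (\<lambda>k i. Rop d1 d2 z f i k)) k i"
    by (rule Dw_cong) (use Cons.prems in \<open>auto simp: Rop_Dop\<close>)
  finally show ?case by simp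
qed simp

lemma Dop_sum:
  assumes "finite S"
  shows "Dop d1 d2 s t a (\<lambda>i k. \<Sum>x\<in>S. c x * f x i k) i k = (\<Sum>x\<in>S. c x * Dop d1 d2 s t a (f x) i k)"
  by (cases a) (simp_all add: Dop_def DX_def DY_def sum_distrib_left sum_distrib_right distrib_left sum.distrib mult_ac)

lemma Dw_sum:
  assumes "finite S"
  shows "Dw d1 d2 s t w (\<lambda>i k. \<Sum>x\<in>S. c x * f x i k) i k = (\<Sum>x\<in>S. c x * Dw d1 d2 s t w (f x) i k)"
proof (induction w arbitrary: f)
  case (Cons a w)
  have "Dop d1 d2 s t a (\<lambda>i k. \<Sum>x\<in>S. c x * f x i k) = (\<lambda>i k. \<Sum>x\<in>S. c x * Dop d1 d2 s t a (f x) i k)"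
    by (intro ext Dop_sum assms)
  then show ?case using Cons[of "\<lambda>x. Dop d1 d2 s t a (f x)"] by simp
qed simp

end

section \<open>The entries of the $K$-matrix\<close>

lemma even_height: "even (height w) \<longleftrightarrow> even (length w)"
proof (induction w)
  case (Cons a w) then show ?case by (cases a) auto
qed simp

lemma length_height: "int (length w) = 2 * int (count_list w X) - height w"
proof (induction w)
  case (Cons a w) then show ?case by (cases a) auto
qed simp

lemma qfact_0 [simp]: "qfact q 0 = 1" by (simp add: qfact_def)
lemma qfact_Suc: "qfact q (Suc n) = qint q (int (Suc n)) * qfact q n" by (simp add: qfact_def mult.commute)
lemma rfact_Suc: "rfact r (Suc n) = r (Suc n) * rfact r n" by (simp add: rfact_def mult.commute)

context qparam begin

lemma qint_nz: "n > 0 \<Longrightarrow> qint q (int n) \<noteq> 0"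
proof
  assume n: "n > 0" and "qint q (int n) = 0"
  then have "q ^ n = inverse (q ^ n)" using q_inv_nz by (simp add: qint_def power_int_minus)
  then have "q ^ (2 * n) = 1" using q_nz by (simp add: power_add mult_2) (simp add: field_simps)
  then show False using q_not_root[of "2 * n"] n by simp
qed

lemma qfact_nz [simp]: "qfact q n \<noteq> 0"
  using qint_nz by (simp add: qfact_def)

lemma r_nz: "n > 0 \<Longrightarrow> r n \<noteq> 0" using r_sqrt[of n] qint_nz[of n] by auto

lemma rfact_nz [simp]: "rfact r n \<noteq> 0"
  using r_nz by (simp add: rfact_def)

lemma rfact_sq: "rfact r n * rfact r n = qfact q n"
  by (simp add: rfact_def qfact_def prod.distrib[symmetric] r_sqrt)

section \<open>Weights of lattice paths, and the coefficients of Delta\<close>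

primrec path_weight :: "int \<Rightarrow> int \<Rightarrow> letter list \<Rightarrow> 'a" where
  "path_weight m h [] = 1"
| "path_weight m h (a # w) = qint q (h + (if a = X then m else 0)) * path_weight m (h + bar a) w"

lemma path_weight_append: "path_weight m h (u @ v) = path_weight m h u * path_weight m (h + height u) v"
  by (induction u arbitrary: h) (simp_all add: algebra_simps)

lemma prod_path_weight:
  "(\<Prod>i < length w. qint q (h + height (take i w) + (if w ! i = X then m else 0))) = path_weight m h w"
proof (induction w arbitrary: h)
  case (Cons a w)
  show ?case using Cons.IH[of "h + bar a"] by (simp add: prod.lessThan_Suc_shift algebra_simps del: prod.lessThan_Suc)
qed simp

text \<open>A path that leaves the upper half plane takes a step \<open>Y\<close> at height 0, of weight $[0]_q = 0$.\<close>

lemma path_weight_negative: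
  "h \<ge> 0 \<Longrightarrow> h + height (take i w) < 0 \<Longrightarrow> path_weight m h w = 0"
proof (induction w arbitrary: h i)
  case (Cons a w)
  then obtain j where i: "i = Suc j" by (cases i) auto
  show ?case
  proof (cases "h + bar a < 0")
    case True
    then have "a = Y" "h = 0" using Cons.prems(1) by (cases a; simp)+
    then show ?thesis by simp
  next
    case False
    then show ?thesis using Cons.IH[of "h + bar a" j] Cons.prems i by simp
  qed
qed simp

text \<open>Words of height 0 that are not Catalan drop out by themselves, by
  \<open>path_weight_negative\<close>. The weight is then multiplicative along arbitrary pieces of a
  word.\<close>

lemma Delta_path_weight:
  "Delta q m n w = (if length w = 2 * n \<and> height w = 0 then path_weight m 0 w else 0)"
proof (cases "length w = 2 * n \<and> height w = 0 \<and> \<not> catalan w")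
  case True
  then obtain i where "height (take i w) < 0" by (auto simp: catalan_def not_le)
  then show ?thesis using True path_weight_negative[of 0 i w m] by (simp add: Delta_def Cat_def)
next
  case False
  then show ?thesis using prod_path_weight[of 0 w m] by (auto simp: Delta_def Cat_def catalan_def)
qed

text \<open>The steps have weights -[d - h], -[d - h - 1], and so on; the product is a quotient of
  q-factorials, stated without division.\<close>

lemma path_weight_X: "h + n \<le> d \<Longrightarrow> path_weight (- int d) (int h) (replicate n X) * qfact q (d - h - n) = (- 1) ^ n * qfact q (d - h)"
proof (induction n arbitrary: h)
  case (Suc n)
  obtain e where d: "d = h + Suc n + e" using Suc.prems le_Suc_ex by blast
  then have diffs: "d - h = Suc (n + e)" "d - Suc h = n + e" "d - h - Suc n = e" "d - Suc h - n = e" by auto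
  have "path_weight (- int d) (int (Suc h)) (replicate n X) * qfact q e = (- 1) ^ n * qfact q (n + e)"
    using Suc.IH[of "Suc h"] Suc.prems unfolding diffs by simp
  moreover have "qint q (int h - int d) = - qint q (int (Suc (n + e)))"
    unfolding qint_minus[symmetric] using d by simp
  ultimately show ?case unfolding diffs
    by (simp only: replicate_Suc path_weight.simps if_True bar_simps qfact_Suc power_Suc of_nat_Suc)
       (simp add: algebra_simps)
qed simp

lemma path_weight_Y: "path_weight m (int n) (replicate n Y) = qfact q n"
  by (induction n) (simp_all add: qfact_Suc)

definition delta :: "nat \<Rightarrow> nat \<Rightarrow> 'a" where "delta b i = (if i = b then 1 else 0)"

lemma Aw_cong:
  assumes "\<And>i. i \<le> d \<Longrightarrow> f i = g i" "c \<le> d"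
  shows "Aw d w f c = Aw d w g c"
  using assms
proof (induction w arbitrary: f g)
  case (Cons a w)
  have "Aop d a f i = Aop d a g i" if "i \<le> d" for i
    using that Cons.prems(1) by (cases a; cases "i = d") (simp_all add: Aop_def)
  then have "Aw d w (Aop d a f) c = Aw d w (Aop d a g) c" by (rule Cons.IH) (use Cons.prems in auto)
  then show ?case by simp
qed simp

text \<open>From index b, \<open>Aop\<close> has weights [b + 1] up and [d - b + 1] down, whereas
  \<open>path_weight (- int d)\<close> has -[d - b] up and [b] down. The quotients telescope through
  [b]! [d - b]!, and each \<open>X\<close> contributes a sign.\<close>

lemma Aw_delta:
  assumes "b \<le> d" "c \<le> d"
  shows "Aw d w (delta b) c * (qfact q b * qfact q (d - b)) =
    (if int b + height w = int c then (- 1) ^ count_list w X * path_weight (- int d) (int b) w * (qfact q c * qfact q (d - c)) else 0)"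
  using assms(1)
proof (induction w arbitrary: b)
  case Nil then show ?case by (auto simp: delta_def)
next
  case (Cons a w)
  show ?case
  proof (cases a)
    case X
    have A: "Aop d X (delta b) = (\<lambda>i. qint q (int (Suc b)) * delta (Suc b) i)"
    proof
      fix i show "Aop d X (delta b) i = qint q (int (Suc b)) * delta (Suc b) i"
        by (cases i) (auto simp: Aop_def delta_def)
    qed
    show ?thesis
    proof (cases "b = d")
      case True
      \<comment> \<open>At the top both sides vanish: \<open>delta (Suc d)\<close> is zero on the
        range, and the path weight contains [d - d].\<close>
      have "Aw d w (delta (Suc b)) c = Aw d w (\<lambda>i. 0 * delta 0 i) c"
        by (rule Aw_cong) (use assms True in \<open>auto simp: delta_def\<close>)
      then have "Aw d w (Aop d X (delta b)) c = 0" unfolding A Aw_scale by simp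
      then show ?thesis using True X by simp
    next
      case False
      then obtain e where d: "d = b + Suc e" using Cons.prems less_imp_Suc_add by fastforce
      have m: "qint q (int b - int d) = - qint q (int (Suc e))" unfolding qint_minus[symmetric] using d by simp
      have diffs: "d - b = Suc e" "d - Suc b = e" using d by auto
      have "Aw d (a # w) (delta b) c * (qfact q b * qfact q (d - b))
          = qint q (int (Suc e)) * (Aw d w (delta (Suc b)) c * (qfact q (Suc b) * qfact q (d - Suc b)))"
        unfolding diffs X Aw.simps A Aw_scale qfact_Suc by (simp add: mult_ac)
      also have "\<dots> = qint q (int (Suc e)) * (if int (Suc b) + height w = int c then (- 1) ^ count_list w X
           * path_weight (- int d) (int (Suc b)) w * (qfact q c * qfact q (d - c)) else 0)"
        using Cons.IH[of "Suc b"] d by simp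
      also have "\<dots> = (if int b + height (a # w) = int c then (- 1) ^ count_list (a # w) X
           * path_weight (- int d) (int b) (a # w) * (qfact q c * qfact q (d - c)) else 0)"
        using m X by (auto simp: algebra_simps)
      finally show ?thesis .
    qed
  next
    case Y
    show ?thesis
    proof (cases b)
      case 0
      have "Aop d Y (delta b) = (\<lambda>i. 0 * delta 0 i)" by (auto simp: Aop_def delta_def 0 fun_eq_iff)
      then have "Aw d w (Aop d Y (delta b)) c = 0" using Aw_scale[of d w 0 "delta 0" c] by simp
      then show ?thesis using 0 Y by simp
    next
      case (Suc e)
      have A: "Aop d Y (delta b) = (\<lambda>i. qint q (int (d - e)) * delta e i)"
        using Cons.prems Suc by (auto simp: Aop_def delta_def fun_eq_iff)
      obtain e' where d: "d = b + e'" using Cons.prems le_Suc_ex by blast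
      then have diffs: "d - e = Suc e'" "d - b = e'" using Suc by auto
      have "Aw d (a # w) (delta b) c * (qfact q b * qfact q (d - b))
          = qint q (int b) * (Aw d w (delta e) c * (qfact q e * qfact q (d - e)))"
        unfolding Y Aw.simps A Aw_scale diffs unfolding Suc qfact_Suc by (simp add: mult_ac)
      also have "\<dots> = qint q (int b) * (if int e + height w = int c then (- 1) ^ count_list w X
           * path_weight (- int d) (int e) w * (qfact q c * qfact q (d - c)) else 0)"
        using Cons.IH[of e] Suc Cons.prems by simp
      also have "\<dots> = (if int b + height (a # w) = int c then (- 1) ^ count_list (a # w) X
           * path_weight (- int d) (int b) (a # w) * (qfact q c * qfact q (d - c)) else 0)"
        using Suc Y by (auto simp: algebra_simps)
      finally show ?thesis .
    qed
  qed
qed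

definition gauge :: "nat \<Rightarrow> nat \<Rightarrow> 'a" where "gauge d i = rfact r i * rfact r (d - i)"

lemma gauge_nz [simp]: "gauge d i \<noteq> 0" by (simp add: gauge_def)

text \<open>The outer runs of \<open>X\<close> and \<open>Y\<close> in \<open>W\<close> contribute
  q-factorials, which \<open>phi\<close> completes to the gauge. The sign (-1)^n, with n the number
  of \<open>X\<close> in \<open>W\<close>, cancels the signs from \<open>path_weight_X\<close> and
  \<open>Aw_delta\<close>.\<close>

lemma Kser_eq:
  assumes "a \<le> d" "b \<le> d"
  shows "Kser q qh r d a b e w = (if e = int (length w) then
     gauge d b / gauge d a * qh powi rho2 (int a + 1) (int b + 1) (int d) * Aw d w (delta b) (d - a) else 0)"
proof -
  define W where "W = replicate b X @ w @ replicate (d - a) Y"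
  define m where "m = e - (int a - int b - int d)"
  have lW: "int (length W) = int b + int (length w) + (int d - int a)" using assms by (simp add: W_def)
  have hW: "height W = int b + height w - (int d - int a)" using assms by (simp add: W_def)
  have K: "Kser q qh r d a b e w = (if 0 \<le> m \<and> even m then phi q qh r d a b * (-1) ^ (nat m div 2) * Delta q (- int d) (nat m div 2) W else 0)"
    unfolding Kser_def W_def m_def Let_def by (simp only: if_distribR zero_fun_apply)
  show ?thesis
  proof (cases "int b + height w = int d - int a")
    case False
    then show ?thesis using Aw_delta[of b d "d - a" w] assms hW by (auto simp: K Delta_path_weight)
  next
    case True
    then have h0: "height W = 0" using hW by simp
    then have ev: "even (length W)" using even_height[of W] by simp
    show ?thesis
    proof (cases "e = int (length w)")
      case False
      \<comment> \<open>The shift of the exponent in \<open>Kser\<close> equals the number of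
        deleted letters up to the sign convention, so \<open>m\<close> is the length of
        \<open>W\<close> exactly when \<open>e\<close> is the length of \<open>w\<close>.\<close>
      then have "int (length W) \<noteq> m" by (simp add: lW m_def)
      then have "\<not> (0 \<le> m \<and> even m \<and> length W = 2 * (nat m div 2))" by auto
      then show ?thesis using False by (auto simp: K Delta_path_weight)
    next
      case e: True
      then have m: "m = int (length W)" by (simp add: lW m_def)
      \<comment> \<open>In a word of height 0 half of the letters are \<open>X\<close>.\<close>
      have cnt: "nat m div 2 = b + count_list w X"
        using lW length_height[of w] True m by auto
      have "Kser q qh r d a b e w = phi q qh r d a b * (-1) ^ (b + count_list w X) * path_weight (- int d) 0 W"
        using m ev h0 cnt by (auto simp: K Delta_path_weight)
      also have "path_weight (- int d) 0 W = path_weight (- int d) 0 (replicate b X) * (path_weight (- int d) (int b) w * qfact q (d - a))"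
        using True assms path_weight_Y[of "- int d" "d - a"] by (simp add: W_def path_weight_append)
      also have "path_weight (- int d) 0 (replicate b X) = (- 1) ^ b * qfact q d / qfact q (d - b)"
        using path_weight_X[of 0 b d] assms by (simp add: field_simps)
      finally have 1: "Kser q qh r d a b e w = qh powi rho2 (int a + 1) (int b + 1) (int d) * (rfact r a * rfact r (d - b) / (rfact r b * rfact r (d - a)))
         * ((- 1) ^ count_list w X * path_weight (- int d) (int b) w * qfact q (d - a) / qfact q (d - b))"
        by (simp add: phi_def power_add field_simps)
      have "Aw d w (delta b) (d - a) = (- 1) ^ count_list w X * path_weight (- int d) (int b) w * (qfact q (d - a) * qfact q a) / (qfact q b * qfact q (d - b))"
        using Aw_delta[of b d "d - a" w] assms True by (simp add: field_simps)
      then show ?thesis using e unfolding 1 by (simp add: gauge_def rfact_sq[symmetric] field_simps)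
    qed
  qed
qed

end

section \<open>Evaluation of the $R$-matrices\<close>

lemma sum_fun_apply: "(sum F A) x = (\<Sum>c\<in>A. F c x)"
  by (induction A rule: infinite_finite_induct) auto

text \<open>Laurent polynomials are encoded as arbitrary functions on the integers; finiteness of
  the support has to be carried along because a sum over an infinite set is 0.\<close>

definition lp_fin :: "'a::zero lp \<Rightarrow> bool" where "lp_fin p \<longleftrightarrow> finite {e. p e \<noteq> 0}"

definition ev :: "'a::field \<Rightarrow> 'a lp \<Rightarrow> 'a" where "ev z p = (\<Sum>e | p e \<noteq> 0. p e * z powi e)"

lemma ev_superset: "finite S \<Longrightarrow> {e. p e \<noteq> 0} \<subseteq> S \<Longrightarrow> ev z p = (\<Sum>e\<in>S. p e * z powi e)"
  unfolding ev_def by (rule sum.mono_neutral_left) auto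

lemma ev_0 [simp]: "ev z 0 = 0" "lp_fin 0" by (simp_all add: ev_def lp_fin_def)

lemma lp_fin_subset: "finite S \<Longrightarrow> {e. p e \<noteq> 0} \<subseteq> S \<Longrightarrow> lp_fin p"
  unfolding lp_fin_def by (rule finite_subset)

lemma ev_sum:
  assumes "\<And>c. c \<in> A \<Longrightarrow> lp_fin (F c)" "finite A"
  shows "ev z (sum F A) = (\<Sum>c\<in>A. ev z (F c))" "lp_fin (sum F A)"
proof -
  let ?S = "\<Union>c\<in>A. {e. F c e \<noteq> 0}"
  have S: "finite ?S" using assms by (auto simp: lp_fin_def)
  have sub: "{e. sum F A e \<noteq> 0} \<subseteq> ?S"
    by (auto simp: sum_fun_apply dest: sum.not_neutral_contains_not_neutral)
  then show "lp_fin (sum F A)" using S lp_fin_subset by blast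
  have "ev z (sum F A) = (\<Sum>e\<in>?S. \<Sum>c\<in>A. F c e * z powi e)"
    unfolding ev_superset[OF S sub] by (simp add: sum_fun_apply sum_distrib_right)
  also have "\<dots> = (\<Sum>c\<in>A. \<Sum>e\<in>?S. F c e * z powi e)" by (rule sum.swap)
  also have "\<dots> = (\<Sum>c\<in>A. ev z (F c))" using S by (intro sum.cong refl ev_superset[symmetric]) auto
  finally show "ev z (sum F A) = (\<Sum>c\<in>A. ev z (F c))" .
qed

lemma ev_lpmul:
  assumes "lp_fin p" "lp_fin r" "z \<noteq> 0"
  shows "ev z (lpmul p r) = ev z p * ev z r" "lp_fin (lpmul p r)"
proof -
  let ?P = "{e. p e \<noteq> 0}" and ?R = "{e. r e \<noteq> 0}"
  let ?S = "(\<lambda>(i, j). i + j) ` (?P \<times> ?R)"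
  have fin: "finite ?P" "finite ?R" "finite ?S" using assms by (auto simp: lp_fin_def)
  have lp: "lpmul p r n = (\<Sum>i\<in>?P. p i * r (n - i))" for n
    unfolding lpmul_def using fin by (intro sum.mono_neutral_left) auto
  have sub: "{e. lpmul p r e \<noteq> 0} \<subseteq> ?S"
  proof
    fix e assume "e \<in> {e. lpmul p r e \<noteq> 0}"
    then have "(\<Sum>i\<in>?P. p i * r (e - i)) \<noteq> 0" by (simp add: lp)
    then obtain i where "p i * r (e - i) \<noteq> 0" by (rule sum.not_neutral_contains_not_neutral)
    then have "p i \<noteq> 0" "r (e - i) \<noteq> 0" by auto
    then show "e \<in> ?S" by (intro image_eqI[of _ _ "(i, e - i)"]) auto
  qed
  then show "lp_fin (lpmul p r)" using fin lp_fin_subset by blast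
  have inner: "(\<Sum>n\<in>?S. r (n - i) * z powi (n - i)) = ev z r" if "p i \<noteq> 0" for i
  proof -
    have "(\<Sum>n\<in>?S. r (n - i) * z powi (n - i)) = (\<Sum>j\<in>(\<lambda>n. n - i) ` ?S. r j * z powi j)"
      by (subst sum.reindex) (auto simp: inj_on_def)
    also have "\<dots> = ev z r"
    proof (rule ev_superset[symmetric])
      show "?R \<subseteq> (\<lambda>n. n - i) ` ?S" using that by (force simp: image_iff)
    qed (use fin in auto)
    finally show ?thesis .
  qed
  have "ev z (lpmul p r) = (\<Sum>n\<in>?S. \<Sum>i\<in>?P. p i * z powi i * (r (n - i) * z powi (n - i)))"
    unfolding ev_superset[OF fin(3) sub] lp sum_distrib_right using assms(3)
    by (intro sum.cong refl) (simp add: power_int_diff field_simps)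
  also have "\<dots> = (\<Sum>i\<in>?P. p i * z powi i * (\<Sum>n\<in>?S. r (n - i) * z powi (n - i)))"
    by (subst sum.swap) (simp add: sum_distrib_left)
  also have "\<dots> = ev z p * ev z r" by (simp add: inner ev_def sum_distrib_right)
  finally show "ev z (lpmul p r) = ev z p * ev z r" .
qed

definition evm :: "'a::field \<Rightarrow> 'a lp mat \<Rightarrow> 'a mat" where "evm z M = (\<lambda>a b. ev z (M a b))"
definition finm :: "'a::field lp mat \<Rightarrow> bool" where "finm M \<longleftrightarrow> (\<forall>a b. lp_fin (M a b))"

lemma evm_lmmul:
  assumes "finm A" "finm B" "z \<noteq> 0"
  shows "evm z (lmmul n A B) = (\<lambda>a b. \<Sum>c<n. evm z A a c * evm z B c b)"
  using assms by (simp add: evm_def lmmul_def finm_def ev_sum ev_lpmul)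

lemma finm_lmmul: "finm A \<Longrightarrow> finm B \<Longrightarrow> finm (lmmul n A B)"
  unfolding finm_def lmmul_def by (intro allI ev_sum(2) ev_lpmul(2)[of _ _ 1]) auto

lemma evm_lscale: "c \<noteq> 0 \<Longrightarrow> evm z (lscale c A) = evm (c * z) A"
  by (auto simp: evm_def lscale_def ev_def fun_eq_iff power_int_mult_distrib mult_ac)

lemma finm_lscale: "finm A \<Longrightarrow> finm (lscale c A)"
  unfolding finm_def lscale_def lp_fin_def
  by (intro allI) (rule finite_subset[of _ "{e. A _ _ e \<noteq> 0}"], auto)

lemma evm_constm: "evm z (constm M) = M"
proof (intro ext)
  fix a b show "evm z (constm M) a b = M a b"
    unfolding evm_def by (subst ev_superset[of "{0}"]) (auto simp: constm_def)
qed

lemma finm_constm: "finm (constm M)"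
  unfolding finm_def constm_def by (intro allI lp_fin_subset[of "{0}"]) auto

lemma evm_leg: "evm z (leg12 n M) = leg12 n (evm z M)" "evm z (leg13 n m M) = leg13 n m (evm z M)"
   "evm z (leg23 n m M) = leg23 n m (evm z M)"
  by (auto simp: evm_def leg12_def leg13_def leg23_def fun_eq_iff)

lemma finm_leg: "finm M \<Longrightarrow> finm (leg12 n M)" "finm M \<Longrightarrow> finm (leg13 n m M)" "finm M \<Longrightarrow> finm (leg23 n m M)"
  by (auto simp: finm_def leg12_def leg13_def leg23_def)

lemma ev_lp_ct: "c \<noteq> 0 \<Longrightarrow> z \<noteq> 0 \<Longrightarrow> ev z (lp_ct c) = cc (c * z)"
  by (subst ev_superset[of "{1, -1}"]) (auto simp: lp_ct_def cc_def power_int_minus)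

lemma ev_lp_const: "ev z (lp_const c) = c"
  by (subst ev_superset[of "{0}"]) (auto simp: lp_const_def)

lemma finm_R11: "finm (R11 q)"
proof -
  have "lp_fin (lp_ct c)" for c :: 'a by (rule lp_fin_subset[of "{1, -1}"]) (auto simp: lp_ct_def)
  moreover have "lp_fin (lp_const c)" for c :: 'a by (rule lp_fin_subset[of "{0}"]) (auto simp: lp_const_def)
  ultimately show ?thesis by (auto simp: finm_def R11_def)
qed

lemma finm_Rhalf: "finm (Rhalf q qh r d)"
proof (induction d rule: less_induct)
  case (less d)
  consider "d = 0" | "d = Suc 0" | d' where "d = Suc (Suc d')" by (metis not0_implies_Suc)
  then show ?case
  proof cases
    case 1 then show ?thesis by (simp add: finm_def lp_fin_def)
  next
    case 2 then show ?thesis by (simp add: finm_R11)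
  next
    case 3
    then have "finm (Rhalf q qh r (Suc d'))" using less by auto
    then show ?thesis unfolding 3 Rhalf.simps
      by (intro finm_lmmul finm_leg finm_lscale finm_constm finm_R11)
  qed
qed

lemma finm_Rfull: "finm (Rfull q qh r d d2)"
proof (induction d rule: less_induct)
  case (less d)
  consider "d = 0" | "d = Suc 0" | d' where "d = Suc (Suc d')" by (metis not0_implies_Suc)
  then show ?case
  proof cases
    case 1 then show ?thesis by (simp add: finm_def lp_fin_def)
  next
    case 2 then show ?thesis by (simp add: finm_Rhalf)
  next
    case 3
    then have "finm (Rfull q qh r (Suc d') d2)" using less by auto
    then show ?thesis unfolding 3 Rfull.simps
      by (intro finm_lmmul finm_leg finm_lscale finm_constm finm_Rhalf)
  qed
qed

section \<open>Matrices on tensor legs acting on vectors\<close>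

definition mv :: "nat \<Rightarrow> 'a::comm_ring mat \<Rightarrow> (nat \<Rightarrow> 'a) \<Rightarrow> nat \<Rightarrow> 'a" where
  "mv n A v a = (\<Sum>c<n. A a c * v c)"

lemma mv_mult: "mv m (\<lambda>a b. \<Sum>c<n. A a c * B c b) v = mv n A (mv m B v)"
  unfolding mv_def sum_distrib_left sum_distrib_right
  by (rule ext, subst sum.swap) (simp add: mult_ac)

lemma sum_lessThan_add: "(\<Sum>c<m + n. g c) = (\<Sum>c<m. g c) + (\<Sum>k<(n::nat). g (m + k))"
  by (induction n) (simp_all add: add.assoc)

lemma sum_lessThan_mult: "(\<Sum>c<N * n. g c) = (\<Sum>i<N. \<Sum>k<(n::nat). g (i * n + k))"
proof (induction N)
  case (Suc N)
  have "(\<Sum>c<Suc N * n. g c) = (\<Sum>c<N * n + n. g c)" by (simp add: add.commute)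
  also have "\<dots> = (\<Sum>c<N * n. g c) + (\<Sum>k<n. g (N * n + k))"
    by (rule sum_lessThan_add)
  finally show ?case using Suc by simp
qed simp

lemma mv_leg12:
  assumes "k < n"
  shows "mv (N * n) (leg12 n M) v (i * n + k) = (\<Sum>j<N. M i j * v (j * n + k))"
  unfolding mv_def sum_lessThan_mult
proof (rule sum.cong[OF refl])
  fix j
  have "(\<Sum>l<n. leg12 n M (i * n + k) (j * n + l) * v (j * n + l)) = (\<Sum>l<n. if l = k then M i j * v (j * n + k) else 0)"
    using assms by (intro sum.cong) (auto simp: leg12_def)
  then show "(\<Sum>l<n. leg12 n M (i * n + k) (j * n + l) * v (j * n + l)) = M i j * v (j * n + k)" using assms by simp
qed

lemma mv_leg23:
  assumes "k < p" "i < N"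
  shows "mv (N * m) (leg23 p m M) v (i * p + k) = (\<Sum>l<m. M k l * v (i * m + l))"
proof -
  have "mv (N * m) (leg23 p m M) v (i * p + k) = (\<Sum>j<N. if j = i then (\<Sum>l<m. M k l * v (i * m + l)) else 0)"
    unfolding mv_def sum_lessThan_mult
    using assms by (intro sum.cong refl) (auto simp: leg23_def intro!: sum.cong sum.neutral)
  then show ?thesis using assms by simp
qed

lemma mv_leg13:
  assumes "j < n2" "k < n3"
  shows "mv (n1 * n2 * n3) (leg13 n2 n3 M) v ((i * n2 + j) * n3 + k)
     = (\<Sum>i'<n1. \<Sum>k'<n3. M (i * n3 + k) (i' * n3 + k') * v ((i' * n2 + j) * n3 + k'))"
proof -
  have D: "((i * n2 + j) * n3 + k) div (n2 * n3) = i" "(((i * n2 + j) * n3 + k) div n3) mod n2 = j"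
    if "j < n2" "k < n3" for i j k
    using that by (simp_all add: div_mult2_eq mult.commute[of n2])
  have "mv (n1 * n2 * n3) (leg13 n2 n3 M) v ((i * n2 + j) * n3 + k)
     = (\<Sum>i'<n1. \<Sum>j'<n2. if j' = j then (\<Sum>k'<n3. M (i * n3 + k) (i' * n3 + k') * v ((i' * n2 + j) * n3 + k')) else 0)"
    unfolding mv_def sum_lessThan_mult
    using assms by (intro sum.cong refl) (auto simp: leg13_def D intro!: sum.cong sum.neutral)
  then show ?thesis using assms by simp
qed

context qparam begin

text \<open>These are the denominators in \<open>Fmat\<close>. Up to a unit [m] + [n] is (q^(m+n) -
  1)(q^m + q^n); if the second factor vanishes and m differs from n, then q^(m-n) = -1 squares to
  1.\<close>

lemma qint_sum_nz:
  assumes "m + n > 0"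
  shows "qint q (int m) + qint q (int n) \<noteq> 0"
proof (cases "m = n")
  case True
  then show ?thesis using assms qint_nz[of m] by (simp add: mult_2[symmetric])
next
  case False
  have nr: "q powi k \<noteq> 1" if "k \<noteq> 0" for k :: int
  proof
    assume "q powi k = 1"
    then have "q powi \<bar>k\<bar> = 1" by (cases "k \<ge> 0") (auto simp: power_int_minus)
    then have "q ^ nat \<bar>k\<bar> = 1" by (simp add: power_int_def)
    then show False using q_not_root[of "nat \<bar>k\<bar>"] that by simp
  qed
  show ?thesis
  proof
    assume "qint q (int m) + qint q (int n) = 0"
    then have 1: "q ^ m - inverse (q ^ m) + (q ^ n - inverse (q ^ n)) = 0"
      using q_inv_nz by (simp add: qint_def power_int_minus add_divide_distrib[symmetric])
    have "(q ^ (m + n) - 1) * (q ^ m + q ^ n) = q ^ m * q ^ n * (q ^ m - inverse (q ^ m) + (q ^ n - inverse (q ^ n)))"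
      using q_nz by (simp add: power_add algebra_simps)
    then have "q ^ (m + n) = 1 \<or> q ^ m = - (q ^ n)" unfolding 1 by (simp add: eq_neg_iff_add_eq_0)
    then have "q ^ m = - (q ^ n)" using q_not_root[of "m + n"] assms by blast
    then have "q powi (int m - int n) = - 1" using q_nz by (simp add: power_int_diff)
    then have "q powi ((int m - int n) + (int m - int n)) = 1"
      using q_nz by (subst power_int_add) auto
    then show False using nr[of "(int m - int n) + (int m - int n)"] False by simp
  qed
qed

lemma gauge_Suc: "k \<le> d \<Longrightarrow> gauge (Suc d) k = r (Suc d - k) * gauge d k"
  "k \<le> d \<Longrightarrow> gauge (Suc d) (Suc k) = r (Suc k) * gauge d k"
  by (simp_all add: gauge_def Suc_diff_le rfact_Suc mult_ac)

text \<open>The numerators in \<open>Emat\<close> are the quotients of consecutive gauges in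
  \<open>gauge_Suc\<close>, so after gauging only the pullback along \<open>p + k\<close> is
  left.\<close>

lemma Emat_apply:
  assumes "p \<le> 1" "k \<le> d"
  shows "(\<Sum>m<Suc (Suc d). Emat q r d (p * Suc d + k) m * v m) = gauge (Suc d) (p + k) * v (p + k) / (gauge d k * r (Suc d))"
proof -
  have "Emat q r d (p * Suc d + k) m * v m = (if m = p + k then gauge (Suc d) (p + k) * v (p + k) / (gauge d k * r (Suc d)) else 0)" for m
  proof -
    consider "p = 0" | "p = 1" using assms by linarith
    then show ?thesis
      by cases (use assms in \<open>simp_all add: Emat_def gauge_Suc Suc_diff_le\<close>)
  qed
  then show ?thesis using assms by simp
qed

text \<open>On a vector that is symmetric in the gauge, the two entries of row \<open>m\<close>
  return the common value with weights [d + 1 - m] and [m] divided by their sum \<open>D\<close>;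
  these add up to 1.\<close>

lemma Fmat_apply:
  assumes u: "\<And>p k. p \<le> 1 \<Longrightarrow> k \<le> d \<Longrightarrow> u (p * Suc d + k) = Z (p + k) / (gauge d k * r (Suc d))"
    and m: "m \<le> Suc d"
  shows "(\<Sum>c<2 * Suc d. Fmat q r d m c * u c) = Z m / gauge (Suc d) m"
proof -
  have r: "r (Suc d) \<noteq> 0" using r_nz by simp
  define D where "D = qint q (int (Suc d - m)) + qint q (int m)"
  have D: "D \<noteq> 0" unfolding D_def using m by (intro qint_sum_nz) simp
  have "(\<Sum>c<2 * Suc d. Fmat q r d m c * u c) = (\<Sum>p<2. \<Sum>k<Suc d. Fmat q r d m (p * Suc d + k) * u (p * Suc d + k))"
    by (rule sum_lessThan_mult)
  also have "\<dots> = (\<Sum>k<Suc d. Fmat q r d m k * u k) + (\<Sum>k<Suc d. Fmat q r d m (Suc d + k) * u (Suc d + k))"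
    by (simp add: numeral_2_eq_2 del: sum.lessThan_Suc) (simp add: sum.lessThan_Suc)
  also have "(\<Sum>k<Suc d. Fmat q r d m k * u k) = (\<Sum>k<Suc d. if k = m then qint q (int (Suc d - m)) * Z m / (D * gauge (Suc d) m) else 0)"
  proof (intro sum.cong refl)
    fix k assume "k \<in> {..<Suc d}"
    then have k: "k \<le> d" by simp
    show "Fmat q r d m k * u k = (if k = m then qint q (int (Suc d - m)) * Z m / (D * gauge (Suc d) m) else 0)"
    proof (cases "k = m")
      case True
      have "Fmat q r d m m = r (Suc d - m) * r (Suc d) / D" using k True by (simp add: Fmat_def D_def)
      then show ?thesis using u[of 0 m] k True r r_nz[of "Suc d - m"]
        by (simp add: gauge_Suc(1) r_sqrt[symmetric] del: of_nat_Suc of_nat_diff)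
    qed (use k in \<open>auto simp: Fmat_def\<close>)
  qed
  also have "\<dots> = qint q (int (Suc d - m)) * Z m / (D * gauge (Suc d) m)"
    using m by (cases "m = Suc d") auto
  also have "(\<Sum>k<Suc d. Fmat q r d m (Suc d + k) * u (Suc d + k)) = (\<Sum>k<Suc d. if Suc k = m then qint q (int m) * Z m / (D * gauge (Suc d) m) else 0)"
  proof (intro sum.cong refl)
    fix k assume "k \<in> {..<Suc d}"
    then have k: "k \<le> d" by simp
    show "Fmat q r d m (Suc d + k) * u (Suc d + k) = (if Suc k = m then qint q (int m) * Z m / (D * gauge (Suc d) m) else 0)"
    proof (cases "Suc k = m")
      case True
      have "Fmat q r d m (Suc d + k) = r m * r (Suc d) / D" using k m True by (auto simp: Fmat_def D_def)
      then show ?thesis using u[of 1 k] k True[symmetric] r r_nz[of m]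
        by (simp add: gauge_Suc(2) r_sqrt[symmetric] del: of_nat_Suc of_nat_diff)
    qed (use k in \<open>auto simp: Fmat_def\<close>)
  qed
  also have "\<dots> = qint q (int m) * Z m / (D * gauge (Suc d) m)"
    using m by (cases m) auto
  finally show ?thesis using D unfolding D_def by (simp add: add_divide_distrib[symmetric] distrib_right[symmetric])
qed

lemma R11_apply:
  assumes "z \<noteq> 0" "p \<le> 1" "k \<le> 1"
  shows "(\<Sum>j<4. evm z (R11 q) (p * 2 + k) j * v j) = Lop 1 z (\<lambda>p k. v (p * 2 + k)) p k"
proof -
  have "(p = 0 \<or> p = 1) \<and> (k = 0 \<or> k = 1)" using assms by auto
  moreover have "qh powi 2 = q" using qh_sq by (simp add: power2_eq_square)
  ultimately show ?thesis using assms(1) q_nz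
    by (auto simp: evm_def R11_def ev_lp_ct ev_lp_const Lop_def numeral_eq_Suc) (simp_all add: cc_def)
qed

text \<open>The vectors \<open>v1\<close>, \<open>v2\<close>, \<open>w\<close> arise by applying the
  factors of the recursion from right to left. \<open>Lop_fusion\<close> shows that \<open>w\<close>
  depends on \<open>p2 + k\<close> only, up to the gauge, which is what \<open>Fmat_apply\<close>
  needs.\<close>

lemma Rhalf_apply:
  assumes "d \<ge> 1" "z \<noteq> 0" "p \<le> 1" "k \<le> d"
  shows "mv (2 * Suc d) (evm z (Rhalf q qh r d)) v (p * Suc d + k)
     = Rfactor d z * Lop d z (\<lambda>p k. gauge d k * v (p * Suc d + k)) p k / gauge d k"
  using assms
proof (induction d arbitrary: z p k v rule: nat_induct_at_least)
  case base
  have g: "gauge (Suc 0) k = r (Suc 0)" if "k \<le> 1" for k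
    using that by (cases k) (auto simp: gauge_def rfact_def)
  have "Lop 1 z (\<lambda>p k. gauge 1 k * v (p * 2 + k)) p k = Lop 1 z (\<lambda>p k. r 1 * v (p * 2 + k) + 0 * v 0) p k"
    using base by (intro Lop_cong) (auto simp: g)
  then show ?case using R11_apply[of z p k v] base r_nz[of 1] unfolding Lop_linear
    by (simp add: mv_def g mult_2_right)
next
  case (Suc d)
  define w where "w = mv (4 * Suc d) (leg13 2 (Suc d) (evm (inverse qh * z) (Rhalf q qh r d)))
      (mv (4 * Suc d) (leg12 (Suc d) (evm (qh ^ d * z) (R11 q)))
      (mv (2 * Suc (Suc d)) (leg23 (2 * Suc d) (Suc (Suc d)) (Emat q r d)) v))"
  obtain d' where d': "d = Suc d'" using Suc.hyps by (cases d) auto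
  have z: "inverse qh * z \<noteq> 0" "qh ^ d * z \<noteq> 0" using Suc.prems by auto
  have start: "mv (2 * Suc (Suc d)) (evm z (Rhalf q qh r (Suc d))) v =
      mv (4 * Suc d) (leg23 (Suc (Suc d)) (2 * Suc d) (Fmat q r d)) w"
    unfolding w_def d' Rhalf.simps using Suc.prems
    by (simp only: evm_lmmul finm_lmmul finm_leg finm_lscale finm_constm finm_R11 finm_Rhalf mv_mult
       evm_leg evm_lscale evm_constm qh_nz nonzero_imp_inverse_nonzero power_not_zero not_False_eq_True Suc_eq_plus1[symmetric]
       add_2_eq_Suc' simp_thms)
  define G where "G p m = gauge (Suc d) m * v (p * Suc (Suc d) + m)" for p m
  define v1 where "v1 = mv (2 * Suc (Suc d)) (leg23 (2 * Suc d) (Suc (Suc d)) (Emat q r d)) v"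
  have v1: "v1 ((p * 2 + p2) * Suc d + k) = G p (p2 + k) / (gauge d k * r (Suc d))" if "p \<le> 1" "p2 \<le> 1" "k \<le> d" for p p2 k
  proof -
    have "p2 * Suc d + k < 2 * Suc d" using that by (cases p2) auto
    moreover have "(p * 2 + p2) * Suc d + k = p * (2 * Suc d) + (p2 * Suc d + k)" by (simp add: algebra_simps)
    ultimately show ?thesis unfolding v1_def G_def using that Emat_apply[of p2 k d "\<lambda>m. v (p * Suc (Suc d) + m)"]
      by (simp only: mv_leg23)
  qed
  define v2 where "v2 = mv (4 * Suc d) (leg12 (Suc d) (evm (qh ^ d * z) (R11 q))) v1"
  have v2: "v2 ((p * 2 + p2) * Suc d + k) = Lop 1 (qh ^ d * z) (\<lambda>p p2. G p (p2 + k)) p p2 / (gauge d k * r (Suc d))"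
    if "p \<le> 1" "p2 \<le> 1" "k \<le> d" for p p2 k
  proof -
    have "v2 ((p * 2 + p2) * Suc d + k) = Lop 1 (qh ^ d * z) (\<lambda>p p2. v1 ((p * 2 + p2) * Suc d + k)) p p2"
      unfolding v2_def using that z R11_apply[of "qh ^ d * z" p p2 "\<lambda>c. v1 (c * Suc d + k)"]
      by (subst mv_leg12) auto
    also have "\<dots> = Lop 1 (qh ^ d * z) (\<lambda>p p2. (1 / (gauge d k * r (Suc d))) * G p (p2 + k) + 0 * 0) p p2"
      using that by (intro Lop_cong) (auto simp: v1 simp del: mult_Suc_right)
    finally show ?thesis unfolding Lop_linear by simp
  qed
  have w: "w ((p * 2 + p2) * Suc d + k) = Rfactor (Suc d) z * Lop (Suc d) z G p (p2 + k) / (gauge d k * r (Suc d))"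
    if "p \<le> 1" "p2 \<le> 1" "k \<le> d" for p p2 k
  proof -
    \<comment> \<open>The entries of \<open>v2\<close> on the legs 1 and 3 for fixed
      \<open>p2\<close>, as a vector for the smaller R-matrix.\<close>
    let ?v = "\<lambda>c. v2 (((c div Suc d) * 2 + p2) * Suc d + c mod Suc d)"
    have "w ((p * 2 + p2) * Suc d + k) = (\<Sum>i'<2. \<Sum>k'<Suc d. evm (inverse qh * z) (Rhalf q qh r d) (p * Suc d + k) (i' * Suc d + k') * v2 ((i' * 2 + p2) * Suc d + k'))"
      unfolding w_def v1_def[symmetric] v2_def[symmetric] using that mv_leg13[of p2 2 k "Suc d" 2] by simp
    also have "\<dots> = mv (2 * Suc d) (evm (inverse qh * z) (Rhalf q qh r d)) ?v (p * Suc d + k)"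
      unfolding mv_def sum_lessThan_mult by (intro sum.cong refl) (auto simp del: mult_Suc_right)
    also have "\<dots> = Rfactor d (inverse qh * z) * Lop d (inverse qh * z) (\<lambda>p k. gauge d k * ?v (p * Suc d + k)) p k / gauge d k"
      using Suc.IH[OF z(1), of p k ?v] that by simp
    also have "Lop d (inverse qh * z) (\<lambda>p k. gauge d k * ?v (p * Suc d + k)) p k
       = Lop d (inverse qh * z) (\<lambda>p k. (1 / r (Suc d)) * Lop 1 (qh ^ d * z) (\<lambda>p p2. G p (p2 + k)) p p2 + 0 * 0) p k"
      using that by (intro Lop_cong) (auto simp: v2 simp del: mult_Suc_right)
    also have "\<dots> = 1 / r (Suc d) * (cc (qh ^ d * z) * Lop (Suc d) z G p (p2 + k))"
      unfolding Lop_linear using Lop_fusion[of z p p2 d G k] Suc.prems that by simp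
    also have "Rfactor d (inverse qh * z) * (1 / r (Suc d) * (cc (qh ^ d * z) * Lop (Suc d) z G p (p2 + k))) / gauge d k
       = Rfactor (Suc d) z * Lop (Suc d) z G p (p2 + k) / (gauge d k * r (Suc d))"
      by (simp add: d' mult_ac)
    finally show ?thesis .
  qed
  have "mv (4 * Suc d) (leg23 (Suc (Suc d)) (2 * Suc d) (Fmat q r d)) w (p * Suc (Suc d) + k)
     = (\<Sum>c<2 * Suc d. Fmat q r d k c * w (p * (2 * Suc d) + c))"
  proof -
    have "4 * Suc d = 2 * (2 * Suc d)" by simp
    then show ?thesis using Suc.prems by (simp only:) (intro mv_leg23, auto)
  qed
  also have "\<dots> = Rfactor (Suc d) z * Lop (Suc d) z G p k / gauge (Suc d) k"
  proof (rule Fmat_apply)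
    fix p2 k' :: nat assume "p2 \<le> 1" "k' \<le> d"
    then show "w (p * (2 * Suc d) + (p2 * Suc d + k')) = Rfactor (Suc d) z * Lop (Suc d) z G p (p2 + k') / (gauge d k' * r (Suc d))"
      using w[of p p2 k'] Suc.prems by (simp add: algebra_simps)
  qed (use Suc.prems in auto)
  finally show ?case unfolding start G_def .
qed

text \<open>The recursion is followed as in \<open>Rhalf_apply\<close>, now with fusion in the first
  factor. The symmetry of \<open>w\<close> comes from \<open>fuse_Rop\<close>.\<close>

lemma Rfull_apply:
  assumes "d \<ge> 1" "d2 \<ge> 1" "z \<noteq> 0" "i \<le> d" "k \<le> d2"
  shows "mv (Suc d * Suc d2) (evm z (Rfull q qh r d d2)) v (i * Suc d2 + k)
     = Rop d d2 z (\<lambda>i k. gauge d i * gauge d2 k * v (i * Suc d2 + k)) i k / (gauge d i * gauge d2 k)"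
  using assms
proof (induction d arbitrary: z i k v rule: nat_induct_at_least)
  case base
  have g: "gauge (Suc 0) k = r (Suc 0)" if "k \<le> 1" for k
    using that by (cases k) (auto simp: gauge_def rfact_def)
  have r: "r (Suc 0) \<noteq> 0" using r_nz by simp
  let ?f = "\<lambda>i k. gauge 1 i * gauge d2 k * v (i * Suc d2 + k)"
  have "Rop (Suc 0) d2 z ?f i k = fuse 0 d2 z ?f i 0 k"
    using fuse_Rop[of i 0 0 k d2 z ?f] base by simp
  also have "\<dots> = Rfactor d2 z * Lop d2 z (\<lambda>p k. r (Suc 0) * (gauge d2 k * v (p * Suc d2 + k)) + 0 * 0) i k"
    unfolding fuse_def using base by (simp del: mult_Suc_right, intro disjI2 Lop_cong) (auto simp: g)
  also have "\<dots> = r (Suc 0) * (Rfactor d2 z * Lop d2 z (\<lambda>p k. gauge d2 k * v (p * Suc d2 + k)) i k)"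
    unfolding Lop_linear by simp
  finally show ?case using Rhalf_apply[of d2 z i k v] base r
    by (simp add: g numeral_2_eq_2[symmetric] del: mult_Suc_right mult_Suc)
next
  case (Suc d)
  let ?n = "Suc d2"
  define w where "w = mv (2 * Suc d * ?n) (leg13 (Suc d) ?n (evm (qh powi (- int d) * z) (Rhalf q qh r d2)))
      (mv (2 * Suc d * ?n) (leg23 (Suc d * ?n) (Suc d * ?n) (evm (qh * z) (Rfull q qh r d d2)))
      (mv (Suc (Suc d) * ?n) (leg12 ?n (Emat q r d)) v))"
  obtain d' where d': "d = Suc d'" using Suc.hyps by (cases d) auto
  have z: "qh * z \<noteq> 0" "qh powi (- int d) * z \<noteq> 0" using Suc.prems by auto
  have start: "mv (Suc (Suc d) * ?n) (evm z (Rfull q qh r (Suc d) d2)) v =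
      mv (2 * Suc d * ?n) (leg12 ?n (Fmat q r d)) w"
    unfolding w_def d' Rfull.simps using Suc.prems
    by (simp only: evm_lmmul finm_lmmul finm_leg finm_lscale finm_constm finm_Rfull finm_Rhalf mv_mult
       evm_leg evm_lscale evm_constm qh_nz power_int_not_zero not_False_eq_True Suc_eq_plus1[symmetric]
       simp_thms)
  define G where "G m k = gauge (Suc d) m * gauge d2 k * v (m * ?n + k)" for m k
  define v1 where "v1 = mv (Suc (Suc d) * ?n) (leg12 ?n (Emat q r d)) v"
  have v1: "v1 ((p * Suc d + i) * ?n + k) = G (p + i) k / (gauge d i * gauge d2 k * r (Suc d))" if "p \<le> 1" "i \<le> d" "k \<le> d2" for p i k
  proof -
    have "v1 ((p * Suc d + i) * ?n + k) = (\<Sum>m<Suc (Suc d). Emat q r d (p * Suc d + i) m * v (m * ?n + k))"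
      unfolding v1_def using that by (intro mv_leg12) auto
    also have "\<dots> = gauge (Suc d) (p + i) * v ((p + i) * ?n + k) / (gauge d i * r (Suc d))"
      using that by (rule_tac Emat_apply) auto
    finally show ?thesis by (simp add: G_def)
  qed
  define v2 where "v2 = mv (2 * Suc d * ?n) (leg23 (Suc d * ?n) (Suc d * ?n) (evm (qh * z) (Rfull q qh r d d2))) v1"
  have v2: "v2 ((p * Suc d + i) * ?n + k) = Rop d d2 (qh * z) (\<lambda>i k. G (p + i) k) i k / (gauge d i * gauge d2 k * r (Suc d))"
    if "p \<le> 1" "i \<le> d" "k \<le> d2" for p i k
  proof -
    have "i * ?n + k < Suc i * ?n" using that by simp
    also have "\<dots> \<le> Suc d * ?n" using that by (intro mult_le_mono) auto
    finally have lt: "i * ?n + k < Suc d * ?n" .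
    have idx: "(p * Suc d + i) * ?n + k = p * (Suc d * ?n) + (i * ?n + k)" for i k by (simp add: algebra_simps)
    have "v2 ((p * Suc d + i) * ?n + k) = mv (Suc d * ?n) (evm (qh * z) (Rfull q qh r d d2)) (\<lambda>c. v1 (p * (Suc d * ?n) + c)) (i * ?n + k)"
      unfolding v2_def idx mult.assoc[of 2] using lt that by (subst mv_leg23) (auto simp: mv_def)
    also have "\<dots> = Rop d d2 (qh * z) (\<lambda>i k. gauge d i * gauge d2 k * v1 (p * (Suc d * ?n) + (i * ?n + k))) i k / (gauge d i * gauge d2 k)"
      using Suc.IH[of "qh * z" i k] Suc.prems z that by simp
    also have "Rop d d2 (qh * z) (\<lambda>i k. gauge d i * gauge d2 k * v1 (p * (Suc d * ?n) + (i * ?n + k))) i k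
       = Rop d d2 (qh * z) (\<lambda>i k. (1 / r (Suc d)) * G (p + i) k + 0 * 0) i k"
      using that by (intro Rop_cong) (auto simp: v1 idx[symmetric] simp del: mult_Suc_right mult_Suc)
    finally show ?thesis unfolding Rop_linear by simp
  qed
  have w: "w ((p * Suc d + i) * ?n + k) = Rop (Suc d) d2 z G (p + i) k / gauge d2 k / (gauge d i * r (Suc d))"
    if "p \<le> 1" "i \<le> d" "k \<le> d2" for p i k
  proof -
    let ?z = "qh powi (- int d) * z"
    let ?v = "\<lambda>c. v2 (((c div ?n) * Suc d + i) * ?n + c mod ?n)"
    have "w ((p * Suc d + i) * ?n + k) = (\<Sum>p'<2. \<Sum>k'<?n. evm ?z (Rhalf q qh r d2) (p * ?n + k) (p' * ?n + k') * v2 ((p' * Suc d + i) * ?n + k'))"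
      unfolding w_def v1_def[symmetric] v2_def[symmetric] using that by (intro mv_leg13) auto
    also have "\<dots> = mv (2 * ?n) (evm ?z (Rhalf q qh r d2)) ?v (p * ?n + k)"
      unfolding mv_def sum_lessThan_mult by (intro sum.cong refl) (auto simp del: mult_Suc_right)
    also have "\<dots> = Rfactor d2 ?z * Lop d2 ?z (\<lambda>p k. gauge d2 k * ?v (p * ?n + k)) p k / gauge d2 k"
      using Rhalf_apply[of d2 ?z p k ?v] z Suc.prems that by simp
    also have "Lop d2 ?z (\<lambda>p k. gauge d2 k * ?v (p * ?n + k)) p k
       = Lop d2 ?z (\<lambda>p k. (1 / (gauge d i * r (Suc d))) * Rop d d2 (qh * z) (\<lambda>i k. G (p + i) k) i k + 0 * 0) p k"
      using that by (intro Lop_cong) (auto simp: v2 simp del: mult_Suc_right)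
    also have "\<dots> = 1 / (gauge d i * r (Suc d)) * Lop d2 ?z (\<lambda>p k. Rop d d2 (qh * z) (\<lambda>i k. G (p + i) k) i k) p k"
      unfolding Lop_linear by simp
    also have "Rfactor d2 ?z * (1 / (gauge d i * r (Suc d)) * Lop d2 ?z (\<lambda>p k. Rop d d2 (qh * z) (\<lambda>i k. G (p + i) k) i k) p k) / gauge d2 k
       = fuse d d2 z G p i k / gauge d2 k / (gauge d i * r (Suc d))"
      by (simp add: fuse_def)
    also have "fuse d d2 z G p i k = Rop (Suc d) d2 z G (p + i) k" using that Suc.prems by (intro fuse_Rop) auto
    finally show ?thesis .
  qed
  have "mv (2 * Suc d * ?n) (leg12 ?n (Fmat q r d)) w (i * ?n + k)
     = (\<Sum>c<2 * Suc d. Fmat q r d i c * w (c * ?n + k))"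
    using Suc.prems by (intro mv_leg12) auto
  also have "\<dots> = Rop (Suc d) d2 z G i k / gauge d2 k / gauge (Suc d) i"
    by (rule Fmat_apply) (use w Suc.prems in auto)
  finally show ?case unfolding start G_def by (simp add: mult.commute)
qed

end

section \<open>Evaluation of series\<close>

text \<open>Multiplication by a power of z gives a polynomial that vanishes at every nonzero element
  of an infinite field.\<close>

lemma ev_eq_0_imp:
  fixes p :: "'a::field_char_0 lp"
  assumes fin: "lp_fin p" and zero: "\<And>z. z \<noteq> 0 \<Longrightarrow> ev z p = 0"
  shows "p = 0"
proof -
  let ?S = "{e. p e \<noteq> 0}"
  have S: "finite ?S" using fin by (simp add: lp_fin_def)
  obtain N :: nat where N: "\<And>e. p e \<noteq> 0 \<Longrightarrow> - int N \<le> e"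
  proof -
    have "\<exists>m. \<forall>e\<in>?S. m \<le> e" using S by (meson Min_le)
    then obtain m where "\<And>e. p e \<noteq> 0 \<Longrightarrow> m \<le> e" by auto
    then show ?thesis by (intro that[of "nat \<bar>m\<bar>"]) force
  qed
  define P where "P = (\<Sum>e\<in>?S. monom (p e) (nat (e + int N)))"
  have "poly P z = 0" if "z \<noteq> 0" for z
  proof -
    have "poly P z = (\<Sum>e\<in>?S. z ^ N * (p e * z powi e))"
      unfolding P_def poly_sum poly_monom
    proof (intro sum.cong refl)
      fix e assume "e \<in> ?S"
      then have "0 \<le> e + int N" using N[of e] by simp
      then have "z ^ nat (e + int N) = z powi (e + int N)" by (simp add: power_int_def)
      then show "p e * z ^ nat (e + int N) = z ^ N * (p e * z powi e)" using that by (simp add: power_int_add)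
    qed
    also have "\<dots> = z ^ N * ev z p" by (simp add: ev_def sum_distrib_left)
    finally show ?thesis using zero[OF that] by simp
  qed
  then have "UNIV - {0} \<subseteq> {z. poly P z = 0}" by auto
  moreover have "infinite (UNIV - {0 :: 'a})" by (simp add: infinite_UNIV_char_0)
  ultimately have P0: "P = 0" using poly_roots_finite finite_subset by blast
  have "p e = 0" for e
  proof (rule ccontr)
    assume e: "p e \<noteq> 0"
    have "coeff P (nat (e + int N)) = (\<Sum>e'\<in>?S. if e' = e then p e else 0)"
      unfolding P_def coeff_sum
    proof (intro sum.cong refl)
      fix e' assume "e' \<in> ?S"
      then have "nat (e' + int N) = nat (e + int N) \<longleftrightarrow> e' = e" using N[of e'] N[OF e] by auto
      then show "coeff (monom (p e') (nat (e' + int N))) (nat (e + int N)) = (if e' = e then p e else 0)" by simp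
    qed
    also have "\<dots> = p e" using S e by simp
    finally show False using P0 e by simp
  qed
  then show ?thesis by (auto simp: fun_eq_iff)
qed

lemma ev_inject:
  fixes p p' :: "'a::field_char_0 lp"
  assumes "lp_fin p" "lp_fin p'" "\<And>z. z \<noteq> 0 \<Longrightarrow> ev z p = ev z p'"
  shows "p = p'"
proof -
  let ?S = "{e. p e \<noteq> 0} \<union> {e. p' e \<noteq> 0}"
  have S: "finite ?S" using assms by (simp add: lp_fin_def)
  have sub: "{e. (p - p') e \<noteq> 0} \<subseteq> ?S" by auto
  have "ev z (p - p') = ev z p - ev z p'" for z
    unfolding ev_superset[OF S sub] using ev_superset[OF S, of p] ev_superset[OF S, of p']
    by (simp add: left_diff_distrib sum_subtractf)
  then have "p - p' = 0" using ev_eq_0_imp[of "p - p'"] lp_fin_subset[OF S sub] assms(3) by simp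
  then show ?thesis by simp
qed

lemma ev_scale: "ev z (\<lambda>e. c * p e) = c * ev z p"
proof (cases "c = 0")
  case True then show ?thesis by (simp add: ev_def)
next
  case False then show ?thesis by (simp add: ev_def sum_distrib_left mult.assoc)
qed

lemma lp_fin_scale: "lp_fin p \<Longrightarrow> lp_fin (\<lambda>e. (c::'a::field) * p e)"
  unfolding lp_fin_def by (rule finite_subset[of _ "{e. p e \<noteq> 0}"]) auto

text \<open>
  In all series at hand the total degree in $s, t$ equals the length of the word, so nothing is lost
  by setting $s = 1$. The lower bound makes the index sets in \<open>smul\<close> finite; over infinite
  index sets the sum would be 0.
\<close>

definition homog :: "'a::zero ser \<Rightarrow> bool" where
  "homog A \<longleftrightarrow> (\<exists>N. \<forall>i k w. A i k w \<noteq> 0 \<longrightarrow> i + k = int (length w) \<and> N \<le> i \<and> N \<le> k)"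

definition coef :: "'a::zero ser \<Rightarrow> letter list \<Rightarrow> 'a lp" where
  "coef A w = (\<lambda>k. A (int (length w) - k) k w)"

definition evs :: "'a::field \<Rightarrow> 'a ser \<Rightarrow> 'a vec" where
  "evs z A w = ev z (coef A w)"

lemma lp_fin_coef:
  assumes "homog A" shows "lp_fin (coef A w)"
proof -
  obtain N where N: "\<And>i k w. A i k w \<noteq> 0 \<Longrightarrow> i + k = int (length w) \<and> N \<le> i \<and> N \<le> k"
    using assms by (auto simp: homog_def)
  show ?thesis
    by (rule lp_fin_subset[of "{N..int (length w) - N}"]) (auto simp: coef_def dest!: N)
qed

lemma homog_eqI:
  fixes A B :: "'a::field_char_0 ser"
  assumes "homog A" "homog B" "\<And>z w. z \<noteq> 0 \<Longrightarrow> evs z A w = evs z B w"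
  shows "A = B"
proof (intro ext)
  fix i k w
  have c: "coef A w = coef B w"
    using assms by (intro ev_inject lp_fin_coef) (auto simp: evs_def)
  show "A i k w = B i k w"
  proof (cases "i + k = int (length w)")
    case True
    then have "i = int (length w) - k" by simp
    then show ?thesis using fun_cong[OF c, of k] by (simp add: coef_def)
  next
    case False
    then have "A i k w = 0" "B i k w = 0" using assms(1,2) unfolding homog_def by blast+
    then show ?thesis by simp
  qed
qed

text \<open>Evaluation collects the coefficients of all words in one vector, whose support may be
  infinite; there \<open>vmul\<close> would be a sum over an infinite set, hence 0. Each single word
  still receives only finitely many contributions.\<close>

definition vprod :: "'a::field \<Rightarrow> 'a vec \<Rightarrow> 'a vec \<Rightarrow> 'a vec" where
  "vprod q f g w = (\<Sum>(u, v) \<in> word_pairs (length w). f u * g v * shuf q u v w)"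

lemma shuf_length: "shuf q u v w \<noteq> 0 \<Longrightarrow> length u + length v = length w"
proof (induction w arbitrary: u v)
  case Nil then show ?case by (cases u; cases v) (auto simp: single_def prepend_def split: if_splits)
next
  case (Cons a w)
  have "u \<noteq> [] \<and> shuf q (tl u) v w \<noteq> 0 \<or> v \<noteq> [] \<and> shuf q u (tl v) w \<noteq> 0"
    using Cons.prems unfolding shuf_Cons_word by (rule contrapos_np) auto
  then show ?case
  proof (elim disjE conjE)
    assume "u \<noteq> []" "shuf q (tl u) v w \<noteq> 0"
    then show ?thesis using Cons.IH[of "tl u" v] by (cases u) auto
  next
    assume "v \<noteq> []" "shuf q u (tl v) w \<noteq> 0"
    then show ?thesis using Cons.IH[of u "tl v"] by (cases v) auto
  qed
qed

lemma finite_words: "finite {w :: letter list. length w = n}"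
proof -
  have "set u \<subseteq> {X, Y}" for u using letter.exhaust by blast
  then show ?thesis using finite_lists_length_eq[of "{X, Y}" n] by simp
qed

lemma vmul_word_pairs:
  assumes "finite {u. f u \<noteq> 0}" "finite {v. g v \<noteq> 0}"
  shows "vmul q f g w = vprod q f g w"
proof -
  let ?T = "{p. f (fst p) \<noteq> 0 \<and> g (snd p) \<noteq> 0}"
  let ?h = "\<lambda>p. f (fst p) * g (snd p) * shuf q (fst p) (snd p) w"
  have "?T \<subseteq> {u. f u \<noteq> 0} \<times> {v. g v \<noteq> 0}" by auto
  then have T: "finite ?T" using assms finite_subset by blast
  have "vmul q f g w = sum ?h (?T \<inter> word_pairs (length w))"
    unfolding vmul_def using T
    by (intro sum.mono_neutral_right) (auto simp: word_pairs_def dest: shuf_length)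
  also have "\<dots> = sum ?h (word_pairs (length w))"
    by (rule sum.mono_neutral_left) auto
  finally show ?thesis by (simp add: vprod_def case_prod_beta)
qed

text \<open>The exponent of s is determined by the word and the exponent of t, so the convolution in
  two exponents reduces to a product of Laurent polynomials in t.\<close>

lemma smul_coef:
  assumes A: "homog A" and B: "homog B"
  shows "smul q A B m n w = (if m + n = int (length w) then
     (\<Sum>(u, v) \<in> word_pairs (length w). lpmul (coef A u) (coef B v) n * shuf q u v w) else 0)"
    and "homog (smul q A B)"
proof -
  obtain N where N: "\<And>i k w. A i k w \<noteq> 0 \<Longrightarrow> i + k = int (length w) \<and> N \<le> i \<and> N \<le> k"
    using A by (auto simp: homog_def)
  obtain M where M: "\<And>i k w. B i k w \<noteq> 0 \<Longrightarrow> i + k = int (length w) \<and> M \<le> i \<and> M \<le> k"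
    using B by (auto simp: homog_def)
  let ?I = "\<lambda>m n. {p. A (fst p) (snd p) \<noteq> 0 \<and> B (m - fst p) (n - snd p) \<noteq> 0}"
  have I_bound: "N \<le> fst p \<and> fst p \<le> m - M \<and> N \<le> snd p \<and> snd p \<le> n - M" if p: "p \<in> ?I m n" for p m n
  proof -
    obtain w1 w2 where "A (fst p) (snd p) w1 \<noteq> 0" "B (m - fst p) (n - snd p) w2 \<noteq> 0"
      using p by (auto simp: fun_eq_iff)
    then show ?thesis using N M by fastforce
  qed
  have finI: "finite (?I m n)" for m n
    by (rule finite_subset[of _ "{N..m - M} \<times> {N..n - M}"]) (use I_bound in \<open>force simp: mem_Times_iff\<close>, simp)
  have finA: "finite {u. A i k u \<noteq> 0}" for i k
    by (rule finite_subset[OF _ finite_words[of "nat (i + k)"]]) (auto dest!: N)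
  have finB: "finite {u. B i k u \<noteq> 0}" for i k
    by (rule finite_subset[OF _ finite_words[of "nat (i + k)"]]) (auto dest!: M)
  have 1: "smul q A B m n w = (\<Sum>(u, v) \<in> word_pairs (length w). (\<Sum>p\<in>?I m n. A (fst p) (snd p) u * B (m - fst p) (n - snd p) v) * shuf q u v w)" for m n w
    unfolding smul_def sum_fun_apply vmul_word_pairs[OF finA finB] vprod_def
    by (subst sum.swap) (simp add: case_prod_beta sum_distrib_right)
  have 2: "(\<Sum>p\<in>?I m n. A (fst p) (snd p) u * B (m - fst p) (n - snd p) v)
     = (if m + n = int (length u + length v) then lpmul (coef A u) (coef B v) n else 0)" for u v m n
  proof -
    let ?J = "{p. A (fst p) (snd p) u \<noteq> 0 \<and> B (m - fst p) (n - snd p) v \<noteq> 0}"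
    let ?K = "{k. coef A u k \<noteq> 0 \<and> coef B v (n - k) \<noteq> 0}"
    have "(\<Sum>p\<in>?I m n. A (fst p) (snd p) u * B (m - fst p) (n - snd p) v) = (\<Sum>p\<in>?J. A (fst p) (snd p) u * B (m - fst p) (n - snd p) v)"
      using finI by (intro sum.mono_neutral_right) auto
    also have "\<dots> = (if m + n = int (length u + length v) then lpmul (coef A u) (coef B v) n else 0)"
    proof (cases "m + n = int (length u + length v)")
      case False
      then have "?J = {}" using N M by fastforce
      then show ?thesis using False by (simp only: sum.empty if_False)
    next
      case True
      have m: "m - (int (length u) - k) = int (length v) - (n - k)" for k using True by simp
      have J: "?J = (\<lambda>k. (int (length u) - k, k)) ` ?K"
      proof (intro equalityI subsetI)
        fix p assume p: "p \<in> ?J"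
        then have "fst p + snd p = int (length u)" using N by blast
        then have "fst p = int (length u) - snd p" by simp
        then show "p \<in> (\<lambda>k. (int (length u) - k, k)) ` ?K" using p m[of "snd p"]
          by (intro image_eqI[of _ _ "snd p"]) (auto simp: coef_def prod_eq_iff)
      qed (auto simp: coef_def m)
      show ?thesis unfolding J using True
        by (subst sum.reindex) (auto simp: inj_on_def lpmul_def coef_def m)
    qed
    finally show ?thesis .
  qed
  show "smul q A B m n w = (if m + n = int (length w) then
     (\<Sum>(u, v) \<in> word_pairs (length w). lpmul (coef A u) (coef B v) n * shuf q u v w) else 0)"
    unfolding 1 2 by (auto simp: word_pairs_def intro!: sum.cong sum.neutral)
  show "homog (smul q A B)" unfolding homog_def
  proof (intro exI[of _ "N + M"] allI impI)
    fix m n w assume nz: "smul q A B m n w \<noteq> 0"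
    then have "m + n = int (length w)" unfolding 1 2
      by (rule contrapos_np) (auto simp: word_pairs_def intro!: sum.neutral)
    moreover have "?I m n \<noteq> {}"
    proof
      assume "?I m n = {}"
      then have "smul q A B m n = 0" unfolding smul_def by (simp only: sum.empty)
      then show False using nz by simp
    qed
    ultimately show "m + n = int (length w) \<and> N + M \<le> m \<and> N + M \<le> n"
      using I_bound[of _ m n] by fastforce
  qed
qed

lemma evs_smul:
  assumes A: "homog A" and B: "homog B" and z: "z \<noteq> 0"
  shows "evs z (smul q A B) = vprod q (evs z A) (evs z B)"
proof
  fix w
  let ?F = "\<lambda>(u, v). (\<lambda>n. shuf q u v w * lpmul (coef A u) (coef B v) n)"
  have "coef (smul q A B) w = sum ?F (word_pairs (length w))"
    by (auto simp: fun_eq_iff coef_def smul_coef[OF A B] sum_fun_apply case_prod_beta mult.commute intro!: sum.cong)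
  then have "evs z (smul q A B) w = (\<Sum>p\<in>word_pairs (length w). ev z (?F p))"
    unfolding evs_def using lp_fin_coef[OF A] lp_fin_coef[OF B] z
    by (simp only:) (intro ev_sum, auto intro!: lp_fin_scale ev_lpmul(2)[of _ _ z])
  also have "\<dots> = vprod q (evs z A) (evs z B) w"
    unfolding vprod_def evs_def using lp_fin_coef[OF A] lp_fin_coef[OF B] z
    by (intro sum.cong) (auto simp: ev_scale ev_lpmul)
  finally show "evs z (smul q A B) w = vprod q (evs z A) (evs z B) w" .
qed

lemma homog_0 [simp]: "homog 0" by (simp add: homog_def)
lemma evs_0 [simp]: "evs (z :: 'a::field) 0 = 0"
proof -
  have "coef (0 :: 'a ser) w = 0" for w by (auto simp: coef_def fun_eq_iff)
  then show ?thesis by (intro ext) (simp add: evs_def)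
qed

lemma homog_add: "homog A \<Longrightarrow> homog B \<Longrightarrow> homog (A + (B :: 'a::field ser))"
proof -
  assume "homog A" "homog B"
  then obtain N M where N: "\<And>i k w. A i k w \<noteq> 0 \<Longrightarrow> i + k = int (length w) \<and> N \<le> i \<and> N \<le> k"
    and M: "\<And>i k w. B i k w \<noteq> 0 \<Longrightarrow> i + k = int (length w) \<and> M \<le> i \<and> M \<le> k"
    unfolding homog_def by blast
  show ?thesis unfolding homog_def
  proof (intro exI[of _ "min N M"] allI impI)
    fix i k w assume "(A + B) i k w \<noteq> 0"
    then have "A i k w \<noteq> 0 \<or> B i k w \<noteq> 0" by auto
    then show "i + k = int (length w) \<and> min N M \<le> i \<and> min N M \<le> k" using N M by fastforce
  qed
qed

lemma homog_sum: "(\<And>c. c \<in> S \<Longrightarrow> homog (F c)) \<Longrightarrow> homog (sum F S :: 'a::field ser)"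
  by (induction S rule: infinite_finite_induct) (auto intro: homog_add)

lemma evs_sum:
  assumes "\<And>c. c \<in> S \<Longrightarrow> homog (F c)" "finite S"
  shows "evs z (sum F S) w = (\<Sum>c\<in>S. evs z (F c) w)"
proof -
  have "coef (sum F S) w = (\<Sum>c\<in>S. coef (F c) w)"
    by (auto simp: coef_def sum_fun_apply fun_eq_iff)
  then show ?thesis unfolding evs_def using assms by (simp add: ev_sum lp_fin_coef)
qed

definition homogm :: "nat \<Rightarrow> 'a::field ser mat \<Rightarrow> bool" where
  "homogm n A \<longleftrightarrow> (\<forall>a<n. \<forall>b<n. homog (A a b))"

lemma homogm_mmul: "homogm n A \<Longrightarrow> homogm n B \<Longrightarrow> homogm n (mmul q n A B)"
  unfolding homogm_def mmul_def by (intro allI impI homog_sum smul_coef(2)) auto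

lemma evs_mmul:
  assumes "homogm n A" "homogm n B" "z \<noteq> 0" "a < n" "b < n"
  shows "evs z (mmul q n A B a b) w = (\<Sum>c<n. vprod q (evs z (A a c)) (evs z (B c b)) w)"
  unfolding mmul_def using assms
  by (subst evs_sum) (auto simp: homogm_def evs_smul smul_coef(2))

definition vconst :: "'a::zero \<Rightarrow> 'a vec" where "vconst c = (\<lambda>w. if w = [] then c else 0)"

lemma evs_serR: "lp_fin p \<Longrightarrow> homog (serR p)" "evs z (serR p) = vconst (ev z p)"
proof -
  assume fin: "lp_fin p"
  then have "finite {e. p e \<noteq> 0}" by (simp add: lp_fin_def)
  then obtain a b where ab: "\<And>e. p e \<noteq> 0 \<Longrightarrow> a \<le> e \<and> e \<le> b"
    by (metis (mono_tags, lifting) Max_ge Min_le mem_Collect_eq)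
  show "homog (serR p)" unfolding homog_def
    by (intro exI[of _ "min a (- b)"]) (auto simp: serR_def dest!: ab split: if_splits)
next
  have "coef (serR p) w = (if w = [] then p else 0)" for w by (auto simp: coef_def serR_def fun_eq_iff)
  then show "evs z (serR p) = vconst (ev z p)" by (intro ext) (simp add: evs_def vconst_def)
qed

lemma evs_serC: "homog (serC c)" "evs z (serC c) = vconst c"
proof -
  show "homog (serC c)" unfolding homog_def by (intro exI[of _ 0]) (auto simp: serC_def split: if_splits)
  have "coef (serC c) w = (if w = [] then lp_const c else 0)" for w by (auto simp: coef_def serC_def lp_const_def fun_eq_iff)
  then show "evs z (serC c) = vconst c" by (intro ext) (simp add: evs_def vconst_def ev_lp_const)
qed

lemma evs_serS:
  assumes "\<And>e w. f e w = (if e = int (length w) then g w else 0)"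
  shows "homog (serS f)" "evs z (serS f) = g"
proof -
  show "homog (serS f)" unfolding homog_def by (intro exI[of _ 0]) (auto simp: serS_def assms split: if_splits)
  have "coef (serS f) w = lp_const (g w)" for w by (auto simp: coef_def serS_def lp_const_def fun_eq_iff assms)
  then show "evs z (serS f) = g" by (intro ext) (simp add: evs_def ev_lp_const)
qed

lemma evs_serT:
  assumes "\<And>e w. f e w = (if e = int (length w) then g w else 0)"
  shows "homog (serT f)" "evs z (serT f) = (\<lambda>w. z ^ length w * g w)"
proof -
  show "homog (serT f)" unfolding homog_def by (intro exI[of _ 0]) (auto simp: serT_def assms split: if_splits)
  have "evs z (serT f) w = z ^ length w * g w" for w unfolding evs_def
    by (subst ev_superset[of "{int (length w)}"]) (auto simp: coef_def serT_def assms split: if_splits)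
  then show "evs z (serT f) = (\<lambda>w. z ^ length w * g w)" by auto
qed

lemma vprod_vconst: "vprod q (vconst c) g w = c * g w" "vprod q f (vconst c) w = f w * c"
proof -
  have "vprod q (vconst c) g w = (\<Sum>p\<in>{([], w)}. case p of (u, v) \<Rightarrow> vconst c u * g v * shuf q u v w)"
    unfolding vprod_def by (rule sum.mono_neutral_right, simp) (auto simp: word_pairs_def vconst_def single_def split: if_splits)
  then show "vprod q (vconst c) g w = c * g w" by (simp add: vconst_def single_def)
  have "vprod q f (vconst c) w = (\<Sum>p\<in>{(w, [])}. case p of (u, v) \<Rightarrow> f u * vconst c v * shuf q u v w)"
    unfolding vprod_def by (rule sum.mono_neutral_right, simp) (auto simp: word_pairs_def vconst_def single_def split: if_splits)
  then show "vprod q f (vconst c) w = f w * c" by (simp add: vconst_def single_def)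
qed

lemma vprod_0 [simp]: "vprod q 0 g w = 0" "vprod q f 0 w = 0"
  by (auto simp: vprod_def intro!: sum.neutral)

lemma vprod_sum_left: "vprod q (\<lambda>u. (\<Sum>c\<in>S. x c * f c u) * y) g w = (\<Sum>c\<in>S. x c * y * vprod q (f c) g w)"
  unfolding vprod_def sum_distrib_left sum_distrib_right
  by (subst sum.swap) (simp add: case_prod_beta sum_distrib_left sum_distrib_right mult_ac)

section \<open>The reflection equation\<close>

lemma mult_add_less: "i < m \<Longrightarrow> k < n \<Longrightarrow> i * n + k < m * (n :: nat)"
proof -
  assume "i < m" "k < n"
  then have "i * n + k < Suc i * n" "Suc i * n \<le> m * n" by (simp, intro mult_le_mono1) simp
  then show ?thesis by linarith
qed

context qparam begin

definition Kc :: "nat \<Rightarrow> nat \<Rightarrow> nat \<Rightarrow> 'a vec" where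
  "Kc d a b w = gauge d b / gauge d a * qh powi rho2 (int a + 1) (int b + 1) (int d) * Aw d w (delta b) (d - a)"

text \<open>
  The exponent of $q^{1/2}$ common to both sides. It depends only on the total heights
  $x = b_1 + b_2$ and $y = c_1 + c_2$ and hence commutes with $R$.
\<close>

definition Kexp :: "int \<Rightarrow> int \<Rightarrow> int \<Rightarrow> int \<Rightarrow> int" where
  "Kexp d1 d2 x y = (x - y)\<^sup>2 + (d1 + d2) * (x + y) - 2 * x * y + (d1 - d1\<^sup>2) div 2 + (d2 - d2\<^sup>2) div 2 - d1 * d2"

text \<open>In terms of the final index \<open>d - a\<close> the exponent becomes symmetric in the
  two ends of the path. The remaining division is exact because d - d^2 is even.\<close>

lemma rho2_eq:
  assumes "a \<le> d"
  shows "rho2 (int a + 1) (int b + 1) (int d) = (int (d - a) - int b)\<^sup>2 + int d * (int b + int (d - a)) - 2 * int b * int (d - a) + (int d - (int d)\<^sup>2) div 2"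
proof -
  have "even (int d - (int d)\<^sup>2)" by simp
  then obtain e where e: "int d - (int d)\<^sup>2 = 2 * e" by blast
  have a: "int a = int d - int (d - a)" using assms by simp
  define c where "c = int (d - a)"
  have "2*(int a + 1)^2 + 2*(int b + 1)^2 + 3*(int d)^2 + 8*(int a + 1)*(int b + 1) - 6*(int a + 1)*int d - 6*(int b + 1)*int d - 12*(int a + 1) - 12*(int b + 1) + 13*int d + 12
    = 2 * ((c - int b)\<^sup>2 + int d * (int b + c) - 2 * int b * c) + (int d - (int d)\<^sup>2)"
    unfolding a c_def[symmetric] by (simp add: algebra_simps power2_eq_square)
  then show ?thesis unfolding rho2_def e c_def[symmetric] by simp
qed

text \<open>\<open>Rhat\<close> stands between the two K-matrices, so its exponent involves the
  column \<open>b1\<close> of the first and the row \<open>l\<close> of the second. It supplies just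
  what turns both rho into the exponent of \<open>Dw_shuffle\<close> plus a function of total
  weights; \<open>n1\<close> and \<open>n2\<close> are the heights of the two subwords.\<close>

lemma Kexp_eq:
  assumes "j \<le> d1" "l \<le> d2" and b: "int b1 + n1 = int (d1 - j)" "int b2 + n2 = int (d2 - l)"
  shows "rho2 (int j + 1) (int b1 + 1) (int d1) + rho2 (int l + 1) (int b2 + 1) (int d2) + (int d1 - 2 * int b1) * (int d2 - 2 * int l)
    = Kexp (int d1) (int d2) (int b1 + int b2) (int (d1 - j) + int (d2 - l)) +
     (- 2 * n1 * n2 + (int d1 - 2 * int (d1 - j)) * n2 - (int d2 - 2 * int (d2 - l)) * n1)"
proof -
  have n: "n1 = int (d1 - j) - int b1" "n2 = int (d2 - l) - int b2" using b by auto
  have l: "int l = int d2 - int (d2 - l)" using assms by simp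
  show ?thesis unfolding rho2_eq[OF assms(1)] rho2_eq[OF assms(2)] Kexp_def n
    by (subst l) (simp only: algebra_simps power2_eq_square)
qed

lemma vprod_Kc:
  assumes "j \<le> d1" "l \<le> d2" "b1 \<le> d1" "b2 \<le> d2"
  shows "qh powi ((int d1 - 2 * int b1) * (int d2 - 2 * int l)) *
     vprod q (\<lambda>u. s ^ length u * Kc d1 j b1 u) (\<lambda>v. t ^ length v * Kc d2 l b2 v) w
    = gauge d1 b1 * gauge d2 b2 / (gauge d1 j * gauge d2 l) * qh powi Kexp (int d1) (int d2) (int b1 + int b2) (int (d1 - j) + int (d2 - l))
      * Dw d1 d2 s t w (\<lambda>i k. delta b1 i * delta b2 k) (d1 - j) (d2 - l)"
  unfolding vprod_def Dw_shuffle[symmetric] sum_distrib_left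
proof (intro sum.cong refl, clarify)
  fix u v
  let ?g = "gauge d1 b1 * gauge d2 b2 / (gauge d1 j * gauge d2 l)"
  let ?A1 = "Aw d1 u (delta b1) (d1 - j)" and ?A2 = "Aw d2 v (delta b2) (d2 - l)"
  let ?E = "- 2 * height u * height v + (int d1 - 2 * int (d1 - j)) * height v - (int d2 - 2 * int (d2 - l)) * height u"
  have AA: "Aw d1 u (\<lambda>i. Aw d2 v (\<lambda>k. delta b1 i * delta b2 k) (d2 - l)) (d1 - j) = ?A2 * ?A1"
    unfolding Aw_scale using Aw_scale[of d1 u ?A2 "delta b1" "d1 - j"] by (simp add: mult.commute)
  have "qh powi ((int d1 - 2 * int b1) * (int d2 - 2 * int l)) * qh powi rho2 (int j + 1) (int b1 + 1) (int d1)
      * qh powi rho2 (int l + 1) (int b2 + 1) (int d2) * (?A1 * ?A2)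
     = qh powi Kexp (int d1) (int d2) (int b1 + int b2) (int (d1 - j) + int (d2 - l)) * qh powi ?E * (?A1 * ?A2)"
  \<comment> \<open>For nonzero entries \<open>Aw_delta\<close> ties the heights of \<open>u\<close>
    and \<open>v\<close> to the indices, as \<open>Kexp_eq\<close> requires.\<close>
  proof (cases "?A1 * ?A2 = 0")
    case False
    then have A: "?A1 \<noteq> 0" "?A2 \<noteq> 0" by auto
    have "int b1 + height u = int (d1 - j)" using Aw_delta[of b1 d1 "d1 - j" u] assms A by (auto split: if_splits)
    moreover have "int b2 + height v = int (d2 - l)" using Aw_delta[of b2 d2 "d2 - l" v] assms A by (auto split: if_splits)
    ultimately have "rho2 (int j + 1) (int b1 + 1) (int d1) + rho2 (int l + 1) (int b2 + 1) (int d2) + (int d1 - 2 * int b1) * (int d2 - 2 * int l)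
      = Kexp (int d1) (int d2) (int b1 + int b2) (int (d1 - j) + int (d2 - l)) + ?E"
      by (rule Kexp_eq[OF assms(1,2)])
    then show ?thesis by (simp only: power_int_add[OF disjI1[OF qh_nz], symmetric] add_ac)
  qed simp
  then show "qh powi ((int d1 - 2 * int b1) * (int d2 - 2 * int l)) * (s ^ length u * Kc d1 j b1 u * (t ^ length v * Kc d2 l b2 v) * shuf q u v w)
     = ?g * qh powi Kexp (int d1) (int d2) (int b1 + int b2) (int (d1 - j) + int (d2 - l)) *
      (shuf q u v w * (s ^ length u * t ^ length v * qh powi ?E * Aw d1 u (\<lambda>i. Aw d2 v (\<lambda>k. delta b1 i * delta b2 k) (d2 - l)) (d1 - j)))"
    unfolding AA Kc_def by (auto simp: mult.assoc)
qed

lemma Rop_scale: "Rop d d2 z (\<lambda>i k. a * f i k) i k = a * Rop d d2 z f i k"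
  using Rop_linear[of d d2 z a f 0 f i k] by simp

text \<open>An entry of R vanishes unless the total weights at its two ends agree; this form lets
  one weight replace the other inside any function \<open>g\<close>.\<close>

lemma Rop_delta_weight:
  assumes "j \<le> d1" "l \<le> d2"
  shows "g (j + l) * Rop d1 d2 z (\<lambda>i k. delta b1 i * delta b2 k) j l = g (b1 + b2) * Rop d1 d2 z (\<lambda>i k. delta b1 i * delta b2 k) j l"
proof -
  have "(\<lambda>i k. g (i + k) * (delta b1 i * delta b2 k)) = (\<lambda>i k. g (b1 + b2) * (delta b1 i * delta b2 k))"
    by (auto simp: delta_def fun_eq_iff)
  then show ?thesis using Rop_weight[OF assms, of z g "\<lambda>i k. delta b1 i * delta b2 k"] by (simp only: Rop_scale)
qed

lemma Rfull_entry:
  assumes "d1 \<ge> 1" "d2 \<ge> 1" "z \<noteq> 0" "j \<le> d1" "l \<le> d2" "b1 \<le> d1" "b2 \<le> d2"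
  shows "evm z (Rfull q qh r d1 d2) (j * Suc d2 + l) (b1 * Suc d2 + b2)
    = gauge d1 b1 * gauge d2 b2 / (gauge d1 j * gauge d2 l) * Rop d1 d2 z (\<lambda>i k. delta b1 i * delta b2 k) j l"
proof -
  let ?v = "\<lambda>c. if c = b1 * Suc d2 + b2 then 1 else 0"
  have lt: "b1 * Suc d2 + b2 < Suc d1 * Suc d2" using assms by (intro mult_add_less) auto
  have v: "?v (i * Suc d2 + k) = delta b1 i * delta b2 k" if "k \<le> d2" for i k
  proof -
    have "i * Suc d2 + k = b1 * Suc d2 + b2 \<longleftrightarrow> i = b1 \<and> k = b2"
    proof
      assume e: "i * Suc d2 + k = b1 * Suc d2 + b2"
      have "(i * Suc d2 + k) div Suc d2 = i" "(i * Suc d2 + k) mod Suc d2 = k"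
        "(b1 * Suc d2 + b2) div Suc d2 = b1" "(b1 * Suc d2 + b2) mod Suc d2 = b2"
        using that assms by (simp_all del: mult_Suc_right)
      then show "i = b1 \<and> k = b2" unfolding e by simp
    qed simp
    then show ?thesis by (auto simp: delta_def)
  qed
  have "evm z (Rfull q qh r d1 d2) (j * Suc d2 + l) (b1 * Suc d2 + b2) = mv (Suc d1 * Suc d2) (evm z (Rfull q qh r d1 d2)) ?v (j * Suc d2 + l)"
    unfolding mv_def using lt by (simp add: if_distrib cong: if_cong del: mult_Suc_right mult_Suc)
  also have "\<dots> = Rop d1 d2 z (\<lambda>i k. gauge d1 i * gauge d2 k * ?v (i * Suc d2 + k)) j l / (gauge d1 j * gauge d2 l)"
    using assms by (intro Rfull_apply) auto
  also have "Rop d1 d2 z (\<lambda>i k. gauge d1 i * gauge d2 k * ?v (i * Suc d2 + k)) j l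
     = Rop d1 d2 z (\<lambda>i k. gauge d1 b1 * gauge d2 b2 * (delta b1 i * delta b2 k)) j l"
    unfolding Rop_scale[symmetric] using assms(4,5) by (intro Rop_cong) (auto simp: v delta_def simp del: mult_Suc_right)
  finally show ?thesis unfolding Rop_scale by simp
qed

text \<open>Both sides equal \<open>Q\<close>. On the left R acts on the final indices of the paths:
  \<open>Rop_weight\<close> extracts the common power of \<open>qh\<close>, \<open>Rop_flip\<close>
  absorbs the reversal \<open>d1 - j\<close>, \<open>d2 - l\<close>, and \<open>Rop_Dw\<close>
  carries R to the initial function. On the right R acts there already, and linearity of
  \<open>Dw\<close> sums up its entries.\<close>

lemma reflection_evaluated:
  assumes d: "d1 \<ge> 1" "d2 \<ge> 1" and z: "z \<noteq> 0" and a: "a1 \<le> d1" "a2 \<le> d2" and b: "b1 \<le> d1" "b2 \<le> d2"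
  shows "(\<Sum>j<Suc d1. \<Sum>l<Suc d2. evm z (Rfull q qh r d1 d2) (a1 * Suc d2 + a2) (j * Suc d2 + l) *
       (qh powi ((int d1 - 2 * int b1) * (int d2 - 2 * int l)) * vprod q (Kc d1 j b1) (\<lambda>v. z ^ length v * Kc d2 l b2 v) w))
     = (\<Sum>j<Suc d1. \<Sum>l<Suc d2. (qh powi ((int d1 - 2 * int a1) * (int d2 - 2 * int l))
       * vprod q (\<lambda>u. z ^ length u * Kc d2 a2 l u) (Kc d1 a1 j) w) * evm z (Rfull q qh r d1 d2) (j * Suc d2 + l) (b1 * Suc d2 + b2))"
    (is "?L = ?R")
proof -
  let ?n = "Suc d2" and ?M = "evm z (Rfull q qh r d1 d2)"
  let ?dd = "\<lambda>i k. delta b1 i * delta b2 k"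
  let ?G = "Kexp (int d1) (int d2)"
  define c where "c = int (d1 - a1) + int (d2 - a2)"
  define Q where "Q = gauge d1 b1 * gauge d2 b2 / (gauge d1 a1 * gauge d2 a2) * qh powi ?G (int b1 + int b2) c
     * Dw d2 d1 z 1 w (\<lambda>k i. Rop d1 d2 z ?dd i k) (d2 - a2) (d1 - a1)"
  define X where "X j l = qh powi ((int d1 - 2 * int b1) * (int d2 - 2 * int l)) * vprod q (Kc d1 j b1) (\<lambda>v. z ^ length v * Kc d2 l b2 v) w" for j l
  define g where "g n = qh powi ?G (int b1 + int b2) (int d1 + int d2 - int n)" for n :: nat
  have X: "gauge d1 j * gauge d2 l * X j l = gauge d1 b1 * gauge d2 b2 * (g (j + l) * Dw d1 d2 1 z w ?dd (d1 - j) (d2 - l))"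
    if "j \<le> d1" "l \<le> d2" for j l
  proof -
    have "int (d1 - j) + int (d2 - l) = int d1 + int d2 - int (j + l)" using that by simp
    then show ?thesis using vprod_Kc[OF that b, of 1 z w] by (simp add: X_def g_def del: of_nat_diff of_nat_add)
  qed
  have "?L = mv (Suc d1 * ?n) ?M (\<lambda>c. X (c div ?n) (c mod ?n)) (a1 * ?n + a2)"
    unfolding mv_def sum_lessThan_mult X_def[symmetric] by (intro sum.cong refl) (auto simp del: mult_Suc_right)
  also have "\<dots> = Rop d1 d2 z (\<lambda>j l. gauge d1 j * gauge d2 l * X ((j * ?n + l) div ?n) ((j * ?n + l) mod ?n)) a1 a2 / (gauge d1 a1 * gauge d2 a2)"
    using assms by (intro Rfull_apply) auto
  also have "Rop d1 d2 z (\<lambda>j l. gauge d1 j * gauge d2 l * X ((j * ?n + l) div ?n) ((j * ?n + l) mod ?n)) a1 a2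
     = Rop d1 d2 z (\<lambda>j l. gauge d1 b1 * gauge d2 b2 * (g (j + l) * Dw d1 d2 1 z w ?dd (d1 - j) (d2 - l))) a1 a2"
    using a by (intro Rop_cong) (auto simp: X simp del: mult_Suc_right)
  also have "\<dots> = gauge d1 b1 * gauge d2 b2 * (g (a1 + a2) * Rop d1 d2 z (Dw d1 d2 1 z w ?dd) (d1 - a1) (d2 - a2))"
    unfolding Rop_scale Rop_weight[OF a, of z g "\<lambda>j l. Dw d1 d2 1 z w ?dd (d1 - j) (d2 - l)"]
      Rop_flip[OF a z, of "Dw d1 d2 1 z w ?dd"] ..
  also have "Rop d1 d2 z (Dw d1 d2 1 z w ?dd) (d1 - a1) (d2 - a2) = Dw d2 d1 z 1 w (\<lambda>k i. Rop d1 d2 z ?dd i k) (d2 - a2) (d1 - a1)"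
    using z by (intro Rop_Dw) auto
  also have "g (a1 + a2) = qh powi ?G (int b1 + int b2) c"
  proof -
    have "int d1 + int d2 - int (a1 + a2) = c" using a by (simp add: c_def)
    then show ?thesis by (simp only: g_def)
  qed
  finally have L: "?L = Q" by (simp add: Q_def)

  have "?R = (\<Sum>j<Suc d1. \<Sum>l<?n. gauge d1 b1 * gauge d2 b2 / (gauge d1 a1 * gauge d2 a2) * qh powi ?G (int b1 + int b2) c
     * (Rop d1 d2 z ?dd j l * Dw d2 d1 z 1 w (\<lambda>k i. delta l k * delta j i) (d2 - a2) (d1 - a1)))"
  proof (intro sum.cong refl)
    fix j l assume "j \<in> {..<Suc d1}" "l \<in> {..<?n}"
    then have jl: "j \<le> d1" "l \<le> d2" by auto
    have "Kexp (int d2) (int d1) (int l + int j) (int (d2 - a2) + int (d1 - a1)) = ?G (int (j + l)) c"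
      by (simp add: Kexp_def c_def add_ac mult.commute)
    then have V: "qh powi ((int d1 - 2 * int a1) * (int d2 - 2 * int l)) * vprod q (\<lambda>u. z ^ length u * Kc d2 a2 l u) (Kc d1 a1 j) w
      = gauge d2 l * gauge d1 j / (gauge d2 a2 * gauge d1 a1) * qh powi ?G (int (j + l)) c * Dw d2 d1 z 1 w (\<lambda>k i. delta l k * delta j i) (d2 - a2) (d1 - a1)"
      using vprod_Kc[OF a(2) a(1) jl(2) jl(1), of z 1 w] by (simp add: mult.commute[of "int d2 - 2 * int l"])
    have W: "qh powi ?G (int (j + l)) c * Rop d1 d2 z ?dd j l = qh powi ?G (int b1 + int b2) c * Rop d1 d2 z ?dd j l"
      using Rop_delta_weight[OF jl, of "\<lambda>n. qh powi ?G (int n) c" z b1 b2] by simp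
    show "qh powi ((int d1 - 2 * int a1) * (int d2 - 2 * int l)) * vprod q (\<lambda>u. z ^ length u * Kc d2 a2 l u) (Kc d1 a1 j) w * ?M (j * ?n + l) (b1 * ?n + b2)
      = gauge d1 b1 * gauge d2 b2 / (gauge d1 a1 * gauge d2 a2) * qh powi ?G (int b1 + int b2) c
       * (Rop d1 d2 z ?dd j l * Dw d2 d1 z 1 w (\<lambda>k i. delta l k * delta j i) (d2 - a2) (d1 - a1))"
      unfolding V Rfull_entry[OF d z jl b] using W by (auto simp: field_simps)
  qed
  also have "\<dots> = gauge d1 b1 * gauge d2 b2 / (gauge d1 a1 * gauge d2 a2) * qh powi ?G (int b1 + int b2) c
     * (\<Sum>(j, l)\<in>{..<Suc d1} \<times> {..<?n}. Rop d1 d2 z ?dd j l * Dw d2 d1 z 1 w (\<lambda>k i. delta l k * delta j i) (d2 - a2) (d1 - a1))"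
    unfolding sum.cartesian_product sum_distrib_left by (intro sum.cong) auto
  also have "(\<Sum>(j, l)\<in>{..<Suc d1} \<times> {..<?n}. Rop d1 d2 z ?dd j l * Dw d2 d1 z 1 w (\<lambda>k i. delta l k * delta j i) (d2 - a2) (d1 - a1))
     = Dw d2 d1 z 1 w (\<lambda>k i. \<Sum>(j, l)\<in>{..<Suc d1} \<times> {..<?n}. Rop d1 d2 z ?dd j l * (delta l k * delta j i)) (d2 - a2) (d1 - a1)"
    using Dw_sum[of "{..<Suc d1} \<times> {..<?n}" d2 d1 z 1 w "\<lambda>(j, l). Rop d1 d2 z ?dd j l" "\<lambda>(j, l) k i. delta l k * delta j i" "d2 - a2" "d1 - a1"]
    by (simp add: case_prod_beta)
  also have "\<dots> = Dw d2 d1 z 1 w (\<lambda>k i. Rop d1 d2 z ?dd i k) (d2 - a2) (d1 - a1)"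
  proof (rule Dw_cong)
    fix k i assume ki: "k \<le> d2" "i \<le> d1"
    have "(\<Sum>(j, l)\<in>{..<Suc d1} \<times> {..<?n}. Rop d1 d2 z ?dd j l * (delta l k * delta j i)) =
       (\<Sum>x\<in>{..<Suc d1} \<times> {..<?n}. if x = (i, k) then Rop d1 d2 z ?dd i k else 0)"
      by (intro sum.cong) (auto simp: delta_def split: if_splits)
    then show "(\<Sum>(j, l)\<in>{..<Suc d1} \<times> {..<?n}. Rop d1 d2 z ?dd j l * (delta l k * delta j i)) = Rop d1 d2 z ?dd i k"
      using ki by simp
  qed auto
  finally have R: "?R = Q" unfolding Q_def .
  show ?thesis unfolding L R ..
qed

section \<open>Evaluation of the matrices and of their products\<close>

lemma evs_entries:
  assumes "a < Suc d1 * Suc d2" "b < Suc d1 * Suc d2"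
  shows "homog (Rts q qh r d1 d2 a b)" "evs z (Rts q qh r d1 d2 a b) = vconst (evm z (Rfull q qh r d1 d2) a b)"
    "homog (Kone q qh r d1 d2 a b)" "evs z (Kone q qh r d1 d2 a b) = (if a mod Suc d2 = b mod Suc d2 then Kc d1 (a div Suc d2) (b div Suc d2) else 0)"
    "homog (Ktwo q qh r d1 d2 a b)" "evs z (Ktwo q qh r d1 d2 a b) = (if a div Suc d2 = b div Suc d2 then (\<lambda>w. z ^ length w * Kc d2 (a mod Suc d2) (b mod Suc d2) w) else 0)"
    "homog (Rhat q qh d1 d2 a b)" "evs z (Rhat q qh d1 d2 a b) = vconst (if a = b then qh powi ((int d1 - 2 * int (a div Suc d2)) * (int d2 - 2 * int (a mod Suc d2))) else 0)"
proof -
  show "homog (Rts q qh r d1 d2 a b)" "evs z (Rts q qh r d1 d2 a b) = vconst (evm z (Rfull q qh r d1 d2) a b)"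
    using finm_Rfull[of q qh r d1 d2] by (simp_all add: Rts_def evs_serR evm_def finm_def)
  have "a div Suc d2 < Suc d1" "b div Suc d2 < Suc d1" using assms by (simp_all add: less_mult_imp_div_less del: mult_Suc mult_Suc_right)
  then have 1: "a div Suc d2 \<le> d1" "b div Suc d2 \<le> d1" by auto
  have 2: "a mod Suc d2 \<le> d2" "b mod Suc d2 \<le> d2" using mod_less_divisor[of "Suc d2" a] mod_less_divisor[of "Suc d2" b] by simp_all
  note K1 = Kser_eq[OF 1, folded Kc_def] and K2 = Kser_eq[OF 2, folded Kc_def]
  show "homog (Kone q qh r d1 d2 a b)" "evs z (Kone q qh r d1 d2 a b) = (if a mod Suc d2 = b mod Suc d2 then Kc d1 (a div Suc d2) (b div Suc d2) else 0)"
    using evs_serS[OF K1] by (simp_all add: Kone_def leg12_def)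
  show "homog (Ktwo q qh r d1 d2 a b)" "evs z (Ktwo q qh r d1 d2 a b) = (if a div Suc d2 = b div Suc d2 then (\<lambda>w. z ^ length w * Kc d2 (a mod Suc d2) (b mod Suc d2) w) else 0)"
    using evs_serT[OF K2] by (simp_all add: Ktwo_def leg23_def)
  show "homog (Rhat q qh d1 d2 a b)" "evs z (Rhat q qh d1 d2 a b) = vconst (if a = b then qh powi ((int d1 - 2 * int (a div Suc d2)) * (int d2 - 2 * int (a mod Suc d2))) else 0)"
    by (auto simp: Rhat_def evs_serC vconst_def fun_eq_iff)
qed

lemma homogm_entries:
  "homogm (Suc d1 * Suc d2) (Rts q qh r d1 d2)" "homogm (Suc d1 * Suc d2) (Kone q qh r d1 d2)"
  "homogm (Suc d1 * Suc d2) (Ktwo q qh r d1 d2)" "homogm (Suc d1 * Suc d2) (Rhat q qh d1 d2)"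
  unfolding homogm_def by (intro allI impI evs_entries(1,3,5,7); assumption)+

lemma vprod_scale_left: "vprod q (\<lambda>u. f u * y) g w = y * vprod q f g w"
  using vprod_sum_left[of q "\<lambda>_. 1" "\<lambda>_. f" "{()}" y g w] by simp

lemma evs_lhs:
  fixes d1 d2 :: nat
  defines "N \<equiv> Suc d1 * Suc d2"
  assumes z: "z \<noteq> 0" and a: "a < N" and b: "b1 \<le> d1" "b2 \<le> d2"
  shows "evs z (mmul q N (mmul q N (mmul q N (Rts q qh r d1 d2) (Kone q qh r d1 d2)) (Rhat q qh d1 d2)) (Ktwo q qh r d1 d2) a (b1 * Suc d2 + b2)) w
    = (\<Sum>j<Suc d1. \<Sum>l<Suc d2. evm z (Rfull q qh r d1 d2) a (j * Suc d2 + l) *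
       (qh powi ((int d1 - 2 * int b1) * (int d2 - 2 * int l)) * vprod q (Kc d1 j b1) (\<lambda>v. z ^ length v * Kc d2 l b2 v) w))"
proof -
  let ?n = "Suc d2"
  note hom = homogm_entries[of d1 d2, folded N_def]
  note ent = evs_entries[where ?d1.0 = d1 and ?d2.0 = d2, folded N_def]
  define h where "h c = qh powi ((int d1 - 2 * int (c div ?n)) * (int d2 - 2 * int (c mod ?n)))" for c
  let ?R = "evm z (Rfull q qh r d1 d2)" and ?k1 = "\<lambda>a b. evs z (Kone q qh r d1 d2 a b)" and ?k2 = "\<lambda>a b. evs z (Ktwo q qh r d1 d2 a b)"
  define b where "b = b1 * ?n + b2"
  have bN: "b < N" unfolding b_def N_def using b by (intro mult_add_less) auto
  have 1: "evs z (mmul q N (Rts q qh r d1 d2) (Kone q qh r d1 d2) a c) u = (\<Sum>c1<N. ?R a c1 * ?k1 c1 c u)" if "c < N" for c u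
    using that a hom z by (subst evs_mmul) (auto simp: ent(2) vprod_vconst intro!: sum.cong)
  have 2: "evs z (mmul q N (mmul q N (Rts q qh r d1 d2) (Kone q qh r d1 d2)) (Rhat q qh d1 d2) a c) u = (\<Sum>c1<N. ?R a c1 * ?k1 c1 c u) * h c" if "c < N" for c u
  proof -
    have "evs z (mmul q N (mmul q N (Rts q qh r d1 d2) (Kone q qh r d1 d2)) (Rhat q qh d1 d2) a c) u
      = (\<Sum>c2<N. vprod q (evs z (mmul q N (Rts q qh r d1 d2) (Kone q qh r d1 d2) a c2)) (evs z (Rhat q qh d1 d2 c2 c)) u)"
      using that a hom z by (intro evs_mmul homogm_mmul)
    also have "\<dots> = (\<Sum>c2<N. if c2 = c then (\<Sum>c1<N. ?R a c1 * ?k1 c1 c u) * h c else 0)"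
      using that by (intro sum.cong refl) (auto simp: ent(8) vprod_vconst 1 h_def)
    finally show ?thesis using that by simp
  qed
  have "evs z (mmul q N (mmul q N (mmul q N (Rts q qh r d1 d2) (Kone q qh r d1 d2)) (Rhat q qh d1 d2)) (Ktwo q qh r d1 d2) a b) w
    = (\<Sum>c<N. vprod q (\<lambda>u. (\<Sum>c1<N. ?R a c1 * ?k1 c1 c u) * h c) (?k2 c b) w)"
  proof -
    have "evs z (mmul q N (mmul q N (Rts q qh r d1 d2) (Kone q qh r d1 d2)) (Rhat q qh d1 d2) a c)
        = (\<lambda>u. (\<Sum>c1<N. ?R a c1 * ?k1 c1 c u) * h c)" if "c < N" for c
      using 2[OF that] by (rule ext)
    then show ?thesis using a bN hom z by (subst evs_mmul) (auto simp: homogm_mmul intro!: sum.cong)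
  qed
  also have "\<dots> = (\<Sum>c1<N. \<Sum>c<N. ?R a c1 * h c * vprod q (?k1 c1 c) (?k2 c b) w)"
    unfolding vprod_sum_left by (rule sum.swap)
  also have "\<dots> = (\<Sum>j<Suc d1. \<Sum>l<?n. \<Sum>i<Suc d1. \<Sum>k<?n. ?R a (j * ?n + l) * h (i * ?n + k) * vprod q (?k1 (j * ?n + l) (i * ?n + k)) (?k2 (i * ?n + k) b) w)"
    unfolding N_def sum_lessThan_mult ..
  \<comment> \<open>The first K-matrix is the identity on the second factor and the second one on
    the first, so only \<open>k = l\<close> and \<open>i = b1\<close> survive.\<close>
  also have "\<dots> = (\<Sum>j<Suc d1. \<Sum>l<?n. \<Sum>i<Suc d1. \<Sum>k<?n. if k = l then if i = b1 then ?R a (j * ?n + l) *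
       (qh powi ((int d1 - 2 * int b1) * (int d2 - 2 * int l)) * vprod q (Kc d1 j b1) (\<lambda>v. z ^ length v * Kc d2 l b2 v) w) else 0 else 0)"
  proof (intro sum.cong refl)
    fix j l i k assume "j \<in> {..<Suc d1}" "l \<in> {..<?n}" "i \<in> {..<Suc d1}" "k \<in> {..<?n}"
    then have lt: "j < Suc d1" "l < ?n" "i < Suc d1" "k < ?n" by auto
    then have N: "j * ?n + l < N" "i * ?n + k < N" unfolding N_def by (auto intro!: mult_add_less simp del: mult_Suc mult_Suc_right)
    show "?R a (j * ?n + l) * h (i * ?n + k) * vprod q (?k1 (j * ?n + l) (i * ?n + k)) (?k2 (i * ?n + k) b) w
      = (if k = l then if i = b1 then ?R a (j * ?n + l) *
       (qh powi ((int d1 - 2 * int b1) * (int d2 - 2 * int l)) * vprod q (Kc d1 j b1) (\<lambda>v. z ^ length v * Kc d2 l b2 v) w) else 0 else 0)"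
      unfolding ent(4)[OF N] ent(6)[OF N(2) bN] using lt b by (auto simp: h_def b_def simp del: mult_Suc mult_Suc_right)
  qed
  also have "\<dots> = (\<Sum>j<Suc d1. \<Sum>l<?n. ?R a (j * ?n + l) *
       (qh powi ((int d1 - 2 * int b1) * (int d2 - 2 * int l)) * vprod q (Kc d1 j b1) (\<lambda>v. z ^ length v * Kc d2 l b2 v) w))"
    using b by (intro sum.cong refl) (auto simp del: sum.lessThan_Suc mult_Suc mult_Suc_right)
  finally show ?thesis unfolding b_def .
qed

lemma evs_rhs:
  fixes d1 d2 :: nat
  defines "N \<equiv> Suc d1 * Suc d2"
  assumes z: "z \<noteq> 0" and b: "b < N" and a: "a1 \<le> d1" "a2 \<le> d2"
  shows "evs z (mmul q N (mmul q N (mmul q N (Ktwo q qh r d1 d2) (Rhat q qh d1 d2)) (Kone q qh r d1 d2)) (Rts q qh r d1 d2) (a1 * Suc d2 + a2) b) w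
    = (\<Sum>j<Suc d1. \<Sum>l<Suc d2. (qh powi ((int d1 - 2 * int a1) * (int d2 - 2 * int l))
       * vprod q (\<lambda>u. z ^ length u * Kc d2 a2 l u) (Kc d1 a1 j) w) * evm z (Rfull q qh r d1 d2) (j * Suc d2 + l) b)"
proof -
  let ?n = "Suc d2"
  note hom = homogm_entries[of d1 d2, folded N_def]
  note ent = evs_entries[where ?d1.0 = d1 and ?d2.0 = d2, folded N_def]
  define h where "h c = qh powi ((int d1 - 2 * int (c div ?n)) * (int d2 - 2 * int (c mod ?n)))" for c
  let ?R = "evm z (Rfull q qh r d1 d2)" and ?k1 = "\<lambda>a b. evs z (Kone q qh r d1 d2 a b)" and ?k2 = "\<lambda>a b. evs z (Ktwo q qh r d1 d2 a b)"
  define a where "a = a1 * ?n + a2"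
  have aN: "a < N" unfolding a_def N_def using a by (intro mult_add_less) auto
  have 1: "evs z (mmul q N (Ktwo q qh r d1 d2) (Rhat q qh d1 d2) a c) u = ?k2 a c u * h c" if "c < N" for c u
  proof -
    have "evs z (mmul q N (Ktwo q qh r d1 d2) (Rhat q qh d1 d2) a c) u = (\<Sum>c2<N. vprod q (?k2 a c2) (evs z (Rhat q qh d1 d2 c2 c)) u)"
      using that aN hom z by (intro evs_mmul)
    also have "\<dots> = (\<Sum>c2<N. if c2 = c then ?k2 a c u * h c else 0)"
      using that by (intro sum.cong refl) (auto simp: ent(8) vprod_vconst h_def)
    finally show ?thesis using that by simp
  qed
  have 2: "evs z (mmul q N (mmul q N (Ktwo q qh r d1 d2) (Rhat q qh d1 d2)) (Kone q qh r d1 d2) a c) u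
     = (\<Sum>c2<N. h c2 * vprod q (?k2 a c2) (?k1 c2 c) u)" if "c < N" for c u
  proof -
    have "evs z (mmul q N (Ktwo q qh r d1 d2) (Rhat q qh d1 d2) a c) = (\<lambda>u. ?k2 a c u * h c)" if "c < N" for c
      using 1[OF that] by (rule ext)
    then show ?thesis using that aN hom z
      by (subst evs_mmul) (auto simp: homogm_mmul vprod_scale_left intro!: sum.cong)
  qed
  have 3: "(\<Sum>c2<N. h c2 * vprod q (?k2 a c2) (?k1 c2 (j * ?n + l)) w)
     = qh powi ((int d1 - 2 * int a1) * (int d2 - 2 * int l)) * vprod q (\<lambda>u. z ^ length u * Kc d2 a2 l u) (Kc d1 a1 j) w"
    if jl: "j < Suc d1" "l < ?n" for j l
  proof -
    have jN: "j * ?n + l < N" unfolding N_def using jl by (rule mult_add_less)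
    have "(\<Sum>c2<N. h c2 * vprod q (?k2 a c2) (?k1 c2 (j * ?n + l)) w) = (\<Sum>i<Suc d1. \<Sum>k<?n. h (i * ?n + k) * vprod q (?k2 a (i * ?n + k)) (?k1 (i * ?n + k) (j * ?n + l)) w)"
      unfolding N_def sum_lessThan_mult ..
    \<comment> \<open>The order of the K-matrices is reversed here, so \<open>i\<close> is tied to
      the row index \<open>a1\<close> and \<open>k\<close> to the inner index
      \<open>l\<close>.\<close>
    also have "\<dots> = (\<Sum>i<Suc d1. \<Sum>k<?n. if k = l then if i = a1 then
      qh powi ((int d1 - 2 * int a1) * (int d2 - 2 * int l)) * vprod q (\<lambda>u. z ^ length u * Kc d2 a2 l u) (Kc d1 a1 j) w else 0 else 0)"
    proof (intro sum.cong refl)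
      fix i k assume "i \<in> {..<Suc d1}" "k \<in> {..<?n}"
      then have lt: "i < Suc d1" "k < ?n" by auto
      then have iN: "i * ?n + k < N" unfolding N_def by (rule mult_add_less)
      show "h (i * ?n + k) * vprod q (?k2 a (i * ?n + k)) (?k1 (i * ?n + k) (j * ?n + l)) w
       = (if k = l then if i = a1 then
      qh powi ((int d1 - 2 * int a1) * (int d2 - 2 * int l)) * vprod q (\<lambda>u. z ^ length u * Kc d2 a2 l u) (Kc d1 a1 j) w else 0 else 0)"
        unfolding ent(4)[OF iN jN] ent(6)[OF aN iN] using lt jl a by (auto simp: h_def a_def simp del: mult_Suc mult_Suc_right)
    qed
    also have "\<dots> = qh powi ((int d1 - 2 * int a1) * (int d2 - 2 * int l)) * vprod q (\<lambda>u. z ^ length u * Kc d2 a2 l u) (Kc d1 a1 j) w"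
      using a jl by (auto simp del: sum.lessThan_Suc mult_Suc mult_Suc_right)
    finally show ?thesis .
  qed
  have "evs z (mmul q N (mmul q N (mmul q N (Ktwo q qh r d1 d2) (Rhat q qh d1 d2)) (Kone q qh r d1 d2)) (Rts q qh r d1 d2) a b) w
    = (\<Sum>c<N. (\<Sum>c2<N. h c2 * vprod q (?k2 a c2) (?k1 c2 c) w) * ?R c b)"
    using aN b hom z by (subst evs_mmul) (auto simp: homogm_mmul ent(2) vprod_vconst 2 intro!: sum.cong)
  also have "\<dots> = (\<Sum>j<Suc d1. \<Sum>l<?n. (\<Sum>c2<N. h c2 * vprod q (?k2 a c2) (?k1 c2 (j * ?n + l)) w) * ?R (j * ?n + l) b)"
    by (subst N_def) (rule sum_lessThan_mult)
  also have "\<dots> = (\<Sum>j<Suc d1. \<Sum>l<?n. (qh powi ((int d1 - 2 * int a1) * (int d2 - 2 * int l))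
       * vprod q (\<lambda>u. z ^ length u * Kc d2 a2 l u) (Kc d1 a1 j) w) * ?R (j * ?n + l) b)"
    by (intro sum.cong refl arg_cong[of _ _ "\<lambda>x. x * _"] 3) auto
  finally show ?thesis unfolding a_def .
qed

end

theorem theorem3p10:
  fixes q qh :: "'a::field_char_0" and r :: "nat \<Rightarrow> 'a" and d1 d2 :: nat
  assumes sqrts: "\<forall>z::'a. \<exists>w. w * w = z"
    and q_nz: "q \<noteq> 0"
    and q_not_root: "\<forall>n::nat. n > 0 \<longrightarrow> q ^ n \<noteq> 1"
    and qh_def: "qh * qh = q"
    and r_sqrt: "\<forall>n. r n * r n = qint q (int n)"
    and d1: "d1 \<ge> 1" and d2: "d2 \<ge> 1"
  shows "\<forall>a < (d1 + 1) * (d2 + 1). \<forall>b < (d1 + 1) * (d2 + 1).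
    mmul q ((d1 + 1) * (d2 + 1))
      (mmul q ((d1 + 1) * (d2 + 1))
        (mmul q ((d1 + 1) * (d2 + 1)) (Rts q qh r d1 d2) (Kone q qh r d1 d2))
        (Rhat q qh d1 d2))
      (Ktwo q qh r d1 d2) a b
  = mmul q ((d1 + 1) * (d2 + 1))
      (mmul q ((d1 + 1) * (d2 + 1))
        (mmul q ((d1 + 1) * (d2 + 1)) (Ktwo q qh r d1 d2) (Rhat q qh d1 d2))
        (Kone q qh r d1 d2))
      (Rts q qh r d1 d2) a b"
proof (intro allI impI, unfold Suc_eq_plus1[symmetric])
  interpret qparam q qh r by standard (use assms in auto)
  fix a b
  let ?N = "Suc d1 * Suc d2"
  assume a: "a < ?N" and b: "b < ?N"
  have split: "\<exists>i k. c = i * Suc d2 + k \<and> i \<le> d1 \<and> k \<le> d2" if "c < ?N" for c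
  proof (intro exI conjI)
    show "c = c div Suc d2 * Suc d2 + c mod Suc d2" by (simp del: mult_Suc_right)
    show "c div Suc d2 \<le> d1" using less_mult_imp_div_less[OF that] by simp
    show "c mod Suc d2 \<le> d2" using mod_less_divisor[of "Suc d2" c] by simp
  qed
  obtain a1 a2 b1 b2 where ab: "a = a1 * Suc d2 + a2" "a1 \<le> d1" "a2 \<le> d2" "b = b1 * Suc d2 + b2" "b1 \<le> d1" "b2 \<le> d2"
    using split[OF a] split[OF b] by blast
  show "mmul q ?N (mmul q ?N (mmul q ?N (Rts q qh r d1 d2) (Kone q qh r d1 d2)) (Rhat q qh d1 d2)) (Ktwo q qh r d1 d2) a b
    = mmul q ?N (mmul q ?N (mmul q ?N (Ktwo q qh r d1 d2) (Rhat q qh d1 d2)) (Kone q qh r d1 d2)) (Rts q qh r d1 d2) a b"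
  \<comment> \<open>It suffices to compare the two series at s = 1 and t = z for every nonzero
    z.\<close>
  proof (rule homog_eqI)
    have "homogm ?N (mmul q ?N (mmul q ?N (mmul q ?N (Rts q qh r d1 d2) (Kone q qh r d1 d2)) (Rhat q qh d1 d2)) (Ktwo q qh r d1 d2))"
      "homogm ?N (mmul q ?N (mmul q ?N (mmul q ?N (Ktwo q qh r d1 d2) (Rhat q qh d1 d2)) (Kone q qh r d1 d2)) (Rts q qh r d1 d2))"
      by (intro homogm_mmul homogm_entries)+
    then show "homog (mmul q ?N (mmul q ?N (mmul q ?N (Rts q qh r d1 d2) (Kone q qh r d1 d2)) (Rhat q qh d1 d2)) (Ktwo q qh r d1 d2) a b)"
      "homog (mmul q ?N (mmul q ?N (mmul q ?N (Ktwo q qh r d1 d2) (Rhat q qh d1 d2)) (Kone q qh r d1 d2)) (Rts q qh r d1 d2) a b)"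
      using a b by (auto simp: homogm_def simp del: mult_Suc mult_Suc_right)
  next
    fix z :: 'a and w assume z: "z \<noteq> 0"
    show "evs z (mmul q ?N (mmul q ?N (mmul q ?N (Rts q qh r d1 d2) (Kone q qh r d1 d2)) (Rhat q qh d1 d2)) (Ktwo q qh r d1 d2) a b) w
      = evs z (mmul q ?N (mmul q ?N (mmul q ?N (Ktwo q qh r d1 d2) (Rhat q qh d1 d2)) (Kone q qh r d1 d2)) (Rts q qh r d1 d2) a b) w"
      using evs_lhs[OF z a ab(5,6), of w] evs_rhs[OF z b ab(2,3), of w]
        reflection_evaluated[OF d1 d2 z ab(2,3,5,6), of w]
      unfolding ab(1,4) by simp
  qed
qed

end
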